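(* Let $(\underline{\mathcal C},\underline x)$ be a $G$-$A$-coring with a fixed grouplike family, $T=A^{\mathrm{co}\,\underline{\mathcal C}}$, and $i:B\to T$ a ring morphism. Then: (1) if $F_7$ is fully faithful, then $i:B\to T$ is an isomorphism; (2) if $G_7$ is fully faithful, then $\underline{\mathrm{can}}:\underline{\mathcal D}\to\underline{\mathcal C}$ is an isomorphism of $G$-$A$-corings, where $\underline{\mathcal D}=(A\otimes_BA)\langle G\rangle$.
   Context: $G$ is a group with unit $e$, $A$ is a ring with unit. A $G$-$A$-coring (group coring) $\underline{\mathcal C}$ is a family $(\mathcal C_\alpha)_{\alpha\in G}$ of $A$-bimodules with $A$-bimodule maps $\Delta_{\alpha,\beta}:\mathcal C_{\alpha\beta}\to\mathcal C_\alpha\otimes_A\mathcal C_\beta$ and $\varepsilon:\mathcal C_e\to A$ such that, for all $\alpha,\beta,\gamma\in G$, $(\Delta_{\alpha,\beta}\otimes_A\mathcal C_\gamma)\circ\Delta_{\alpha\beta,\gamma}=(\mathcal C_\alpha\otimes_A\Delta_{\beta,\gamma})\circ\Delta_{\alpha,\beta\gamma}$ and $(\mathcal C_\alpha\otimes_A\varepsilon)\circ\Delta_{\alpha,e}=\mathcal C_\alpha=(\varepsilon\otimes_A\mathcal C_\alpha)\circ\Delta_{e,\alpha}$ (an object also denotes its identity map). A morphism of $G$-$A$-corings is a family of bimodule maps $f_\alpha$ with $(f_\alpha\otimes_Af_\beta)\circ\Delta_{\alpha,\beta}=\Delta_{\alpha,\beta}\circ f_{\alpha\beta}$ and $\varepsilon\circ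 f_e=\varepsilon$. A right $G$-$\underline{\mathcal C}$-comodule is a family $\underline M=(M_\alpha)_{\alpha\in G}$ of right $A$-modules with right $A$-linear maps $\rho_{\alpha,\beta}:M_{\alpha\beta}\to M_\alpha\otimes_A\mathcal C_\beta$ such that $(M_\alpha\otimes_A\Delta_{\beta,\gamma})\circ\rho_{\alpha,\beta\gamma}=(\rho_{\alpha,\beta}\otimes_A\mathcal C_\gamma)\circ\rho_{\alpha\beta,\gamma}$ and $(M_\alpha\otimes_A\varepsilon)\circ\rho_{\alpha,e}=M_\alpha$. Morphisms are families of right $A$-linear maps $f_\alpha:M_\alpha\to N_\alpha$ with $(f_\alpha\otimes_A\mathcal C_\beta)\circ\rho_{\alpha,\beta}=\rho_{\alpha,\beta}\circ f_{\alpha\beta}$. The category is $\mathcal M^{G,\underline{\mathcal C}}$; $\mathcal M_B$ is the category of right $B$-modules. A grouplike family is $\underline x=(x_\alpha)_{\alpha\in G}\in\prod_\alpha\mathcal C_\alpha$ with $\Delta_{\alpha,\beta}(x_{\alpha\beta})=x_\alpha\otimes_Ax_\beta$ and $\varepsilon(x_e)=1$. $A^{\mathrm{co}\,\underline{\mathcal C}}=\{a\in A\mid ax_\alpha=x_\alpha a\ \forall\alpha\in G\}$, a subring of $A$. $\mu_\alpha(M)$ is an isomorphic copy of a module $M$ indexed by $\alpha\in G$. $F_7:\mathcal M_B\to\mathcal M^{G,\underline{\mathcal C}}$ is $F_7(N)=(\mu_\alpha(N\otimes_BA))_\alpha$ with $\rho_{\alpha,\beta}(\mu_{\alpha\beta}(n\otimes_Ba))=\mu_\alpha(n\otimes_B1_A)\otimes_Ax_\beta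 a$. Its right adjoint is $G_7(\underline M)=\{(m_\alpha)_\alpha\in\prod_\alpha M_\alpha\mid\rho_{\alpha,\beta}(m_{\alpha\beta})=m_\alpha\otimes_Ax_\beta\ \forall\alpha,\beta\in G\}$ with componentwise right $B$-action. $\underline{\mathcal D}=(A\otimes_BA)\langle G\rangle$ is the $G$-$A$-coring $(\mu_\alpha(A\otimes_BA))_{\alpha}$ with $\Delta_{\alpha,\beta}(\mu_{\alpha\beta}(a\otimes_Bb))=\mu_\alpha(a\otimes_B1_A)\otimes_A\mu_\beta(1_A\otimes_Bb)$ and $\varepsilon(\mu_e(a\otimes_Bb))=ab$; $\underline{\mathrm{can}}:\underline{\mathcal D}\to\underline{\mathcal C}$ is the morphism of $G$-$A$-corings $\mathrm{can}_\alpha(\mu_\alpha(a\otimes_Bb))=ax_\alpha b$. *)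

theory Defs
  imports "HOL-Algebra.Algebra"
begin

section \<open>Modules and bimodules over noncommutative rings\<close>

text \<open>Only the additive structure of a module record is meaningful: the inherited fields
  \<^term>\<open>monoid.mult\<close> and \<^term>\<open>monoid.one\<close> are never used. Morphisms are extensional, so that two
  morphisms are equal iff they agree on the carrier.\<close>

record ('r, 'm) rmod = "'m ring" +
  ract :: "'m \<Rightarrow> 'r \<Rightarrow> 'm"  (infixl "\<triangleleft>\<index>" 72)

record ('l, 'r, 'm) bimod = "('r, 'm) rmod" +
  lact :: "'l \<Rightarrow> 'm \<Rightarrow> 'm"  (infixr "\<triangleright>\<index>" 72)

locale right_module = R?: ring R + M?: abelian_group M
  for R :: "('r, 'x) ring_scheme" (structure) and M :: "('r, 'm, 'y) rmod_scheme" (structure) +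
  assumes ract_closed:
      "\<lbrakk>m \<in> carrier M; r \<in> carrier R\<rbrakk> \<Longrightarrow> m \<triangleleft>\<^bsub>M\<^esub> r \<in> carrier M"
    and ract_add_left:
      "\<lbrakk>m \<in> carrier M; n \<in> carrier M; r \<in> carrier R\<rbrakk>
        \<Longrightarrow> (m \<oplus>\<^bsub>M\<^esub> n) \<triangleleft>\<^bsub>M\<^esub> r = m \<triangleleft>\<^bsub>M\<^esub> r \<oplus>\<^bsub>M\<^esub> n \<triangleleft>\<^bsub>M\<^esub> r"
    and ract_add_right:
      "\<lbrakk>m \<in> carrier M; r \<in> carrier R; s \<in> carrier R\<rbrakk>
        \<Longrightarrow> m \<triangleleft>\<^bsub>M\<^esub> (r \<oplus>\<^bsub>R\<^esub> s) = m \<triangleleft>\<^bsub>M\<^esub> r \<oplus>\<^bsub>M\<^esub> m \<triangleleft>\<^bsub>M\<^esub> s"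
    and ract_mult:
      "\<lbrakk>m \<in> carrier M; r \<in> carrier R; s \<in> carrier R\<rbrakk>
        \<Longrightarrow> m \<triangleleft>\<^bsub>M\<^esub> (r \<otimes>\<^bsub>R\<^esub> s) = (m \<triangleleft>\<^bsub>M\<^esub> r) \<triangleleft>\<^bsub>M\<^esub> s"
    and ract_one:
      "m \<in> carrier M \<Longrightarrow> m \<triangleleft>\<^bsub>M\<^esub> \<one>\<^bsub>R\<^esub> = m"

locale bimodule = L?: ring L + right_module R M
  for L :: "('l, 'z) ring_scheme" (structure)
    and R :: "('r, 'x) ring_scheme" (structure)
    and M :: "('l, 'r, 'm, 'y) bimod_scheme" (structure) +
  assumes lact_closed:
      "\<lbrakk>l \<in> carrier L; m \<in> carrier M\<rbrakk> \<Longrightarrow> l \<triangleright>\<^bsub>M\<^esub> m \<in> carrier M"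
    and lact_add_right:
      "\<lbrakk>l \<in> carrier L; m \<in> carrier M; n \<in> carrier M\<rbrakk>
        \<Longrightarrow> l \<triangleright>\<^bsub>M\<^esub> (m \<oplus>\<^bsub>M\<^esub> n) = l \<triangleright>\<^bsub>M\<^esub> m \<oplus>\<^bsub>M\<^esub> l \<triangleright>\<^bsub>M\<^esub> n"
    and lact_add_left:
      "\<lbrakk>k \<in> carrier L; l \<in> carrier L; m \<in> carrier M\<rbrakk>
        \<Longrightarrow> (k \<oplus>\<^bsub>L\<^esub> l) \<triangleright>\<^bsub>M\<^esub> m = k \<triangleright>\<^bsub>M\<^esub> m \<oplus>\<^bsub>M\<^esub> l \<triangleright>\<^bsub>M\<^esub> m"
    and lact_mult:
      "\<lbrakk>k \<in> carrier L; l \<in> carrier L; m \<in> carrier M\<rbrakk>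
        \<Longrightarrow> (k \<otimes>\<^bsub>L\<^esub> l) \<triangleright>\<^bsub>M\<^esub> m = k \<triangleright>\<^bsub>M\<^esub> (l \<triangleright>\<^bsub>M\<^esub> m)"
    and lact_one:
      "m \<in> carrier M \<Longrightarrow> \<one>\<^bsub>L\<^esub> \<triangleright>\<^bsub>M\<^esub> m = m"
    and lact_ract:
      "\<lbrakk>l \<in> carrier L; m \<in> carrier M; r \<in> carrier R\<rbrakk>
        \<Longrightarrow> (l \<triangleright>\<^bsub>M\<^esub> m) \<triangleleft>\<^bsub>M\<^esub> r = l \<triangleright>\<^bsub>M\<^esub> (m \<triangleleft>\<^bsub>M\<^esub> r)"

definition rmod_hom ::
  "('r, 'x) ring_scheme \<Rightarrow> ('r, 'm, 'y) rmod_scheme \<Rightarrow> ('r, 'n, 'z) rmod_scheme \<Rightarrow> ('m \<Rightarrow> 'n) set"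
  where "rmod_hom R M N =
    {f \<in> extensional (carrier M) \<inter> hom (add_monoid M) (add_monoid N).
      \<forall>m\<in>carrier M. \<forall>r\<in>carrier R. f (m \<triangleleft>\<^bsub>M\<^esub> r) = f m \<triangleleft>\<^bsub>N\<^esub> r}"

definition bimod_hom ::
  "('l, 'w) ring_scheme \<Rightarrow> ('r, 'x) ring_scheme \<Rightarrow> ('l, 'r, 'm, 'y) bimod_scheme
    \<Rightarrow> ('l, 'r, 'n, 'z) bimod_scheme \<Rightarrow> ('m \<Rightarrow> 'n) set"
  where "bimod_hom L R M N =
    {f \<in> rmod_hom R M N. \<forall>l\<in>carrier L. \<forall>m\<in>carrier M. f (l \<triangleright>\<^bsub>M\<^esub> m) = l \<triangleright>\<^bsub>N\<^esub> f m}"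

text \<open>The ring \<open>A\<close> as a bimodule, with scalars acting from the left through \<open>f\<close> and from the
  right through \<open>g\<close>.\<close>

definition ring_bimod ::
  "('a, 'x) ring_scheme \<Rightarrow> ('l \<Rightarrow> 'a) \<Rightarrow> ('r \<Rightarrow> 'a) \<Rightarrow> ('l, 'r, 'a) bimod"
  where "ring_bimod A f g =
    \<lparr>carrier = carrier A, monoid.mult = monoid.mult A, one = one A,
     ring.zero = ring.zero A, ring.add = ring.add A,
     ract = (\<lambda>a r. a \<otimes>\<^bsub>A\<^esub> g r), lact = (\<lambda>l a. f l \<otimes>\<^bsub>A\<^esub> a)\<rparr>"

abbreviation regular_bimod :: "('a, 'x) ring_scheme \<Rightarrow> ('a, 'a, 'a) bimod"
  where "regular_bimod A \<equiv> ring_bimod A (\<lambda>a. a) (\<lambda>a. a)"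


section \<open>Tensor products\<close>

type_synonym ('m, 'n) tens = "('m \<times> 'n \<Rightarrow>\<^sub>0 int) set"

definition tensor_rels ::
  "('r, 'w) ring_scheme \<Rightarrow> ('r, 'm, 'x) rmod_scheme \<Rightarrow> ('r, 's, 'n, 'y) bimod_scheme
    \<Rightarrow> ('m \<times> 'n \<Rightarrow>\<^sub>0 int) set"
  where "tensor_rels R M N =
    {frag_of (m \<oplus>\<^bsub>M\<^esub> m', n) - frag_of (m, n) - frag_of (m', n) | m m' n.
       m \<in> carrier M \<and> m' \<in> carrier M \<and> n \<in> carrier N}
    \<union> {frag_of (m, n \<oplus>\<^bsub>N\<^esub> n') - frag_of (m, n) - frag_of (m, n') | m n n'.
       m \<in> carrier M \<and> n \<in> carrier N \<and> n' \<in> carrier N}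
    \<union> {frag_of (m \<triangleleft>\<^bsub>M\<^esub> r, n) - frag_of (m, r \<triangleright>\<^bsub>N\<^esub> n) | m r n.
       m \<in> carrier M \<and> r \<in> carrier R \<and> n \<in> carrier N}"

definition tensor_subgroup ::
  "('r, 'w) ring_scheme \<Rightarrow> ('r, 'm, 'x) rmod_scheme \<Rightarrow> ('r, 's, 'n, 'y) bimod_scheme
    \<Rightarrow> ('m \<times> 'n \<Rightarrow>\<^sub>0 int) set"
  where "tensor_subgroup R M N =
    generate (free_Abelian_group (carrier M \<times> carrier N)) (tensor_rels R M N)"

text \<open>The abelian group \<open>M \<otimes>\<^sub>R N\<close>, for a right \<open>R\<close>-module \<open>M\<close> and a left \<open>R\<close>-module \<open>N\<close> (the right
  action on \<open>N\<close> plays no role here).\<close>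

definition tensor_group ::
  "('r, 'w) ring_scheme \<Rightarrow> ('r, 'm, 'x) rmod_scheme \<Rightarrow> ('r, 's, 'n, 'y) bimod_scheme
    \<Rightarrow> ('m, 'n) tens ring"
  where "tensor_group R M N =
    (let Q = free_Abelian_group (carrier M \<times> carrier N) Mod tensor_subgroup R M N
     in \<lparr>carrier = carrier Q, monoid.mult = undefined, one = undefined,
         ring.zero = one Q, ring.add = monoid.mult Q\<rparr>)"

definition tensor ::
  "('r, 'w) ring_scheme \<Rightarrow> ('r, 'm, 'x) rmod_scheme \<Rightarrow> ('r, 's, 'n, 'y) bimod_scheme
    \<Rightarrow> 'm \<Rightarrow> 'n \<Rightarrow> ('m, 'n) tens"
  where "tensor R M N m n =
    tensor_subgroup R M N #>\<^bsub>free_Abelian_group (carrier M \<times> carrier N)\<^esub> frag_of (m, n)"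

text \<open>The additive map \<open>M \<otimes>\<^sub>R N \<rightarrow> P\<close> given on pure tensors by \<open>m \<otimes> n \<mapsto> h m n\<close>. It is unique, as pure
  tensors generate, and it exists when \<open>h\<close> is additive in both arguments and \<open>R\<close>-balanced; this is
  the case wherever it is used below.\<close>

definition tensor_lift ::
  "('r, 'w) ring_scheme \<Rightarrow> ('r, 'm, 'x) rmod_scheme \<Rightarrow> ('r, 's, 'n, 'y) bimod_scheme
    \<Rightarrow> ('p, 'z) ring_scheme \<Rightarrow> ('m \<Rightarrow> 'n \<Rightarrow> 'p) \<Rightarrow> ('m, 'n) tens \<Rightarrow> 'p"
  where "tensor_lift R M N P h =
    (THE \<phi>. \<phi> \<in> extensional (carrier (tensor_group R M N))
       \<and> \<phi> \<in> hom (add_monoid (tensor_group R M N)) (add_monoid P)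
       \<and> (\<forall>m\<in>carrier M. \<forall>n\<in>carrier N. \<phi> (tensor R M N m n) = h m n))"

definition tensor_ract ::
  "('r, 'w) ring_scheme \<Rightarrow> ('r, 'm, 'x) rmod_scheme \<Rightarrow> ('r, 's, 'n, 'y) bimod_scheme
    \<Rightarrow> ('m, 'n) tens \<Rightarrow> 's \<Rightarrow> ('m, 'n) tens"
  where "tensor_ract R M N t s =
    tensor_lift R M N (tensor_group R M N) (\<lambda>m n. tensor R M N m (n \<triangleleft>\<^bsub>N\<^esub> s)) t"

definition tensor_lact ::
  "('r, 'w) ring_scheme \<Rightarrow> ('l, 'r, 'm, 'x) bimod_scheme \<Rightarrow> ('r, 's, 'n, 'y) bimod_scheme
    \<Rightarrow> 'l \<Rightarrow> ('m, 'n) tens \<Rightarrow> ('m, 'n) tens"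
  where "tensor_lact R M N l t =
    tensor_lift R M N (tensor_group R M N) (\<lambda>m n. tensor R M N (l \<triangleright>\<^bsub>M\<^esub> m) n) t"

definition tensor_rmod ::
  "('r, 'w) ring_scheme \<Rightarrow> ('r, 'm, 'x) rmod_scheme \<Rightarrow> ('r, 's, 'n, 'y) bimod_scheme
    \<Rightarrow> ('s, ('m, 'n) tens) rmod"
  where "tensor_rmod R M N =
    (let T = tensor_group R M N
     in \<lparr>carrier = carrier T, monoid.mult = monoid.mult T, one = one T,
         ring.zero = ring.zero T, ring.add = ring.add T, ract = tensor_ract R M N\<rparr>)"

definition tensor_bimod ::
  "('r, 'w) ring_scheme \<Rightarrow> ('l, 'r, 'm, 'x) bimod_scheme \<Rightarrow> ('r, 's, 'n, 'y) bimod_scheme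
    \<Rightarrow> ('l, 's, ('m, 'n) tens) bimod"
  where "tensor_bimod R M N =
    (let T = tensor_group R M N
     in \<lparr>carrier = carrier T, monoid.mult = monoid.mult T, one = one T,
         ring.zero = ring.zero T, ring.add = ring.add T, ract = tensor_ract R M N, lact = tensor_lact R M N\<rparr>)"

text \<open>\<open>f \<otimes>\<^sub>R g : M \<otimes>\<^sub>R N \<rightarrow> M' \<otimes>\<^sub>R N'\<close>.\<close>

definition tensor_map ::
  "('r, 'w) ring_scheme \<Rightarrow> ('r, 'm, 'x) rmod_scheme \<Rightarrow> ('r, 's, 'n, 'y) bimod_scheme
    \<Rightarrow> ('r, 'p, 'v) rmod_scheme \<Rightarrow> ('r, 't, 'q, 'z) bimod_scheme
    \<Rightarrow> ('m \<Rightarrow> 'p) \<Rightarrow> ('n \<Rightarrow> 'q) \<Rightarrow> ('m, 'n) tens \<Rightarrow> ('p, 'q) tens"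
  where "tensor_map R M N M' N' f g =
    tensor_lift R M N (tensor_group R M' N') (\<lambda>m n. tensor R M' N' (f m) (g n))"

text \<open>The canonical isomorphisms \<open>(M \<otimes>\<^sub>R N) \<otimes>\<^sub>S P \<rightarrow> M \<otimes>\<^sub>R (N \<otimes>\<^sub>S P)\<close>, \<open>M \<otimes>\<^sub>R R \<rightarrow> M\<close> and
  \<open>R \<otimes>\<^sub>R M \<rightarrow> M\<close>, which the usual notation leaves implicit.\<close>

definition tensor_assoc ::
  "('r, 'v) ring_scheme \<Rightarrow> ('s, 'w) ring_scheme \<Rightarrow> ('r, 'm, 'x) rmod_scheme
    \<Rightarrow> ('r, 's, 'n, 'y) bimod_scheme \<Rightarrow> ('s, 't, 'p, 'z) bimod_scheme
    \<Rightarrow> (('m, 'n) tens, 'p) tens \<Rightarrow> ('m, ('n, 'p) tens) tens"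
  where "tensor_assoc R S M N P =
    (let Q = tensor_group R M (tensor_bimod S N P)
     in tensor_lift S (tensor_rmod R M N) P Q
       (\<lambda>t p. tensor_lift R M N Q
         (\<lambda>m n. tensor R M (tensor_bimod S N P) m (tensor S N P n p)) t))"

definition tensor_unit_right ::
  "('r, 'w) ring_scheme \<Rightarrow> ('r, 'm, 'x) rmod_scheme \<Rightarrow> ('m, 'r) tens \<Rightarrow> 'm"
  where "tensor_unit_right R M = tensor_lift R M (regular_bimod R) M (\<lambda>m r. m \<triangleleft>\<^bsub>M\<^esub> r)"

definition tensor_unit_left ::
  "('r, 'w) ring_scheme \<Rightarrow> ('r, 's, 'm, 'x) bimod_scheme \<Rightarrow> ('r, 'm) tens \<Rightarrow> 'm"
  where "tensor_unit_left R M = tensor_lift R (regular_bimod R) M M (\<lambda>r m. r \<triangleright>\<^bsub>M\<^esub> m)"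


section \<open>Group corings and their comodules\<close>

record ('g, 'a, 'c) coring =
  cpart :: "'g \<Rightarrow> ('a, 'a, 'c) bimod"
  comult :: "'g \<Rightarrow> 'g \<Rightarrow> 'c \<Rightarrow> ('c, 'c) tens"
  counit :: "'c \<Rightarrow> 'a"

record ('g, 'a, 'm, 'c) comod =
  mpart :: "'g \<Rightarrow> ('a, 'm) rmod"
  coact :: "'g \<Rightarrow> 'g \<Rightarrow> 'm \<Rightarrow> ('m, 'c) tens"

locale group_coring = G?: group G + A?: ring A
  for G :: "('g, 'v) monoid_scheme" (structure)
    and A :: "('a, 'w) ring_scheme" (structure)
    and C :: "('g, 'a, 'c, 'x) coring_scheme" (structure) +
  assumes cpart_bimodule: "\<alpha> \<in> carrier G \<Longrightarrow> bimodule A A (cpart C \<alpha>)"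
    and comult_hom:
      "\<lbrakk>\<alpha> \<in> carrier G; \<beta> \<in> carrier G\<rbrakk> \<Longrightarrow>
        comult C \<alpha> \<beta> \<in> bimod_hom A A (cpart C (\<alpha> \<otimes>\<^bsub>G\<^esub> \<beta>)) (tensor_bimod A (cpart C \<alpha>) (cpart C \<beta>))"
    and counit_hom: "counit C \<in> bimod_hom A A (cpart C \<one>\<^bsub>G\<^esub>) (regular_bimod A)"
    and coassoc:
      "\<lbrakk>\<alpha> \<in> carrier G; \<beta> \<in> carrier G; \<gamma> \<in> carrier G; c \<in> carrier (cpart C (\<alpha> \<otimes>\<^bsub>G\<^esub> \<beta> \<otimes>\<^bsub>G\<^esub> \<gamma>))\<rbrakk> \<Longrightarrow>
        tensor_assoc A A (cpart C \<alpha>) (cpart C \<beta>) (cpart C \<gamma>)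
          (tensor_map A (cpart C (\<alpha> \<otimes>\<^bsub>G\<^esub> \<beta>)) (cpart C \<gamma>)
             (tensor_bimod A (cpart C \<alpha>) (cpart C \<beta>)) (cpart C \<gamma>)
             (comult C \<alpha> \<beta>) (\<lambda>d. d) (comult C (\<alpha> \<otimes>\<^bsub>G\<^esub> \<beta>) \<gamma> c))
        = tensor_map A (cpart C \<alpha>) (cpart C (\<beta> \<otimes>\<^bsub>G\<^esub> \<gamma>))
             (cpart C \<alpha>) (tensor_bimod A (cpart C \<beta>) (cpart C \<gamma>))
             (\<lambda>d. d) (comult C \<beta> \<gamma>) (comult C \<alpha> (\<beta> \<otimes>\<^bsub>G\<^esub> \<gamma>) c)"
    and counit_right:
      "\<lbrakk>\<alpha> \<in> carrier G; c \<in> carrier (cpart C \<alpha>)\<rbrakk> \<Longrightarrow>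
        tensor_unit_right A (cpart C \<alpha>)
          (tensor_map A (cpart C \<alpha>) (cpart C \<one>\<^bsub>G\<^esub>) (cpart C \<alpha>) (regular_bimod A)
             (\<lambda>d. d) (counit C) (comult C \<alpha> \<one>\<^bsub>G\<^esub> c)) = c"
    and counit_left:
      "\<lbrakk>\<alpha> \<in> carrier G; c \<in> carrier (cpart C \<alpha>)\<rbrakk> \<Longrightarrow>
        tensor_unit_left A (cpart C \<alpha>)
          (tensor_map A (cpart C \<one>\<^bsub>G\<^esub>) (cpart C \<alpha>) (regular_bimod A) (cpart C \<alpha>)
             (counit C) (\<lambda>d. d) (comult C \<one>\<^bsub>G\<^esub> \<alpha> c)) = c"

definition coring_hom ::
  "('g, 'v) monoid_scheme \<Rightarrow> ('a, 'w) ring_scheme \<Rightarrow> ('g, 'a, 'c, 'x) coring_scheme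
    \<Rightarrow> ('g, 'a, 'd, 'y) coring_scheme \<Rightarrow> ('g \<Rightarrow> 'c \<Rightarrow> 'd) set"
  where "coring_hom G A C D =
    {f \<in> (\<Pi>\<^sub>E \<alpha>\<in>carrier G. bimod_hom A A (cpart C \<alpha>) (cpart D \<alpha>)).
      (\<forall>\<alpha>\<in>carrier G. \<forall>\<beta>\<in>carrier G. \<forall>c\<in>carrier (cpart C (\<alpha> \<otimes>\<^bsub>G\<^esub> \<beta>)).
        tensor_map A (cpart C \<alpha>) (cpart C \<beta>) (cpart D \<alpha>) (cpart D \<beta>) (f \<alpha>) (f \<beta>) (comult C \<alpha> \<beta> c)
          = comult D \<alpha> \<beta> (f (\<alpha> \<otimes>\<^bsub>G\<^esub> \<beta>) c))
      \<and> (\<forall>c\<in>carrier (cpart C \<one>\<^bsub>G\<^esub>). counit D (f \<one>\<^bsub>G\<^esub> c) = counit C c)}"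

definition coring_iso ::
  "('g, 'v) monoid_scheme \<Rightarrow> ('a, 'w) ring_scheme \<Rightarrow> ('g, 'a, 'c, 'x) coring_scheme
    \<Rightarrow> ('g, 'a, 'd, 'y) coring_scheme \<Rightarrow> ('g \<Rightarrow> 'c \<Rightarrow> 'd) set"
  where "coring_iso G A C D =
    {f \<in> coring_hom G A C D. \<exists>h\<in>coring_hom G A D C. \<forall>\<alpha>\<in>carrier G.
      (\<forall>c\<in>carrier (cpart C \<alpha>). h \<alpha> (f \<alpha> c) = c) \<and> (\<forall>d\<in>carrier (cpart D \<alpha>). f \<alpha> (h \<alpha> d) = d)}"

locale group_comodule = group_coring G A C
  for G :: "('g, 'v) monoid_scheme" (structure)
    and A :: "('a, 'w) ring_scheme" (structure)
    and C :: "('g, 'a, 'c, 'x) coring_scheme" (structure)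
    and M :: "('g, 'a, 'm, 'c, 'y) comod_scheme" (structure) +
  assumes mpart_module: "\<alpha> \<in> carrier G \<Longrightarrow> right_module A (mpart M \<alpha>)"
    and coact_hom:
      "\<lbrakk>\<alpha> \<in> carrier G; \<beta> \<in> carrier G\<rbrakk> \<Longrightarrow>
        coact M \<alpha> \<beta> \<in> rmod_hom A (mpart M (\<alpha> \<otimes>\<^bsub>G\<^esub> \<beta>)) (tensor_rmod A (mpart M \<alpha>) (cpart C \<beta>))"
    and coact_coassoc:
      "\<lbrakk>\<alpha> \<in> carrier G; \<beta> \<in> carrier G; \<gamma> \<in> carrier G; m \<in> carrier (mpart M (\<alpha> \<otimes>\<^bsub>G\<^esub> \<beta> \<otimes>\<^bsub>G\<^esub> \<gamma>))\<rbrakk> \<Longrightarrow>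
        tensor_map A (mpart M \<alpha>) (cpart C (\<beta> \<otimes>\<^bsub>G\<^esub> \<gamma>))
             (mpart M \<alpha>) (tensor_bimod A (cpart C \<beta>) (cpart C \<gamma>))
             (\<lambda>d. d) (comult C \<beta> \<gamma>) (coact M \<alpha> (\<beta> \<otimes>\<^bsub>G\<^esub> \<gamma>) m)
        = tensor_assoc A A (mpart M \<alpha>) (cpart C \<beta>) (cpart C \<gamma>)
          (tensor_map A (mpart M (\<alpha> \<otimes>\<^bsub>G\<^esub> \<beta>)) (cpart C \<gamma>)
             (tensor_rmod A (mpart M \<alpha>) (cpart C \<beta>)) (cpart C \<gamma>)
             (coact M \<alpha> \<beta>) (\<lambda>d. d) (coact M (\<alpha> \<otimes>\<^bsub>G\<^esub> \<beta>) \<gamma> m))"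
    and coact_counit:
      "\<lbrakk>\<alpha> \<in> carrier G; m \<in> carrier (mpart M \<alpha>)\<rbrakk> \<Longrightarrow>
        tensor_unit_right A (mpart M \<alpha>)
          (tensor_map A (mpart M \<alpha>) (cpart C \<one>\<^bsub>G\<^esub>) (mpart M \<alpha>) (regular_bimod A)
             (\<lambda>d. d) (counit C) (coact M \<alpha> \<one>\<^bsub>G\<^esub> m)) = m"

definition comod_hom ::
  "('g, 'v) monoid_scheme \<Rightarrow> ('a, 'w) ring_scheme \<Rightarrow> ('g, 'a, 'c, 'x) coring_scheme
    \<Rightarrow> ('g, 'a, 'm, 'c, 'y) comod_scheme \<Rightarrow> ('g, 'a, 'n, 'c, 'z) comod_scheme
    \<Rightarrow> ('g \<Rightarrow> 'm \<Rightarrow> 'n) set"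
  where "comod_hom G A C M N =
    {f \<in> (\<Pi>\<^sub>E \<alpha>\<in>carrier G. rmod_hom A (mpart M \<alpha>) (mpart N \<alpha>)).
      \<forall>\<alpha>\<in>carrier G. \<forall>\<beta>\<in>carrier G. \<forall>m\<in>carrier (mpart M (\<alpha> \<otimes>\<^bsub>G\<^esub> \<beta>)).
        tensor_map A (mpart M \<alpha>) (cpart C \<beta>) (mpart N \<alpha>) (cpart C \<beta>) (f \<alpha>) (\<lambda>d. d) (coact M \<alpha> \<beta> m)
          = coact N \<alpha> \<beta> (f (\<alpha> \<otimes>\<^bsub>G\<^esub> \<beta>) m)}"


section \<open>Grouplike families, and the functors \<open>F\<^sub>7\<close> and \<open>G\<^sub>7\<close>\<close>

definition grouplike_family ::
  "('g, 'v) monoid_scheme \<Rightarrow> ('a, 'w) ring_scheme \<Rightarrow> ('g, 'a, 'c, 'x) coring_scheme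
    \<Rightarrow> ('g \<Rightarrow> 'c) \<Rightarrow> bool"
  where "grouplike_family G A C x \<longleftrightarrow>
    (\<forall>\<alpha>\<in>carrier G. x \<alpha> \<in> carrier (cpart C \<alpha>))
    \<and> (\<forall>\<alpha>\<in>carrier G. \<forall>\<beta>\<in>carrier G.
        comult C \<alpha> \<beta> (x (\<alpha> \<otimes>\<^bsub>G\<^esub> \<beta>)) = tensor A (cpart C \<alpha>) (cpart C \<beta>) (x \<alpha>) (x \<beta>))
    \<and> counit C (x \<one>\<^bsub>G\<^esub>) = \<one>\<^bsub>A\<^esub>"

definition coinvariants ::
  "('g, 'v) monoid_scheme \<Rightarrow> ('a, 'w) ring_scheme \<Rightarrow> ('g, 'a, 'c, 'x) coring_scheme
    \<Rightarrow> ('g \<Rightarrow> 'c) \<Rightarrow> ('a, 'w) ring_scheme"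
  where "coinvariants G A C x =
    A\<lparr>carrier := {a \<in> carrier A. \<forall>\<alpha>\<in>carrier G. a \<triangleright>\<^bsub>cpart C \<alpha>\<^esub> x \<alpha> = x \<alpha> \<triangleleft>\<^bsub>cpart C \<alpha>\<^esub> a}\<rparr>"

text \<open>Below, \<open>i\<close> makes \<open>A\<close> a \<open>B\<close>-bimodule. Copies \<open>\<mu>\<^sub>\<alpha>(M)\<close> of one module \<open>M\<close> are the constant family
  \<open>M\<close>. Full faithfulness only involves morphism sets, so the carrier types of the values of a
  functor may differ from those of its arguments.\<close>

definition F7 ::
  "('a, 'w) ring_scheme \<Rightarrow> ('b, 'y) ring_scheme \<Rightarrow> ('g, 'a, 'c, 'x) coring_scheme
    \<Rightarrow> ('g \<Rightarrow> 'c) \<Rightarrow> ('b \<Rightarrow> 'a) \<Rightarrow> ('b, 'n) rmod \<Rightarrow> ('g, 'a, ('n, 'a) tens, 'c) comod"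
  where "F7 A B C x i N =
    (let A' = ring_bimod A i (\<lambda>a. a); T = tensor_rmod B N A'
     in \<lparr>mpart = (\<lambda>\<alpha>. T),
         coact = (\<lambda>\<alpha> \<beta>. tensor_lift B N A' (tensor_group A T (cpart C \<beta>))
           (\<lambda>n a. tensor A T (cpart C \<beta>) (tensor B N A' n \<one>\<^bsub>A\<^esub>) (x \<beta> \<triangleleft>\<^bsub>cpart C \<beta>\<^esub> a)))\<rparr>)"

definition F7_map ::
  "('g, 'v) monoid_scheme \<Rightarrow> ('a, 'w) ring_scheme \<Rightarrow> ('b, 'y) ring_scheme \<Rightarrow> ('b \<Rightarrow> 'a)
    \<Rightarrow> ('b, 'n) rmod \<Rightarrow> ('b, 'p) rmod \<Rightarrow> ('n \<Rightarrow> 'p) \<Rightarrow> 'g \<Rightarrow> ('n, 'a) tens \<Rightarrow> ('p, 'a) tens"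
  where "F7_map G A B i N P f =
    (let A' = ring_bimod A i (\<lambda>a. a)
     in (\<lambda>\<alpha>\<in>carrier G. tensor_map B N A' P A' f (\<lambda>a. a)))"

definition G7 ::
  "('g, 'v) monoid_scheme \<Rightarrow> ('a, 'w) ring_scheme \<Rightarrow> ('g, 'a, 'c, 'x) coring_scheme
    \<Rightarrow> ('g \<Rightarrow> 'c) \<Rightarrow> ('b \<Rightarrow> 'a) \<Rightarrow> ('g, 'a, 'm, 'c) comod \<Rightarrow> ('b, 'g \<Rightarrow> 'm) rmod"
  where "G7 G A C x i M =
    \<lparr>carrier = {m \<in> (\<Pi>\<^sub>E \<alpha>\<in>carrier G. carrier (mpart M \<alpha>)).
       \<forall>\<alpha>\<in>carrier G. \<forall>\<beta>\<in>carrier G.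
         coact M \<alpha> \<beta> (m (\<alpha> \<otimes>\<^bsub>G\<^esub> \<beta>)) = tensor A (mpart M \<alpha>) (cpart C \<beta>) (m \<alpha>) (x \<beta>)},
     monoid.mult = undefined, one = undefined,
     ring.zero = (\<lambda>\<alpha>\<in>carrier G. \<zero>\<^bsub>mpart M \<alpha>\<^esub>),
     ring.add = (\<lambda>m m'. (\<lambda>\<alpha>\<in>carrier G. m \<alpha> \<oplus>\<^bsub>mpart M \<alpha>\<^esub> m' \<alpha>)),
     ract = (\<lambda>m b. (\<lambda>\<alpha>\<in>carrier G. m \<alpha> \<triangleleft>\<^bsub>mpart M \<alpha>\<^esub> i b))\<rparr>"

definition G7_map ::
  "('g, 'v) monoid_scheme \<Rightarrow> ('a, 'w) ring_scheme \<Rightarrow> ('g, 'a, 'c, 'x) coring_scheme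
    \<Rightarrow> ('g \<Rightarrow> 'c) \<Rightarrow> ('b \<Rightarrow> 'a) \<Rightarrow> ('g, 'a, 'm, 'c) comod \<Rightarrow> ('g, 'a, 'n, 'c) comod
    \<Rightarrow> ('g \<Rightarrow> 'm \<Rightarrow> 'n) \<Rightarrow> ('g \<Rightarrow> 'm) \<Rightarrow> ('g \<Rightarrow> 'n)"
  where "G7_map G A C x i M N f =
    (\<lambda>m\<in>carrier (G7 G A C x i M :: ('b, 'g \<Rightarrow> 'm) rmod). (\<lambda>\<alpha>\<in>carrier G. f \<alpha> (m \<alpha>)))"

definition fully_faithful ::
  "'x set \<Rightarrow> ('x \<Rightarrow> 'x \<Rightarrow> 'f set) \<Rightarrow> ('y \<Rightarrow> 'y \<Rightarrow> 'h set)
    \<Rightarrow> ('x \<Rightarrow> 'y) \<Rightarrow> ('x \<Rightarrow> 'x \<Rightarrow> 'f \<Rightarrow> 'h) \<Rightarrow> bool"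
  where "fully_faithful Obj Hom Hom' F Fmap \<longleftrightarrow>
    (\<forall>M\<in>Obj. \<forall>N\<in>Obj. bij_betw (Fmap M N) (Hom M N) (Hom' (F M) (F N)))"

text \<open>The type \<open>'u\<close> serves as a universe: the objects of the source categories are the modules, resp.
  families of modules, whose carriers are subsets of \<open>'u\<close>.\<close>

definition F7_fully_faithful ::
  "'u itself \<Rightarrow> ('g, 'v) monoid_scheme \<Rightarrow> ('a, 'w) ring_scheme \<Rightarrow> ('b, 'y) ring_scheme
    \<Rightarrow> ('g, 'a, 'c, 'x) coring_scheme \<Rightarrow> ('g \<Rightarrow> 'c) \<Rightarrow> ('b \<Rightarrow> 'a) \<Rightarrow> bool"
  where "F7_fully_faithful U G A B C x i \<longleftrightarrow>
    fully_faithful {N :: ('b, 'u) rmod. right_module B N} (rmod_hom B) (comod_hom G A C)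
      (F7 A B C x i) (F7_map G A B i)"

definition G7_fully_faithful ::
  "'u itself \<Rightarrow> ('g, 'v) monoid_scheme \<Rightarrow> ('a, 'w) ring_scheme \<Rightarrow> ('b, 'y) ring_scheme
    \<Rightarrow> ('g, 'a, 'c, 'x) coring_scheme \<Rightarrow> ('g \<Rightarrow> 'c) \<Rightarrow> ('b \<Rightarrow> 'a) \<Rightarrow> bool"
  where "G7_fully_faithful U G A B C x i \<longleftrightarrow>
    fully_faithful {M :: ('g, 'a, 'u, 'c) comod. group_comodule G A C M} (comod_hom G A C) (rmod_hom B)
      (G7 G A C x i) (G7_map G A C x i)"


section \<open>The coring \<open>(A \<otimes>\<^sub>B A)\<langle>G\<rangle>\<close> and the canonical morphism\<close>

definition canonical_coring ::
  "('a, 'w) ring_scheme \<Rightarrow> ('b, 'y) ring_scheme \<Rightarrow> ('b \<Rightarrow> 'a) \<Rightarrow> ('g, 'a, ('a, 'a) tens) coring"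
  where "canonical_coring A B i =
    (let A\<^sub>r = ring_bimod A (\<lambda>a. a) i; A\<^sub>l = ring_bimod A i (\<lambda>a. a); D = tensor_bimod B A\<^sub>r A\<^sub>l
     in \<lparr>cpart = (\<lambda>\<alpha>. D),
         comult = (\<lambda>\<alpha> \<beta>. tensor_lift B A\<^sub>r A\<^sub>l (tensor_group A D D)
           (\<lambda>a b. tensor A D D (tensor B A\<^sub>r A\<^sub>l a \<one>\<^bsub>A\<^esub>) (tensor B A\<^sub>r A\<^sub>l \<one>\<^bsub>A\<^esub> b))),
         counit = tensor_lift B A\<^sub>r A\<^sub>l A (\<lambda>a b. a \<otimes>\<^bsub>A\<^esub> b)\<rparr>)"

definition can ::
  "('g, 'v) monoid_scheme \<Rightarrow> ('a, 'w) ring_scheme \<Rightarrow> ('b, 'y) ring_scheme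
    \<Rightarrow> ('g, 'a, 'c, 'x) coring_scheme \<Rightarrow> ('g \<Rightarrow> 'c) \<Rightarrow> ('b \<Rightarrow> 'a) \<Rightarrow> 'g \<Rightarrow> ('a, 'a) tens \<Rightarrow> 'c"
  where "can G A B C x i =
    (\<lambda>\<alpha>\<in>carrier G. tensor_lift B (ring_bimod A (\<lambda>a. a) i) (ring_bimod A i (\<lambda>a. a)) (cpart C \<alpha>)
      (\<lambda>a b. (a \<triangleright>\<^bsub>cpart C \<alpha>\<^esub> x \<alpha>) \<triangleleft>\<^bsub>cpart C \<alpha>\<^esub> b))"

end

theory Submission
  imports Defs "HOL-Library.Equipollence"
begin

text \<open>
  Both halves say that a fully faithful adjoint makes a unit or counit invertible at one particular object, and both
  can be read off from morphisms that are visibly there.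

  For the first half, take \<open>N = B\<close>. Every \<open>t \<in> T\<close> gives an endomorphism \<open>1 \<otimes> a \<mapsto> 1 \<otimes> t a\<close> of
  \<open>F\<^sub>7(B) = (\<mu>\<^sub>\<alpha>(B \<otimes>\<^sub>B A))\<^sub>\<alpha>\<close>, the same map in every degree; it is colinear because \<open>t x\<^sub>\<beta> = x\<^sub>\<beta> t\<close>. As \<open>F\<^sub>7\<close> is
  full, it is induced by a \<open>B\<close>-linear map \<open>B \<rightarrow> B\<close>, that is by left multiplication with some \<open>b\<close>, and then
  \<open>i(b) = t\<close>. If \<open>i(b) = i(b')\<close>, then left multiplication with \<open>b\<close> and with \<open>b'\<close> induce the same map of \<open>F\<^sub>7(B)\<close>, so
  \<open>b = b'\<close> as \<open>F\<^sub>7\<close> is faithful. Working with these endomorphisms rather than with all of \<open>G\<^sub>7 F\<^sub>7(B)\<close> matters: the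
  families in \<open>G\<^sub>7 F\<^sub>7(B)\<close> need not be constant, and it is not \<open>T\<close> in general.

  For the second half, compare two comodules: \<open>C\<close>, coacting on itself by its comultiplication, and \<open>D = F\<^sub>7(A)\<close>, whose
  underlying bimodules are those of the coring \<open>(A \<otimes>\<^sub>B A)\<langle>G\<rangle>\<close>. Applying \<open>\<epsilon>\<close> to the condition
  \<open>\<Delta>\<^sub>e\<^sub>,\<^sub>\<alpha>(c\<^sub>\<alpha>) = c\<^sub>e \<otimes> x\<^sub>\<alpha>\<close> shows that \<open>G\<^sub>7(C)\<close> consists of the families \<open>(a x\<^sub>\<alpha>)\<^sub>\<alpha>\<close> with \<open>a = \<epsilon>(c\<^sub>e)\<close>. Sending such a family to
  \<open>(a \<otimes> 1)\<^sub>\<alpha>\<close> is a \<open>B\<close>-linear map \<open>G\<^sub>7(C) \<rightarrow> G\<^sub>7(D)\<close>; as \<open>G\<^sub>7\<close> is full, it comes from a comodule morphism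
  \<open>h : C \<rightarrow> D\<close>. Now \<open>can \<circ> h\<close> fixes every coinvariant family of \<open>C\<close>, so it is the identity by faithfulness, while
  \<open>h(a x\<^sub>\<alpha> b) = (a \<otimes> 1) b = a \<otimes> b\<close> says that \<open>h \<circ> can\<close> is the identity. A bijective morphism of corings is an isomorphism.

  Full faithfulness is given only for objects whose carriers lie in the type \<open>'u\<close>, so \<open>B\<close>, \<open>C\<close> and \<open>D\<close> have to be copied
  there. For \<open>D\<close> this is possible because \<open>'u\<close> is infinite: a tensor is a finite sum of pure tensors, so there are at most
  as many tensors as finite lists over \<open>'u\<close>. Most of the remaining work is the calculus of tensor products over a
  noncommutative ring: the universal property, the induced actions and maps, associativity, and the fact that additive maps
  agreeing on pure tensors are equal, by which all identities between coactions are checked.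
\<close>

section \<open>Universal property of the tensor product\<close>

text \<open>The counterpart of \<^locale>\<open>right_module\<close>: of the second factor, \<open>M \<otimes>\<^sub>R N\<close> only involves the left action.\<close>

locale left_module = R?: ring R + M?: abelian_group N
  for R :: "('r, 'x) ring_scheme" (structure) and N :: "('r, 's, 'n, 'y) bimod_scheme" (structure) +
  assumes lact_closed:
      "\<lbrakk>r \<in> carrier R; n \<in> carrier N\<rbrakk> \<Longrightarrow> r \<triangleright>\<^bsub>N\<^esub> n \<in> carrier N"
    and lact_add_right:
      "\<lbrakk>r \<in> carrier R; m \<in> carrier N; n \<in> carrier N\<rbrakk>
        \<Longrightarrow> r \<triangleright>\<^bsub>N\<^esub> (m \<oplus>\<^bsub>N\<^esub> n) = r \<triangleright>\<^bsub>N\<^esub> m \<oplus>\<^bsub>N\<^esub> r \<triangleright>\<^bsub>N\<^esub> n"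
    and lact_add_left:
      "\<lbrakk>r \<in> carrier R; s \<in> carrier R; n \<in> carrier N\<rbrakk>
        \<Longrightarrow> (r \<oplus>\<^bsub>R\<^esub> s) \<triangleright>\<^bsub>N\<^esub> n = r \<triangleright>\<^bsub>N\<^esub> n \<oplus>\<^bsub>N\<^esub> s \<triangleright>\<^bsub>N\<^esub> n"
    and lact_mult:
      "\<lbrakk>r \<in> carrier R; s \<in> carrier R; n \<in> carrier N\<rbrakk>
        \<Longrightarrow> (r \<otimes>\<^bsub>R\<^esub> s) \<triangleright>\<^bsub>N\<^esub> n = r \<triangleright>\<^bsub>N\<^esub> (s \<triangleright>\<^bsub>N\<^esub> n)"
    and lact_one:
      "n \<in> carrier N \<Longrightarrow> \<one>\<^bsub>R\<^esub> \<triangleright>\<^bsub>N\<^esub> n = n"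

lemma bimodule_left: "bimodule L R M \<Longrightarrow> left_module L M"
  by (simp add: bimodule_def bimodule_axioms_def left_module_def left_module_axioms_def right_module_def)

lemma bimodule_right: "bimodule L R M \<Longrightarrow> right_module R M"
  by (simp add: bimodule_def)

locale tensor_product = M: right_module R M + N: left_module R N
  for R :: "('r, 'w) ring_scheme" and M :: "('r, 'm, 'x) rmod_scheme"
    and N :: "('r, 's, 'n, 'y) bimod_scheme"

definition balanced_map ::
  "('r, 'w) ring_scheme \<Rightarrow> ('r, 'm, 'x) rmod_scheme \<Rightarrow> ('r, 's, 'n, 'y) bimod_scheme
    \<Rightarrow> ('p, 'z) ring_scheme \<Rightarrow> ('m \<Rightarrow> 'n \<Rightarrow> 'p) \<Rightarrow> bool"
  where "balanced_map R M N P h \<longleftrightarrow>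
    (\<forall>m\<in>carrier M. \<forall>n\<in>carrier N. h m n \<in> carrier P)
    \<and> (\<forall>m\<in>carrier M. \<forall>m'\<in>carrier M. \<forall>n\<in>carrier N. h (m \<oplus>\<^bsub>M\<^esub> m') n = h m n \<oplus>\<^bsub>P\<^esub> h m' n)
    \<and> (\<forall>m\<in>carrier M. \<forall>n\<in>carrier N. \<forall>n'\<in>carrier N. h m (n \<oplus>\<^bsub>N\<^esub> n') = h m n \<oplus>\<^bsub>P\<^esub> h m n')
    \<and> (\<forall>m\<in>carrier M. \<forall>r\<in>carrier R. \<forall>n\<in>carrier N. h (m \<triangleleft>\<^bsub>M\<^esub> r) n = h m (r \<triangleright>\<^bsub>N\<^esub> n))"

text \<open>Linear maps are treated as predicates, apart from the extensionality that \<^const>\<open>rmod_hom\<close> includes; identities and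
  composites then stay linear without being restricted to a carrier.\<close>

definition additive_map :: "('m, 'x) ring_scheme \<Rightarrow> ('n, 'y) ring_scheme \<Rightarrow> ('m \<Rightarrow> 'n) \<Rightarrow> bool"
  where "additive_map M N f \<longleftrightarrow>
    (\<forall>m\<in>carrier M. f m \<in> carrier N)
    \<and> (\<forall>m\<in>carrier M. \<forall>m'\<in>carrier M. f (m \<oplus>\<^bsub>M\<^esub> m') = f m \<oplus>\<^bsub>N\<^esub> f m')"

lemma add_hom_iff: "f \<in> hom (add_monoid M) (add_monoid N) \<longleftrightarrow> additive_map M N f"
  by (auto simp: hom_def additive_map_def)

lemma additive_map_closed: "additive_map M N f \<Longrightarrow> m \<in> carrier M \<Longrightarrow> f m \<in> carrier N"
  by (simp add: additive_map_def)

lemma additive_map_add: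
  "additive_map M N f \<Longrightarrow> m \<in> carrier M \<Longrightarrow> m' \<in> carrier M \<Longrightarrow> f (m \<oplus>\<^bsub>M\<^esub> m') = f m \<oplus>\<^bsub>N\<^esub> f m'"
  by (simp add: additive_map_def)

context tensor_product
begin

abbreviation (input) "free \<equiv> free_Abelian_group (carrier M \<times> carrier N)"

lemma tensor_rels_carrier: "tensor_rels R M N \<subseteq> carrier free"
proof -
  have keys2: "Poly_Mapping.keys (frag_of a - frag_of b) \<subseteq> S" if "a \<in> S" "b \<in> S" for a b :: 'e and S
    using keys_diff[of "frag_of a" "frag_of b"] that by (auto simp: keys_frag_of)
  have keys3: "Poly_Mapping.keys (frag_of a - frag_of b - frag_of c) \<subseteq> S"
    if "a \<in> S" "b \<in> S" "c \<in> S" for a b c :: 'e and S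
    using keys_diff[of "frag_of a - frag_of b" "frag_of c"] keys2[OF that(1,2)] that(3)
    by (auto simp: keys_frag_of)
  show ?thesis
    unfolding tensor_rels_def
    by (auto simp: keys2 keys3 M.ract_closed N.lact_closed
        dest!: subsetD[OF keys2, rotated 2] subsetD[OF keys3, rotated 3])
qed

lemma tensor_subgroup_normal: "tensor_subgroup R M N \<lhd> free"
  unfolding tensor_subgroup_def
  by (intro comm_group.subgroup_imp_normal[OF abelian_free_Abelian_group]
      group.generate_is_subgroup tensor_rels_carrier group_free_Abelian_group)

lemma abelian_tensor_group: "abelian_group (tensor_group R M N)"
proof -
  have "comm_group (free Mod tensor_subgroup R M N)"
    by (intro comm_group.abelian_FactGroup[OF abelian_free_Abelian_group]
        normal_imp_subgroup tensor_subgroup_normal)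
  then interpret Q: comm_group "free Mod tensor_subgroup R M N" .
  have inv: "\<exists>y\<in>carrier (tensor_group R M N). y \<oplus>\<^bsub>tensor_group R M N\<^esub> x = \<zero>\<^bsub>tensor_group R M N\<^esub>"
    if "x \<in> carrier (tensor_group R M N)" for x
    using that Q.l_inv Q.inv_closed unfolding tensor_group_def Let_def by (auto simp del: one_FactGroup mult_FactGroup)
  show ?thesis
    using inv Q.m_closed Q.one_closed Q.m_assoc Q.m_comm Q.l_one
    by (intro abelian_groupI) (simp_all add: tensor_group_def Let_def del: one_FactGroup mult_FactGroup)
qed

abbreviation (input) "cls c \<equiv> tensor_subgroup R M N #>\<^bsub>free\<^esub> c"

lemma carrier_tensor_group: "carrier (tensor_group R M N) = cls ` carrier free"
  by (simp add: tensor_group_def carrier_FactGroup Let_def)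

lemma cls_add:
  assumes "a \<in> carrier free" "b \<in> carrier free"
  shows "cls (a + b) = cls a \<oplus>\<^bsub>tensor_group R M N\<^esub> cls b"
  using normal.rcos_sum[OF tensor_subgroup_normal assms] by (simp add: tensor_group_def Let_def)

lemma cls_eqI:
  assumes "a \<in> carrier free" "b \<in> carrier free" "a - b \<in> tensor_subgroup R M N"
  shows "cls a = cls b"
proof -
  have "a \<in> cls b"
    using assms(3) unfolding r_coset_def by (auto intro!: bexI[of _ "a - b"])
  then have "cls b = cls a"
    by (rule group.repr_independence[OF group_free_Abelian_group _ assms(2)
          normal_imp_subgroup[OF tensor_subgroup_normal]])
  then show ?thesis by simp
qed

lemma frag_of_carrier [simp]:
  "m \<in> carrier M \<Longrightarrow> n \<in> carrier N \<Longrightarrow> frag_of (m, n) \<in> carrier free"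
  by simp

lemma tensor_closed:
  "m \<in> carrier M \<Longrightarrow> n \<in> carrier N \<Longrightarrow> tensor R M N m n \<in> carrier (tensor_group R M N)"
  by (auto simp: tensor_def carrier_tensor_group simp del: carrier_free_Abelian_group_iff)

lemma frag_add_carrier:
  "a \<in> carrier free \<Longrightarrow> b \<in> carrier free \<Longrightarrow> a + b \<in> carrier free"
  using Poly_Mapping.keys_add[of a b] by auto

lemma frag_diff_carrier:
  "a \<in> carrier free \<Longrightarrow> b \<in> carrier free \<Longrightarrow> a - b \<in> carrier free"
  using keys_diff[of a b] by auto

lemma tensor_add_left:
  assumes "m \<in> carrier M" "m' \<in> carrier M" "n \<in> carrier N"
  shows "tensor R M N (m \<oplus>\<^bsub>M\<^esub> m') n = tensor R M N m n \<oplus>\<^bsub>tensor_group R M N\<^esub> tensor R M N m' n"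
proof -
  have "frag_of (m \<oplus>\<^bsub>M\<^esub> m', n) - (frag_of (m, n) + frag_of (m', n)) \<in> tensor_rels R M N"
    unfolding tensor_rels_def diff_diff_eq[symmetric] using assms by blast
  then have "cls (frag_of (m \<oplus>\<^bsub>M\<^esub> m', n)) = cls (frag_of (m, n) + frag_of (m', n))"
    by - (rule cls_eqI[OF frag_of_carrier frag_add_carrier[OF frag_of_carrier frag_of_carrier]]
       , simp_all add: assms tensor_subgroup_def generate.incl)
  then show ?thesis
    unfolding tensor_def using assms by (simp add: cls_add)
qed

lemma tensor_add_right:
  assumes "m \<in> carrier M" "n \<in> carrier N" "n' \<in> carrier N"
  shows "tensor R M N m (n \<oplus>\<^bsub>N\<^esub> n') = tensor R M N m n \<oplus>\<^bsub>tensor_group R M N\<^esub> tensor R M N m n'"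
proof -
  have "frag_of (m, n \<oplus>\<^bsub>N\<^esub> n') - (frag_of (m, n) + frag_of (m, n')) \<in> tensor_rels R M N"
    unfolding tensor_rels_def diff_diff_eq[symmetric] using assms by blast
  then have "cls (frag_of (m, n \<oplus>\<^bsub>N\<^esub> n')) = cls (frag_of (m, n) + frag_of (m, n'))"
    by - (rule cls_eqI[OF frag_of_carrier frag_add_carrier[OF frag_of_carrier frag_of_carrier]],
       simp_all add: assms tensor_subgroup_def generate.incl)
  then show ?thesis
    unfolding tensor_def using assms by (simp add: cls_add)
qed

lemma tensor_balanced:
  assumes "m \<in> carrier M" "r \<in> carrier R" "n \<in> carrier N"
  shows "tensor R M N (m \<triangleleft>\<^bsub>M\<^esub> r) n = tensor R M N m (r \<triangleright>\<^bsub>N\<^esub> n)"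
proof -
  have "frag_of (m \<triangleleft>\<^bsub>M\<^esub> r, n) - frag_of (m, r \<triangleright>\<^bsub>N\<^esub> n) \<in> tensor_rels R M N"
    unfolding tensor_rels_def using assms by blast
  then show ?thesis
    unfolding tensor_def
    by (intro cls_eqI[OF frag_of_carrier frag_of_carrier])
       (simp_all add: assms M.ract_closed N.lact_closed tensor_subgroup_def generate.incl)
qed

text \<open>Pure tensors generate \<open>M \<otimes>\<^sub>R N\<close> even under addition alone, as \<open>0 = 0 \<otimes> 0\<close> and \<open>- (m \<otimes> n) = (- m) \<otimes> n\<close>. The induction
  over the free abelian group proceeds by differences and therefore treats \<open>c\<close> and \<open>- c\<close> together.\<close>

lemma tensor_induct [consumes 1, case_names pure add]:
  assumes t: "t \<in> carrier (tensor_group R M N)"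
    and pure: "\<And>m n. m \<in> carrier M \<Longrightarrow> n \<in> carrier N \<Longrightarrow> Q (tensor R M N m n)"
    and add: "\<And>s t. s \<in> carrier (tensor_group R M N) \<Longrightarrow> t \<in> carrier (tensor_group R M N)
      \<Longrightarrow> Q s \<Longrightarrow> Q t \<Longrightarrow> Q (s \<oplus>\<^bsub>tensor_group R M N\<^esub> t)"
  shows "Q t"
proof -
  let ?T = "tensor_group R M N"
  interpret T: abelian_group ?T by (rule abelian_tensor_group)
  have idem: "u = \<zero>\<^bsub>?T\<^esub>" if "u \<oplus>\<^bsub>?T\<^esub> u = u" "u \<in> carrier ?T" for u
    using that T.add.l_cancel_one'[of u u] by simp
  have cls_zero: "cls 0 = \<zero>\<^bsub>?T\<^esub>"
  proof -
    have "cls 0 \<oplus>\<^bsub>?T\<^esub> cls 0 = cls 0" using cls_add[of 0 0] by simp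
    moreover have "cls 0 \<in> carrier ?T" by (simp add: carrier_tensor_group)
    ultimately show ?thesis
      by (rule idem)
  qed
  have "c \<in> carrier free \<and> Q (cls c) \<and> Q (cls (- c))" if "Poly_Mapping.keys c \<subseteq> carrier M \<times> carrier N" for c
    using that
  proof (induction c rule: frag_induction)
    case zero
    have "tensor R M N \<zero>\<^bsub>M\<^esub> \<zero>\<^bsub>N\<^esub> \<oplus>\<^bsub>?T\<^esub> tensor R M N \<zero>\<^bsub>M\<^esub> \<zero>\<^bsub>N\<^esub> = tensor R M N \<zero>\<^bsub>M\<^esub> \<zero>\<^bsub>N\<^esub>"
      using tensor_add_left[of "\<zero>\<^bsub>M\<^esub>" "\<zero>\<^bsub>M\<^esub>" "\<zero>\<^bsub>N\<^esub>"] by simp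
    then have "tensor R M N \<zero>\<^bsub>M\<^esub> \<zero>\<^bsub>N\<^esub> = \<zero>\<^bsub>?T\<^esub>"
      by (rule idem) (simp add: tensor_closed)
    then show ?case
      using pure[of "\<zero>\<^bsub>M\<^esub>" "\<zero>\<^bsub>N\<^esub>"] cls_zero by simp
  next
    case (one x)
    then obtain m n where x: "x = (m, n)" "m \<in> carrier M" "n \<in> carrier N" by blast
    have neg: "\<ominus>\<^bsub>M\<^esub> m \<in> carrier M" using x by simp
    let ?c = "frag_of (\<ominus>\<^bsub>M\<^esub> m, n)"
    have "tensor R M N \<zero>\<^bsub>M\<^esub> n \<oplus>\<^bsub>?T\<^esub> tensor R M N \<zero>\<^bsub>M\<^esub> n = tensor R M N \<zero>\<^bsub>M\<^esub> n"
      using tensor_add_left[of "\<zero>\<^bsub>M\<^esub>" "\<zero>\<^bsub>M\<^esub>" n] x by simp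
    then have z: "tensor R M N \<zero>\<^bsub>M\<^esub> n = \<zero>\<^bsub>?T\<^esub>"
      by (rule idem) (simp add: tensor_closed x)
    have "tensor R M N (\<ominus>\<^bsub>M\<^esub> m) n \<oplus>\<^bsub>?T\<^esub> tensor R M N m n = \<zero>\<^bsub>?T\<^esub>"
      using tensor_add_left[of "\<ominus>\<^bsub>M\<^esub> m" m n] x neg z by (simp add: M.M.l_neg)
    moreover have "cls (- frag_of x) \<oplus>\<^bsub>?T\<^esub> tensor R M N m n = \<zero>\<^bsub>?T\<^esub>"
      using cls_add[of "- frag_of x" "frag_of x"] x cls_zero by (simp add: tensor_def)
    moreover have "cls (- frag_of x) \<in> carrier ?T"
      using x by (simp add: carrier_tensor_group)
    ultimately have "cls (- frag_of x) = tensor R M N (\<ominus>\<^bsub>M\<^esub> m) n"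
      using T.add.inv_equality[of "cls (- frag_of x)" "tensor R M N m n"]
        T.add.inv_equality[of "tensor R M N (\<ominus>\<^bsub>M\<^esub> m) n" "tensor R M N m n"] x neg tensor_closed by simp
    then show ?case using pure x neg by (simp add: tensor_def)
  next
    case (diff a b)
    have *: "\<And>c. Poly_Mapping.keys c \<subseteq> carrier M \<times> carrier N \<Longrightarrow> cls c \<in> carrier ?T"
      by (simp add: carrier_tensor_group)
    show ?case
      using diff add[of "cls a" "cls (- b)"] add[of "cls (- a)" "cls b"]
        cls_add[of a "-b"] cls_add[of "- a" b] * keys_diff[of a b] by auto
  qed
  then show ?thesis
    using t by (auto simp: carrier_tensor_group)
qed

lemma tensor_eqI:
  assumes "additive_map (tensor_group R M N) P f"
    and "additive_map (tensor_group R M N) P g"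
    and "\<And>m n. m \<in> carrier M \<Longrightarrow> n \<in> carrier N \<Longrightarrow> f (tensor R M N m n) = g (tensor R M N m n)"
    and "t \<in> carrier (tensor_group R M N)"
  shows "f t = g t"
  using assms(4)
proof (induction t rule: tensor_induct)
  case (pure m n)
  then show ?case by (rule assms(3))
next
  case (add s t)
  then show ?case by (simp add: additive_map_add[OF assms(1)] additive_map_add[OF assms(2)])
qed

text \<open>Extend \<open>h\<close> to the free abelian group on \<open>M \<times> N\<close>; balancedness says that the extension kills the tensor relations, so that it
  factors through the quotient.\<close>

lemma tensor_lift_exists:
  assumes P: "abelian_group P" and h: "balanced_map R M N P h"
  shows "\<exists>\<phi>. \<phi> \<in> extensional (carrier (tensor_group R M N))
       \<and> additive_map (tensor_group R M N) P \<phi>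
       \<and> (\<forall>m\<in>carrier M. \<forall>n\<in>carrier N. \<phi> (tensor R M N m n) = h m n)"
proof -
  interpret P: abelian_group P by fact
  have hc: "h m n \<in> carrier P" if "m \<in> carrier M" "n \<in> carrier N" for m n
    using h that by (simp add: balanced_map_def)
  have "(\<lambda>(m, n). h m n) ` (carrier M \<times> carrier N) \<subseteq> carrier (add_monoid P)"
    using hc by auto
  then obtain k where k: "k \<in> hom free (add_monoid P)"
    and k_of: "\<And>x. x \<in> carrier M \<times> carrier N \<Longrightarrow> k (frag_of x) = (\<lambda>(m, n). h m n) x"
    using comm_group.free_Abelian_group_universal[OF P.a_comm_group, of "\<lambda>(m, n). h m n" "carrier M \<times> carrier N"] by metis
  interpret k: group_hom free "add_monoid P" k
    by (intro group_hom.intro group_hom_axioms.intro k group_free_Abelian_group comm_group.axioms(2)[OF P.a_comm_group])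
  have k_add: "k (a + b) = k a \<oplus>\<^bsub>P\<^esub> k b" if "a \<in> carrier free" "b \<in> carrier free" for a b
    using k.hom_mult[OF that] by simp
  have k_diff: "k (a - b) = \<zero>\<^bsub>P\<^esub>" if "a \<in> carrier free" "b \<in> carrier free" "k a = k b" for a b
  proof -
    have "k (a - b) \<oplus>\<^bsub>P\<^esub> k b = k a"
      using k_add[OF frag_diff_carrier[OF that(1,2)] that(2)] by simp
    moreover have "k (a - b) \<in> carrier P" "k b \<in> carrier P"
      using k.hom_closed[OF that(2)] k.hom_closed[OF frag_diff_carrier[OF that(1,2)]] by simp_all
    ultimately show ?thesis
      using P.add.r_cancel_one[of "k b" "k (a - b)"] that(3) by simp
  qed
  have "tensor_rels R M N \<subseteq> kernel free (add_monoid P) k"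
  proof
    fix c assume c: "c \<in> tensor_rels R M N"
    have "k c = \<zero>\<^bsub>P\<^esub>"
      using c unfolding tensor_rels_def diff_diff_eq
    proof (elim UnE CollectE exE conjE)
      fix m m' n assume *: "c = frag_of (m \<oplus>\<^bsub>M\<^esub> m', n) - (frag_of (m, n) + frag_of (m', n))"
        "m \<in> carrier M" "m' \<in> carrier M" "n \<in> carrier N"
      show ?thesis unfolding *(1)
        by (rule k_diff[OF frag_of_carrier frag_add_carrier[OF frag_of_carrier frag_of_carrier]])
           (use h *(2-) in \<open>simp_all add: k_add k_of balanced_map_def\<close>)
    next
      fix m n n' assume *: "c = frag_of (m, n \<oplus>\<^bsub>N\<^esub> n') - (frag_of (m, n) + frag_of (m, n'))"
        "m \<in> carrier M" "n \<in> carrier N" "n' \<in> carrier N"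
      show ?thesis unfolding *(1)
        by (rule k_diff[OF frag_of_carrier frag_add_carrier[OF frag_of_carrier frag_of_carrier]])
           (use h *(2-) in \<open>simp_all add: k_add k_of balanced_map_def\<close>)
    next
      fix m r n assume *: "c = frag_of (m \<triangleleft>\<^bsub>M\<^esub> r, n) - frag_of (m, r \<triangleright>\<^bsub>N\<^esub> n)"
        "m \<in> carrier M" "r \<in> carrier R" "n \<in> carrier N"
      show ?thesis unfolding *(1)
        by (rule k_diff[OF frag_of_carrier frag_of_carrier])
           (use h *(2-) in \<open>simp_all add: k_of balanced_map_def M.ract_closed N.lact_closed\<close>)
    qed
    then show "c \<in> kernel free (add_monoid P) k"
      using subsetD[OF tensor_rels_carrier c] by (simp add: kernel_def)
  qed
  then have "tensor_subgroup R M N \<subseteq> kernel free (add_monoid P) k"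
    unfolding tensor_subgroup_def
    by (rule group.generate_subgroup_incl[OF group_free_Abelian_group _ k.subgroup_kernel])
  from k.FactGroup_universal_kernel[OF tensor_subgroup_normal this]
  obtain g where g: "g \<in> hom (free Mod tensor_subgroup R M N) (add_monoid P)"
    and g_cls: "\<And>c. c \<in> carrier free \<Longrightarrow> g (cls c) = k c"
    by blast
  have ghom: "additive_map (tensor_group R M N) P g"
    using g by (auto simp: hom_def additive_map_def tensor_group_def Let_def simp del: mult_FactGroup one_FactGroup)
  interpret T: abelian_group "tensor_group R M N" by (rule abelian_tensor_group)
  have "additive_map (tensor_group R M N) P (restrict g (carrier (tensor_group R M N)))"
    using ghom by (simp add: additive_map_def)
  moreover have "restrict g (carrier (tensor_group R M N)) (tensor R M N m n) = h m n"
    if "m \<in> carrier M" "n \<in> carrier N" for m n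
    using that tensor_closed[OF that] g_cls[of "frag_of (m, n)"] k_of[of "(m, n)"]
    by (simp add: tensor_def)
  ultimately show ?thesis by blast
qed

text \<open>The definite description in \<^const>\<open>tensor_lift\<close> denotes: a lift exists, and it is unique because pure tensors generate.\<close>

lemma tensor_lift_properties:
  assumes P: "abelian_group P" and h: "balanced_map R M N P h"
  shows tensor_lift_extensional:
      "tensor_lift R M N P h \<in> extensional (carrier (tensor_group R M N))"
    and tensor_lift_additive:
      "additive_map (tensor_group R M N) P (tensor_lift R M N P h)"
    and tensor_lift_pure:
      "m \<in> carrier M \<Longrightarrow> n \<in> carrier N \<Longrightarrow> tensor_lift R M N P h (tensor R M N m n) = h m n"
proof -
  let ?lifts = "\<lambda>\<phi>. \<phi> \<in> extensional (carrier (tensor_group R M N))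
       \<and> additive_map (tensor_group R M N) P \<phi>
       \<and> (\<forall>m\<in>carrier M. \<forall>n\<in>carrier N. \<phi> (tensor R M N m n) = h m n)"
  obtain \<phi> where \<phi>: "?lifts \<phi>"
    using tensor_lift_exists[OF P h] by blast
  have "?lifts (tensor_lift R M N P h)"
    unfolding tensor_lift_def add_hom_iff
  proof (rule theI[of ?lifts \<phi>])
    show "?lifts \<phi>" by (fact \<phi>)
    fix \<psi> assume \<psi>: "?lifts \<psi>"
    show "\<psi> = \<phi>"
    proof (rule extensionalityI)
      show "\<psi> \<in> extensional (carrier (tensor_group R M N))" using \<psi> by blast
      show "\<phi> \<in> extensional (carrier (tensor_group R M N))" using \<phi> by blast
      fix t assume "t \<in> carrier (tensor_group R M N)"
      then show "\<psi> t = \<phi> t"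
        by (rule tensor_eqI[rotated 3]) (use \<phi> \<psi> in auto)
    qed
  qed
  then show "tensor_lift R M N P h \<in> extensional (carrier (tensor_group R M N))"
    and "additive_map (tensor_group R M N) P (tensor_lift R M N P h)"
    and "m \<in> carrier M \<Longrightarrow> n \<in> carrier N \<Longrightarrow> tensor_lift R M N P h (tensor R M N m n) = h m n"
    by blast+
qed

end

section \<open>Tensor products as modules, and maps between them\<close>

definition right_linear ::
  "('r, 'w) ring_scheme \<Rightarrow> ('r, 'm, 'x) rmod_scheme \<Rightarrow> ('r, 'n, 'y) rmod_scheme \<Rightarrow> ('m \<Rightarrow> 'n) \<Rightarrow> bool"
  where "right_linear R M N f \<longleftrightarrow> additive_map M N f
    \<and> (\<forall>m\<in>carrier M. \<forall>r\<in>carrier R. f (m \<triangleleft>\<^bsub>M\<^esub> r) = f m \<triangleleft>\<^bsub>N\<^esub> r)"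

definition left_linear ::
  "('l, 'w) ring_scheme \<Rightarrow> ('l, 'r, 'm, 'x) bimod_scheme \<Rightarrow> ('l, 's, 'n, 'y) bimod_scheme
    \<Rightarrow> ('m \<Rightarrow> 'n) \<Rightarrow> bool"
  where "left_linear L M N f \<longleftrightarrow> additive_map M N f
    \<and> (\<forall>l\<in>carrier L. \<forall>m\<in>carrier M. f (l \<triangleright>\<^bsub>M\<^esub> m) = l \<triangleright>\<^bsub>N\<^esub> f m)"

lemma rmod_hom_iff: "f \<in> rmod_hom R M N \<longleftrightarrow> f \<in> extensional (carrier M) \<and> right_linear R M N f"
  by (auto simp: rmod_hom_def right_linear_def add_hom_iff)

lemma bimod_hom_iff:
  "f \<in> bimod_hom L R M N \<longleftrightarrow>
    f \<in> extensional (carrier M) \<and> right_linear R M N f \<and> left_linear L M N f"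
  by (auto simp: bimod_hom_def rmod_hom_iff left_linear_def right_linear_def)

lemma right_linearD:
  assumes "right_linear R M N f"
  shows right_linear_additive: "additive_map M N f"
    and right_linear_closed: "m \<in> carrier M \<Longrightarrow> f m \<in> carrier N"
    and right_linear_add:
      "m \<in> carrier M \<Longrightarrow> m' \<in> carrier M \<Longrightarrow> f (m \<oplus>\<^bsub>M\<^esub> m') = f m \<oplus>\<^bsub>N\<^esub> f m'"
    and right_linear_ract: "m \<in> carrier M \<Longrightarrow> r \<in> carrier R \<Longrightarrow> f (m \<triangleleft>\<^bsub>M\<^esub> r) = f m \<triangleleft>\<^bsub>N\<^esub> r"
  using assms by (simp_all add: right_linear_def additive_map_def)

lemma left_linearD:
  assumes "left_linear L M N f"
  shows left_linear_closed: "m \<in> carrier M \<Longrightarrow> f m \<in> carrier N"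
    and left_linear_add:
      "m \<in> carrier M \<Longrightarrow> m' \<in> carrier M \<Longrightarrow> f (m \<oplus>\<^bsub>M\<^esub> m') = f m \<oplus>\<^bsub>N\<^esub> f m'"
    and left_linear_lact: "l \<in> carrier L \<Longrightarrow> m \<in> carrier M \<Longrightarrow> f (l \<triangleright>\<^bsub>M\<^esub> m) = l \<triangleright>\<^bsub>N\<^esub> f m"
  using assms by (simp_all add: left_linear_def additive_map_def)

lemma right_linear_id: "right_linear R M M (\<lambda>m. m)"
  by (simp add: right_linear_def additive_map_def)

lemma left_linear_id: "left_linear R M M (\<lambda>m. m)"
  by (simp add: left_linear_def additive_map_def)

lemma additive_map_comp:
  "additive_map M N f \<Longrightarrow> additive_map N P g \<Longrightarrow> additive_map M P (\<lambda>m. g (f m))"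
  by (simp add: additive_map_def)

lemma right_linear_comp:
  "right_linear R M N f \<Longrightarrow> right_linear R N P g \<Longrightarrow> right_linear R M P (\<lambda>m. g (f m))"
  by (simp add: right_linear_def additive_map_def)

lemma tensor_rmod_simps [simp]:
  "carrier (tensor_rmod R M N) = carrier (tensor_group R M N)"
  "ring.add (tensor_rmod R M N) = ring.add (tensor_group R M N)"
  "ring.zero (tensor_rmod R M N) = ring.zero (tensor_group R M N)"
  "ract (tensor_rmod R M N) = tensor_ract R M N"
  by (simp_all add: tensor_rmod_def Let_def)

lemma tensor_bimod_simps [simp]:
  "carrier (tensor_bimod R M N) = carrier (tensor_group R M N)"
  "ring.add (tensor_bimod R M N) = ring.add (tensor_group R M N)"
  "ring.zero (tensor_bimod R M N) = ring.zero (tensor_group R M N)"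
  "ract (tensor_bimod R M N) = tensor_ract R M N"
  "lact (tensor_bimod R M N) = tensor_lact R M N"
  by (simp_all add: tensor_bimod_def Let_def)

lemma additive_map_tensor_rmod [simp]:
  "additive_map (tensor_rmod R M N) P f = additive_map (tensor_group R M N) P f"
  "additive_map P (tensor_rmod R M N) g = additive_map P (tensor_group R M N) g"
  by (simp_all add: additive_map_def)

lemma additive_map_tensor_bimod [simp]:
  "additive_map (tensor_bimod R M N) P f = additive_map (tensor_group R M N) P f"
  "additive_map P (tensor_bimod R M N) g = additive_map P (tensor_group R M N) g"
  by (simp_all add: additive_map_def)

lemma right_linear_tensor_bimod [simp]:
  "right_linear S (tensor_bimod R M N) P f = right_linear S (tensor_rmod R M N) P f"
  "right_linear S P (tensor_bimod R M N) g = right_linear S P (tensor_rmod R M N) g"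
  by (simp_all add: right_linear_def)

lemma abelian_group_cong:
  assumes "abelian_group P" "carrier Q = carrier P" "ring.add Q = ring.add P" "ring.zero Q = ring.zero P"
  shows "abelian_group Q"
proof -
  interpret P: abelian_group P by fact
  have "\<exists>y\<in>carrier P. y \<oplus>\<^bsub>P\<^esub> x = \<zero>\<^bsub>P\<^esub>" if "x \<in> carrier P" for x
    using P.l_neg P.a_inv_closed that by blast
  then show ?thesis
    by (intro abelian_groupI) (simp_all add: assms(2-) P.a_ac)
qed

context tensor_product
begin

lemma tensor_ract_balanced:
  assumes "bimodule R S N" "s \<in> carrier S"
  shows "balanced_map R M N (tensor_group R M N) (\<lambda>m n. tensor R M N m (n \<triangleleft>\<^bsub>N\<^esub> s))"
proof -
  interpret N': bimodule R S N by fact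
  show ?thesis
    using assms(2)
    by (auto simp: balanced_map_def tensor_closed N'.ract_closed tensor_add_left tensor_add_right
        N'.ract_add_left tensor_balanced N'.lact_ract)
qed

lemma tensor_ract_additive:
  assumes "bimodule R S N" "s \<in> carrier S"
  shows "additive_map (tensor_group R M N) (tensor_group R M N) (\<lambda>t. tensor_ract R M N t s)"
  unfolding tensor_ract_def
  by (rule tensor_lift_additive[OF abelian_tensor_group tensor_ract_balanced[OF assms]])

lemma tensor_ract_pure:
  assumes "bimodule R S N" "s \<in> carrier S" "m \<in> carrier M" "n \<in> carrier N"
  shows "tensor_ract R M N (tensor R M N m n) s = tensor R M N m (n \<triangleleft>\<^bsub>N\<^esub> s)"
  unfolding tensor_ract_def
  by (rule tensor_lift_pure[OF abelian_tensor_group tensor_ract_balanced[OF assms(1,2)] assms(3,4)])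

lemma tensor_rmod_right_module:
  assumes N: "bimodule R S N"
  shows "right_module S (tensor_rmod R M N)"
proof -
  let ?T = "tensor_group R M N"
  interpret N': bimodule R S N by fact
  interpret T: abelian_group ?T by (rule abelian_tensor_group)
  note add = additive_map_add[OF tensor_ract_additive[OF N]] and closed = additive_map_closed[OF tensor_ract_additive[OF N]]
  have add_scalar: "tensor_ract R M N t (r \<oplus>\<^bsub>S\<^esub> s) = tensor_ract R M N t r \<oplus>\<^bsub>?T\<^esub> tensor_ract R M N t s"
    if "t \<in> carrier ?T" "r \<in> carrier S" "s \<in> carrier S" for t r s
    using that(1)
  proof (induction t rule: tensor_induct)
    case (pure m n)
    then show ?case using that
      by (simp add: tensor_ract_pure[OF N] N'.ract_add_right tensor_add_right N'.ract_closed)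
  next
    case (add u v)
    then show ?case using that
      by (simp add: additive_map_add[OF tensor_ract_additive[OF N]] closed T.a_ac)
  qed
  have mult_scalar: "tensor_ract R M N t (r \<otimes>\<^bsub>S\<^esub> s) = tensor_ract R M N (tensor_ract R M N t r) s"
    if "t \<in> carrier ?T" "r \<in> carrier S" "s \<in> carrier S" for t r s
    using that(1)
  proof (induction t rule: tensor_induct)
    case (pure m n)
    then show ?case using that
      by (simp add: tensor_ract_pure[OF N] N'.ract_mult N'.ract_closed)
  next
    case (add u v)
    then show ?case using that
      by (simp add: additive_map_add[OF tensor_ract_additive[OF N]] closed)
  qed
  have one_scalar: "tensor_ract R M N t \<one>\<^bsub>S\<^esub> = t" if "t \<in> carrier ?T" for t
    using that
  proof (induction t rule: tensor_induct)
    case (pure m n)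
    then show ?case
      by (simp add: tensor_ract_pure[OF N] N'.ract_one)
  next
    case (add u v)
    then show ?case
      by (simp add: additive_map_add[OF tensor_ract_additive[OF N]])
  qed
  have "abelian_group (tensor_rmod R M N)"
    by (rule abelian_group_cong[OF abelian_tensor_group]) simp_all
  then show ?thesis
    by (intro right_module.intro right_module_axioms.intro N'.R.ring_axioms)
       (simp_all add: add closed add_scalar mult_scalar one_scalar)
qed

end

text \<open>The left action on \<open>M \<otimes>\<^sub>R N\<close> needs one on \<open>M\<close>, which \<^locale>\<open>tensor_product\<close> does not provide.\<close>

locale tensor_product_bimodule = M': bimodule L R M + tensor_product R M N
  for L :: "('l, 'z) ring_scheme" and R :: "('r, 'w) ring_scheme" and M :: "('l, 'r, 'm, 'x) bimod_scheme"
    and N :: "('r, 's, 'n, 'y) bimod_scheme"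
begin

lemma tensor_lact_balanced:
  assumes "l \<in> carrier L"
  shows "balanced_map R M N (tensor_group R M N) (\<lambda>m n. tensor R M N (l \<triangleright>\<^bsub>M\<^esub> m) n)"
proof -
  show ?thesis
    using assms
    by (auto simp: balanced_map_def tensor_closed M'.lact_closed tensor_add_left tensor_add_right
        M'.lact_add_right tensor_balanced[symmetric] M'.lact_ract[symmetric])
qed

lemma tensor_lact_additive:
  assumes "l \<in> carrier L"
  shows "additive_map (tensor_group R M N) (tensor_group R M N) (tensor_lact R M N l)"
  unfolding tensor_lact_def
  by (rule tensor_lift_additive[OF abelian_tensor_group tensor_lact_balanced[OF assms]])

lemma tensor_lact_pure:
  assumes "l \<in> carrier L" "m \<in> carrier M" "n \<in> carrier N"
  shows "tensor_lact R M N l (tensor R M N m n) = tensor R M N (l \<triangleright>\<^bsub>M\<^esub> m) n"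
  unfolding tensor_lact_def
  by (rule tensor_lift_pure[OF abelian_tensor_group tensor_lact_balanced[OF assms(1)] assms(2,3)])

lemma tensor_bimod_left_module:
  "left_module L (tensor_bimod R M N)"
proof -
  let ?T = "tensor_group R M N"
  interpret T: abelian_group ?T by (rule abelian_tensor_group)
  note add = additive_map_add[OF tensor_lact_additive] and closed = additive_map_closed[OF tensor_lact_additive]
  have add_scalar: "tensor_lact R M N (k \<oplus>\<^bsub>L\<^esub> l) t = tensor_lact R M N k t \<oplus>\<^bsub>?T\<^esub> tensor_lact R M N l t"
    if "t \<in> carrier ?T" "k \<in> carrier L" "l \<in> carrier L" for t k l
    using that(1)
  proof (induction t rule: tensor_induct)
    case (pure m n)
    then show ?case using that
      by (simp add: tensor_lact_pure M'.lact_add_left tensor_add_left M'.lact_closed)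
  next
    case (add u v)
    then show ?case using that
      by (simp add: additive_map_add[OF tensor_lact_additive] closed T.a_ac)
  qed
  have mult_scalar: "tensor_lact R M N (k \<otimes>\<^bsub>L\<^esub> l) t = tensor_lact R M N k (tensor_lact R M N l t)"
    if "t \<in> carrier ?T" "k \<in> carrier L" "l \<in> carrier L" for t k l
    using that(1)
  proof (induction t rule: tensor_induct)
    case (pure m n)
    then show ?case using that
      by (simp add: tensor_lact_pure M'.lact_mult M'.lact_closed)
  next
    case (add u v)
    then show ?case using that
      by (simp add: additive_map_add[OF tensor_lact_additive] closed)
  qed
  have one_scalar: "tensor_lact R M N \<one>\<^bsub>L\<^esub> t = t" if "t \<in> carrier ?T" for t
    using that
  proof (induction t rule: tensor_induct)
    case (pure m n)
    then show ?case
      by (simp add: tensor_lact_pure M'.lact_one)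
  next
    case (add u v)
    then show ?case
      by (simp add: additive_map_add[OF tensor_lact_additive])
  qed
  have "abelian_group (tensor_bimod R M N)"
    by (rule abelian_group_cong[OF abelian_tensor_group]) simp_all
  then show ?thesis
    by (intro left_module.intro left_module_axioms.intro M'.L.ring_axioms)
       (simp_all add: add closed add_scalar mult_scalar one_scalar)
qed

end

lemma tensor_product_bimod:
  "right_module R M \<Longrightarrow> bimodule R S N \<Longrightarrow> tensor_product R M N"
  by (intro tensor_product.intro bimodule_left)

lemma tensor_bimod_bimodule:
  assumes M: "bimodule L R M" and N: "bimodule R S N"
  shows "bimodule L S (tensor_bimod R M N)"
proof -
  interpret M': bimodule L R M by fact
  interpret N': bimodule R S N by fact
  interpret tensor_product_bimodule L R M N
    by (intro tensor_product_bimodule.intro tensor_product_bimod[OF bimodule_right[OF M] N] M)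
  interpret T: left_module L "tensor_bimod R M N" by (rule tensor_bimod_left_module)
  have "right_module S (tensor_rmod R M N)" by (rule tensor_rmod_right_module[OF N])
  then interpret U: right_module S "tensor_rmod R M N" .
  have comm: "tensor_ract R M N (tensor_lact R M N l t) s = tensor_lact R M N l (tensor_ract R M N t s)"
    if "t \<in> carrier (tensor_group R M N)" "l \<in> carrier L" "s \<in> carrier S" for t l s
    using that(1)
  proof (induction t rule: tensor_induct)
    case (pure m n)
    then show ?case using that
      by (simp add: tensor_lact_pure tensor_ract_pure[OF N] M'.lact_closed N'.ract_closed)
  next
    case (add u v)
    then show ?case using that
      by (simp add: additive_map_add[OF tensor_lact_additive] additive_map_add[OF tensor_ract_additive[OF N]]
          additive_map_closed[OF tensor_lact_additive] additive_map_closed[OF tensor_ract_additive[OF N]])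
  qed
  have "right_module S (tensor_bimod R M N)"
    using U.ract_closed U.ract_add_left U.ract_add_right U.ract_mult U.ract_one
    by (intro right_module.intro right_module_axioms.intro N'.R.ring_axioms T.M.abelian_group_axioms) simp_all
  then show ?thesis
    using T.lact_closed T.lact_add_left T.lact_add_right T.lact_mult T.lact_one comm
    by (intro bimodule.intro bimodule_axioms.intro M'.L.ring_axioms) simp_all
qed

lemma tensor_map_balanced:
  assumes "tensor_product R M N" "tensor_product R M' N'" "right_linear R M M' f" "left_linear R N N' g"
  shows "balanced_map R M N (tensor_group R M' N') (\<lambda>m n. tensor R M' N' (f m) (g n))"
proof -
  interpret T: tensor_product R M' N' by fact
  show ?thesis
    using assms(3,4)
    by (simp add: balanced_map_def right_linearD[OF assms(3)] left_linearD[OF assms(4)]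
        T.tensor_closed T.tensor_add_left T.tensor_add_right T.tensor_balanced)
qed

lemma tensor_map_properties:
  assumes "tensor_product R M N" "tensor_product R M' N'" "right_linear R M M' f" "left_linear R N N' g"
  shows tensor_map_additive: "additive_map (tensor_group R M N) (tensor_group R M' N') (tensor_map R M N M' N' f g)"
    and tensor_map_extensional: "tensor_map R M N M' N' f g \<in> extensional (carrier (tensor_group R M N))"
    and tensor_map_pure: "m \<in> carrier M \<Longrightarrow> n \<in> carrier N \<Longrightarrow>
      tensor_map R M N M' N' f g (tensor R M N m n) = tensor R M' N' (f m) (g n)"
  unfolding tensor_map_def
  using tensor_product.tensor_lift_properties[OF assms(1) tensor_product.abelian_tensor_group[OF assms(2)]
      tensor_map_balanced[OF assms]] by blast+

lemma tensor_map_closed: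
  assumes "tensor_product R M N" "tensor_product R M' N'" "right_linear R M M' f" "left_linear R N N' g"
    and "t \<in> carrier (tensor_group R M N)"
  shows "tensor_map R M N M' N' f g t \<in> carrier (tensor_group R M' N')"
  by (rule additive_map_closed[OF tensor_map_additive[OF assms(1-4)] assms(5)])

lemma tensor_map_right_linear:
  assumes T: "tensor_product R M N" "tensor_product R M' N'" "right_linear R M M' f" "left_linear R N N' g"
    and N: "bimodule R S N" "bimodule R S N'" and g: "right_linear S N N' g"
  shows "right_linear S (tensor_rmod R M N) (tensor_rmod R M' N') (tensor_map R M N M' N' f g)"
proof -
  interpret T: tensor_product R M N by fact
  interpret T': tensor_product R M' N' by fact
  interpret N: bimodule R S N by fact
  have "tensor_map R M N M' N' f g (tensor_ract R M N t s) = tensor_ract R M' N' (tensor_map R M N M' N' f g t) s"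
    if "t \<in> carrier (tensor_group R M N)" "s \<in> carrier S" for t s
    by (rule T.tensor_eqI[OF additive_map_comp[OF T.tensor_ract_additive[OF N(1) that(2)] tensor_map_additive[OF T]]
          additive_map_comp[OF tensor_map_additive[OF T] T'.tensor_ract_additive[OF N(2) that(2)]] _ that(1)])
       (simp add: that T.tensor_ract_pure[OF N(1)] T'.tensor_ract_pure[OF N(2)] tensor_map_pure[OF T] N.ract_closed
          right_linearD[OF T(3)] right_linearD[OF g])
  then show ?thesis
    by (simp add: right_linear_def tensor_map_additive[OF T])
qed

lemma tensor_map_cong:
  assumes T: "tensor_product R M N" "tensor_product R M' N'" "right_linear R M M' f" "left_linear R N N' g"
    and T': "right_linear R M M' f'" "left_linear R N N' g'"
    and "\<And>m. m \<in> carrier M \<Longrightarrow> f m = f' m" "\<And>n. n \<in> carrier N \<Longrightarrow> g n = g' n"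
    and t: "t \<in> carrier (tensor_group R M N)"
  shows "tensor_map R M N M' N' f g t = tensor_map R M N M' N' f' g' t"
  by (rule tensor_product.tensor_eqI[OF T(1) tensor_map_additive[OF T] tensor_map_additive[OF T(1,2) T'] _ t])
     (simp add: tensor_map_pure[OF T] tensor_map_pure[OF T(1,2) T'] assms)

text \<open>The composites \<open>f''\<close> and \<open>g''\<close> are only required to be composites on the carriers. The rule thus splits \<open>f \<otimes> g\<close> as
  \<open>(f \<otimes> 1)(1 \<otimes> g)\<close> or as \<open>(1 \<otimes> g)(f \<otimes> 1)\<close>, and merges such products, without any \<open>\<circ>\<close> in the goals.\<close>

lemma tensor_map_comp:
  assumes T: "tensor_product R M N" "tensor_product R M' N'" "right_linear R M M' f" "left_linear R N N' g"
    and T': "tensor_product R M'' N''" "right_linear R M' M'' f'" "left_linear R N' N'' g'"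
    and T'': "right_linear R M M'' f''" "left_linear R N N'' g''"
    and "\<And>m. m \<in> carrier M \<Longrightarrow> f' (f m) = f'' m" "\<And>n. n \<in> carrier N \<Longrightarrow> g' (g n) = g'' n"
    and t: "t \<in> carrier (tensor_group R M N)"
  shows "tensor_map R M' N' M'' N'' f' g' (tensor_map R M N M' N' f g t) = tensor_map R M N M'' N'' f'' g'' t"
  by (rule tensor_product.tensor_eqI[OF T(1) additive_map_comp[OF tensor_map_additive[OF T] tensor_map_additive[OF T(2) T']]
        tensor_map_additive[OF T(1) T'(1) T''] _ t])
     (simp add: tensor_map_pure[OF T] tensor_map_pure[OF T(2) T'] tensor_map_pure[OF T(1) T'(1) T''] assms
       right_linearD[OF T(3)] left_linearD[OF T(4)])

lemma tensor_map_ident: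
  assumes T: "tensor_product R M N" and t: "t \<in> carrier (tensor_group R M N)"
  shows "tensor_map R M N M N (\<lambda>m. m) (\<lambda>n. n) t = t"
  by (rule tensor_product.tensor_eqI[OF T tensor_map_additive[OF T T right_linear_id left_linear_id] _ _ t])
     (simp_all add: tensor_map_pure[OF T T right_linear_id left_linear_id] additive_map_def)

section \<open>The associativity and unit isomorphisms\<close>

locale triple_tensor_product =
  M: right_module R M + N: bimodule R S N + P: left_module S P
  for R :: "('r, 'v) ring_scheme" and S :: "('s, 'w) ring_scheme" and M :: "('r, 'm, 'x) rmod_scheme"
    and N :: "('r, 's, 'n, 'y) bimod_scheme" and P :: "('s, 't, 'p, 'z) bimod_scheme"
begin

sublocale MN: tensor_product R M N
  by (rule tensor_product_bimod[OF M.right_module_axioms N.bimodule_axioms])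

sublocale NP: tensor_product_bimodule R S N P
  by (intro tensor_product_bimodule.intro tensor_product.intro N.bimodule_axioms N.right_module_axioms
      P.left_module_axioms)

sublocale MN_P: tensor_product S "tensor_rmod R M N" P
  by (intro tensor_product.intro MN.tensor_rmod_right_module N.bimodule_axioms P.left_module_axioms)

sublocale M_NP: tensor_product R M "tensor_bimod S N P"
  by (intro tensor_product.intro NP.tensor_bimod_left_module M.right_module_axioms)

text \<open>The associativity map is a lift of lifts: for every \<open>p\<close> one over \<open>R\<close>, whose dependence on \<open>p\<close> is in turn balanced
  over \<open>S\<close>.\<close>

lemma assoc_inner_balanced:
  assumes "p \<in> carrier P"
  shows "balanced_map R M N (tensor_group R M (tensor_bimod S N P))
    (\<lambda>m n. tensor R M (tensor_bimod S N P) m (tensor S N P n p))"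
  using assms
  by (simp add: balanced_map_def M_NP.tensor_closed NP.tensor_closed M_NP.tensor_add_left
      NP.tensor_add_left M_NP.tensor_add_right[simplified] M_NP.tensor_balanced[simplified] NP.tensor_lact_pure)

lemmas assoc_inner_pure = MN.tensor_lift_pure[OF M_NP.abelian_tensor_group assoc_inner_balanced]
lemmas assoc_inner_additive = MN.tensor_lift_additive[OF M_NP.abelian_tensor_group assoc_inner_balanced]

lemma assoc_outer_balanced:
  "balanced_map S (tensor_rmod R M N) P (tensor_group R M (tensor_bimod S N P))
    (\<lambda>t p. tensor_lift R M N (tensor_group R M (tensor_bimod S N P))
      (\<lambda>m n. tensor R M (tensor_bimod S N P) m (tensor S N P n p)) t)" (is "balanced_map _ _ _ ?Q ?h")
proof -
  interpret Q: abelian_group ?Q by (rule M_NP.abelian_tensor_group)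
  have closed: "?h t p \<in> carrier ?Q" if "t \<in> carrier (tensor_group R M N)" "p \<in> carrier P" for t p
    by (rule additive_map_closed[OF assoc_inner_additive[OF that(2)] that(1)])
  have add_left: "?h (t \<oplus>\<^bsub>tensor_group R M N\<^esub> u) p = ?h t p \<oplus>\<^bsub>?Q\<^esub> ?h u p"
    if "t \<in> carrier (tensor_group R M N)" "u \<in> carrier (tensor_group R M N)" "p \<in> carrier P" for t u p
    by (rule additive_map_add[OF assoc_inner_additive[OF that(3)] that(1,2)])
  have add_right: "?h t (p \<oplus>\<^bsub>P\<^esub> q) = ?h t p \<oplus>\<^bsub>?Q\<^esub> ?h t q"
    if "t \<in> carrier (tensor_group R M N)" "p \<in> carrier P" "q \<in> carrier P" for t p q
    using that(1)
  proof (induction t rule: MN.tensor_induct)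
    case (pure m n)
    then show ?case using that
      by (simp add: assoc_inner_pure NP.tensor_add_right M_NP.tensor_add_right[simplified] NP.tensor_closed)
  next
    case (add u v)
    then show ?case using that by (simp add: add_left closed Q.a_ac)
  qed
  have bal: "?h (tensor_ract R M N t s) p = ?h t (s \<triangleright>\<^bsub>P\<^esub> p)"
    if "t \<in> carrier (tensor_group R M N)" "s \<in> carrier S" "p \<in> carrier P" for t s p
    using that(1)
  proof (induction t rule: MN.tensor_induct)
    case (pure m n)
    then show ?case using that
      by (simp add: assoc_inner_pure MN.tensor_ract_pure[OF N.bimodule_axioms] N.ract_closed P.lact_closed
          NP.tensor_balanced)
  next
    case (add u v)
    note ract = MN.tensor_ract_additive[OF N.bimodule_axioms \<open>s \<in> carrier S\<close>]
    show ?case using that add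
      by (simp add: add_left closed additive_map_add[OF ract] additive_map_closed[OF ract] P.lact_closed)
  qed
  show ?thesis
    by (simp add: balanced_map_def closed add_left add_right bal)
qed

lemma tensor_assoc_additive:
  "additive_map (tensor_group S (tensor_rmod R M N) P) (tensor_group R M (tensor_bimod S N P))
    (tensor_assoc R S M N P)"
  unfolding tensor_assoc_def Let_def
  by (rule MN_P.tensor_lift_additive[OF M_NP.abelian_tensor_group assoc_outer_balanced])

lemma tensor_assoc_pure:
  assumes "m \<in> carrier M" "n \<in> carrier N" "p \<in> carrier P"
  shows "tensor_assoc R S M N P (tensor S (tensor_rmod R M N) P (tensor R M N m n) p)
    = tensor R M (tensor_bimod S N P) m (tensor S N P n p)"
  unfolding tensor_assoc_def Let_def
  by (subst MN_P.tensor_lift_pure[OF M_NP.abelian_tensor_group assoc_outer_balanced])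
     (simp_all add: assms MN.tensor_closed assoc_inner_pure)

lemma triple_tensor_eqI:
  assumes f: "additive_map (tensor_group S (tensor_rmod R M N) P) Q f"
    and g: "additive_map (tensor_group S (tensor_rmod R M N) P) Q g"
    and pure: "\<And>m n p. m \<in> carrier M \<Longrightarrow> n \<in> carrier N \<Longrightarrow> p \<in> carrier P \<Longrightarrow>
      f (tensor S (tensor_rmod R M N) P (tensor R M N m n) p)
        = g (tensor S (tensor_rmod R M N) P (tensor R M N m n) p)"
    and u: "u \<in> carrier (tensor_group S (tensor_rmod R M N) P)"
  shows "f u = g u"
proof (rule MN_P.tensor_eqI[OF f g _ u])
  fix t p assume "t \<in> carrier (tensor_rmod R M N)" and p: "p \<in> carrier P"
  then have "t \<in> carrier (tensor_group R M N)" by simp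
  then show "f (tensor S (tensor_rmod R M N) P t p) = g (tensor S (tensor_rmod R M N) P t p)"
  proof (induction t rule: MN.tensor_induct)
    case (pure m n)
    then show ?case using p by (rule assms(3))
  next
    case (add s t)
    then show ?case using p
      by (simp add: MN_P.tensor_add_left[simplified] MN_P.tensor_closed additive_map_add[OF f] additive_map_add[OF g])
  qed
qed

end

lemma tensor_assoc_natural:
  assumes M: "right_module R M" "right_module R M'" and f: "right_linear R M M' f"
    and N: "bimodule R S N" and P: "left_module S P"
    and u: "u \<in> carrier (tensor_group S (tensor_rmod R M N) P)"
  shows "tensor_assoc R S M' N P (tensor_map S (tensor_rmod R M N) P (tensor_rmod R M' N) P
      (tensor_map R M N M' N f (\<lambda>n. n)) (\<lambda>p. p) u)
    = tensor_map R M (tensor_bimod S N P) M' (tensor_bimod S N P) f (\<lambda>q. q) (tensor_assoc R S M N P u)"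
proof -
  interpret X: triple_tensor_product R S M N P
    by (intro triple_tensor_product.intro M N P)
  interpret Y: triple_tensor_product R S M' N P
    by (intro triple_tensor_product.intro M N P)
  note fN = X.MN.tensor_product_axioms Y.MN.tensor_product_axioms f left_linear_id
  note fNP = X.M_NP.tensor_product_axioms Y.M_NP.tensor_product_axioms f left_linear_id
  note fN_P = X.MN_P.tensor_product_axioms Y.MN_P.tensor_product_axioms
    tensor_map_right_linear[OF fN N N right_linear_id] left_linear_id
  show ?thesis
    by (rule X.triple_tensor_eqI[OF additive_map_comp[OF tensor_map_additive[OF fN_P] Y.tensor_assoc_additive]
          additive_map_comp[OF X.tensor_assoc_additive tensor_map_additive[OF fNP]] _ u])
       (simp add: tensor_map_pure[OF fN_P] tensor_map_pure[OF fN] tensor_map_pure[OF fNP] X.tensor_assoc_pure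
          Y.tensor_assoc_pure X.MN.tensor_closed X.NP.tensor_closed right_linear_closed[OF f])
qed

lemma ring_bimod_simps [simp]:
  "carrier (ring_bimod A f g) = carrier A"
  "ring.add (ring_bimod A f g) = ring.add A"
  "ring.zero (ring_bimod A f g) = ring.zero A"
  "ract (ring_bimod A f g) a r = a \<otimes>\<^bsub>A\<^esub> g r"
  "lact (ring_bimod A f g) l a = f l \<otimes>\<^bsub>A\<^esub> a"
  by (simp_all add: ring_bimod_def)

lemma bimodule_ring_bimod:
  assumes "ring A" "ring L" "ring R" "f \<in> ring_hom L A" "g \<in> ring_hom R A"
  shows "bimodule L R (ring_bimod A f g)"
proof -
  interpret A: ring A by fact
  have "abelian_group (ring_bimod A f g)"
    by (rule abelian_group_cong[OF A.abelian_group_axioms]) simp_all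
  then show ?thesis
    using assms
    by (intro bimodule.intro bimodule_axioms.intro right_module.intro right_module_axioms.intro)
       (simp_all add: ring_hom_closed ring_hom_add ring_hom_mult ring_hom_one A.l_distr A.r_distr A.m_assoc)
qed

lemma ident_ring_hom: "(\<lambda>a. a) \<in> ring_hom A A"
  by (simp add: ring_hom_def)

lemma bimodule_regular: "ring A \<Longrightarrow> bimodule A A (regular_bimod A)"
  by (rule bimodule_ring_bimod) (simp_all add: ident_ring_hom)

lemma tensor_unit_right_properties:
  assumes M: "right_module R M"
  shows tensor_unit_right_additive:
      "additive_map (tensor_group R M (regular_bimod R)) M (tensor_unit_right R M)"
    and tensor_unit_right_pure: "m \<in> carrier M \<Longrightarrow> r \<in> carrier R \<Longrightarrow>
      tensor_unit_right R M (tensor R M (regular_bimod R) m r) = m \<triangleleft>\<^bsub>M\<^esub> r"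
proof -
  interpret M: right_module R M by fact
  interpret T: tensor_product R M "regular_bimod R"
    by (rule tensor_product_bimod[OF M bimodule_regular[OF M.R.ring_axioms]])
  have bal: "balanced_map R M (regular_bimod R) M (\<lambda>m r. m \<triangleleft>\<^bsub>M\<^esub> r)"
    by (simp add: balanced_map_def M.ract_closed M.ract_add_left M.ract_add_right M.ract_mult)
  show "additive_map (tensor_group R M (regular_bimod R)) M (tensor_unit_right R M)"
    and "m \<in> carrier M \<Longrightarrow> r \<in> carrier R \<Longrightarrow>
      tensor_unit_right R M (tensor R M (regular_bimod R) m r) = m \<triangleleft>\<^bsub>M\<^esub> r"
    using T.tensor_lift_properties[OF M.M.abelian_group_axioms bal]
    by (simp_all add: tensor_unit_right_def)
qed

lemma tensor_unit_left_pure: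
  assumes M: "left_module R M" and "r \<in> carrier R" "m \<in> carrier M"
  shows "tensor_unit_left R M (tensor R (regular_bimod R) M r m) = r \<triangleright>\<^bsub>M\<^esub> m"
proof -
  interpret M: left_module R M by fact
  interpret T: tensor_product R "regular_bimod R" M
    by (intro tensor_product.intro bimodule_right[OF bimodule_regular[OF M.R.ring_axioms]] M)
  have "balanced_map R (regular_bimod R) M M (\<lambda>r m. r \<triangleright>\<^bsub>M\<^esub> m)"
    by (simp add: balanced_map_def M.lact_closed M.lact_add_left M.lact_add_right M.lact_mult)
  then show ?thesis
    using T.tensor_lift_pure[OF M.M.abelian_group_axioms] assms
    by (simp add: tensor_unit_left_def)
qed

lemma tensor_unit_right_natural:
  assumes M: "right_module R M" "right_module R M'" and f: "right_linear R M M' f"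
    and t: "t \<in> carrier (tensor_group R M (regular_bimod R))"
  shows "tensor_unit_right R M' (tensor_map R M (regular_bimod R) M' (regular_bimod R) f (\<lambda>r. r) t)
    = f (tensor_unit_right R M t)"
proof -
  interpret M: right_module R M by fact
  note reg = bimodule_regular[OF M.R.ring_axioms]
  note T = tensor_product_bimod[OF M(1) reg] tensor_product_bimod[OF M(2) reg] f left_linear_id
  show ?thesis
    by (rule tensor_product.tensor_eqI[OF T(1)
          additive_map_comp[OF tensor_map_additive[OF T] tensor_unit_right_additive[OF M(2)]]
          additive_map_comp[OF tensor_unit_right_additive[OF M(1)] right_linear_additive[OF f]] _ t])
       (simp add: tensor_map_pure[OF T] tensor_unit_right_pure[OF M(1)] tensor_unit_right_pure[OF M(2)]
          right_linearD[OF f])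
qed

section \<open>Forgetting left actions\<close>

text \<open>The parts of a comodule are records without a left action, those of a coring are records with one. To regard a coring as a
  comodule over itself the left action is dropped, and no construction in which it does not enter changes.\<close>

lemma truncate_simps [simp]:
  "carrier (rmod.truncate M) = carrier M"
  "ring.add (rmod.truncate M) = ring.add M"
  "ring.zero (rmod.truncate M) = ring.zero M"
  "ract (rmod.truncate M) = ract M"
  by (simp_all add: rmod.truncate_def)

lemma right_module_truncate:
  assumes "right_module R M"
  shows "right_module R (rmod.truncate M)"
proof -
  interpret M: right_module R M by fact
  have "abelian_group (rmod.truncate M)"
    by (rule abelian_group_cong[OF M.M.abelian_group_axioms]) simp_all
  then show ?thesis
    using M.ract_closed M.ract_add_left M.ract_add_right M.ract_mult M.ract_one
    by (intro right_module.intro right_module_axioms.intro M.R.ring_axioms) simp_all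
qed

lemma right_linear_truncate [simp]:
  "right_linear R (rmod.truncate M) N f = right_linear R M N f"
  "right_linear R M' (rmod.truncate N') g = right_linear R M' N' g"
  by (simp_all add: right_linear_def additive_map_def)

lemma tensor_truncate [simp]:
  "tensor_group R (rmod.truncate M) N = tensor_group R M N"
  "tensor R (rmod.truncate M) N = tensor R M N"
  "tensor_lift R (rmod.truncate M) N P h = tensor_lift R M N P h"
proof -
  have sub: "tensor_subgroup R (rmod.truncate M) N = tensor_subgroup R M N"
    by (simp add: tensor_subgroup_def tensor_rels_def)
  show gr: "tensor_group R (rmod.truncate M) N = tensor_group R M N"
    by (simp add: tensor_group_def sub)
  show te: "tensor R (rmod.truncate M) N = tensor R M N"
    by (simp add: tensor_def sub fun_eq_iff)
  show "tensor_lift R (rmod.truncate M) N P h = tensor_lift R M N P h"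
    by (simp add: tensor_lift_def gr te)
qed

lemma tensor_lift_truncate_codomain [simp]:
  "tensor_lift R M N (rmod.truncate P) h = tensor_lift R M N P h"
  unfolding tensor_lift_def add_hom_iff by (simp add: additive_map_def)

lemma tensor_rmod_truncate [simp]: "tensor_rmod R (rmod.truncate M) N = tensor_rmod R M N"
proof -
  have "tensor_ract R (rmod.truncate M) N = tensor_ract R M N"
    by (intro ext) (simp add: tensor_ract_def)
  then show ?thesis by (simp add: tensor_rmod_def)
qed

lemma tensor_map_truncate [simp]:
  "tensor_map R (rmod.truncate M) N M' N' = tensor_map R M N M' N'"
  "tensor_map R L N (rmod.truncate L') N' = tensor_map R L N L' N'"
  by (simp_all add: tensor_map_def fun_eq_iff)

lemma truncate_tensor_bimod: "rmod.truncate (tensor_bimod R M N) = tensor_rmod R M N"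
  by (simp add: tensor_bimod_def tensor_rmod_def rmod.truncate_def Let_def)

lemma tensor_assoc_truncate [simp]: "tensor_assoc R S (rmod.truncate M) N P = tensor_assoc R S M N P"
  by (simp add: tensor_assoc_def fun_eq_iff)

lemma tensor_unit_right_truncate [simp]: "tensor_unit_right R (rmod.truncate M) = tensor_unit_right R M"
  by (simp add: tensor_unit_right_def fun_eq_iff)

section \<open>The coring as a comodule, and induced comodules\<close>

text \<open>A group coring coacts on itself from the right by its comultiplication.\<close>

definition regular_comod :: "('g, 'a, 'c, 'x) coring_scheme \<Rightarrow> ('g, 'a, 'c, 'c) comod"
  where "regular_comod C = \<lparr>mpart = (\<lambda>\<alpha>. rmod.truncate (cpart C \<alpha>)), coact = comult C\<rparr>"

lemma regular_comod_simps [simp]: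
  "mpart (regular_comod C) \<alpha> = rmod.truncate (cpart C \<alpha>)"
  "coact (regular_comod C) = comult C"
  by (simp_all add: regular_comod_def)

lemma tensor_map_tensor_rmod:
  "tensor_map R M N (tensor_rmod S M' N') P = tensor_map R M N (tensor_bimod S M' N') P"
  by (simp add: truncate_tensor_bimod[symmetric])

context group_coring
begin

lemma counit_closed: "c \<in> carrier (cpart C \<one>\<^bsub>G\<^esub>) \<Longrightarrow> counit C c \<in> carrier A"
  using counit_hom by (auto simp: bimod_hom_iff dest: right_linear_closed)

lemma regular_comodule: "group_comodule G A C (regular_comod C)"
proof (intro group_comodule.intro group_comodule_axioms.intro group_coring_axioms; simp only: regular_comod_simps)
  fix \<alpha> \<beta> \<gamma> assume [simp]: "\<alpha> \<in> carrier G" "\<beta> \<in> carrier G"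
  show "right_module A (rmod.truncate (cpart C \<alpha>))"
    by (rule right_module_truncate[OF bimodule_right[OF cpart_bimodule]]) simp
  show "comult C \<alpha> \<beta> \<in> rmod_hom A (rmod.truncate (cpart C (\<alpha> \<otimes>\<^bsub>G\<^esub> \<beta>)))
      (tensor_rmod A (rmod.truncate (cpart C \<alpha>)) (cpart C \<beta>))"
    using comult_hom[of \<alpha> \<beta>] by (simp add: bimod_hom_iff rmod_hom_iff)
  fix c assume "c \<in> carrier (rmod.truncate (cpart C \<alpha>))"
  then show "tensor_unit_right A (rmod.truncate (cpart C \<alpha>))
     (tensor_map A (rmod.truncate (cpart C \<alpha>)) (cpart C \<one>\<^bsub>G\<^esub>)
       (rmod.truncate (cpart C \<alpha>)) (regular_bimod A) (\<lambda>d. d) (counit C)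
       (comult C \<alpha> \<one>\<^bsub>G\<^esub> c)) = c"
    using counit_right by simp
next
  fix \<alpha> \<beta> \<gamma> c assume "\<alpha> \<in> carrier G" "\<beta> \<in> carrier G" "\<gamma> \<in> carrier G"
    and "c \<in> carrier (rmod.truncate (cpart C (\<alpha> \<otimes>\<^bsub>G\<^esub> \<beta> \<otimes>\<^bsub>G\<^esub> \<gamma>)))"
  then show "tensor_map A (rmod.truncate (cpart C \<alpha>)) (cpart C (\<beta> \<otimes>\<^bsub>G\<^esub> \<gamma>))
      (rmod.truncate (cpart C \<alpha>)) (tensor_bimod A (cpart C \<beta>) (cpart C \<gamma>))
      (\<lambda>d. d) (comult C \<beta> \<gamma>) (comult C \<alpha> (\<beta> \<otimes>\<^bsub>G\<^esub> \<gamma>) c) =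
     tensor_assoc A A (rmod.truncate (cpart C \<alpha>)) (cpart C \<beta>) (cpart C \<gamma>)
      (tensor_map A (rmod.truncate (cpart C (\<alpha> \<otimes>\<^bsub>G\<^esub> \<beta>))) (cpart C \<gamma>)
        (tensor_rmod A (rmod.truncate (cpart C \<alpha>)) (cpart C \<beta>)) (cpart C \<gamma>)
        (comult C \<alpha> \<beta>) (\<lambda>d. d) (comult C (\<alpha> \<otimes>\<^bsub>G\<^esub> \<beta>) \<gamma> c))"
    using coassoc[of \<alpha> \<beta> \<gamma> c] by (simp add: tensor_map_tensor_rmod)
qed

end

text \<open>Through \<open>i\<close>, the ring \<open>A\<close> becomes a \<open>B\<close>-\<open>A\<close>-bimodule \<open>A\<^sub>l\<close> and an \<open>A\<close>-\<open>B\<close>-bimodule \<open>A\<^sub>r\<close>, so that \<open>F\<^sub>7\<close> tensors with \<open>A\<^sub>l\<close> and the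
  coring \<open>(A \<otimes>\<^sub>B A)\<langle>G\<rangle>\<close> is built on \<open>A\<^sub>r \<otimes>\<^sub>B A\<^sub>l\<close>.\<close>

locale grouplike_coring = group_coring G A C + B: ring B
  for G :: "('g, 'v) monoid_scheme" (structure)
    and A :: "('a, 'w) ring_scheme" (structure)
    and C :: "('g, 'a, 'c, 'x) coring_scheme" (structure)
    and B :: "('b, 'y) ring_scheme" +
  fixes x :: "'g \<Rightarrow> 'c" and i :: "'b \<Rightarrow> 'a"
  assumes grouplike: "grouplike_family G A C x"
    and i_hom: "i \<in> ring_hom B (coinvariants G A C x)"
begin

abbreviation A\<^sub>l where "A\<^sub>l \<equiv> ring_bimod A i (\<lambda>a. a)"
abbreviation A\<^sub>r where "A\<^sub>r \<equiv> ring_bimod A (\<lambda>a. a) i"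

lemma x_closed: "\<alpha> \<in> carrier G \<Longrightarrow> x \<alpha> \<in> carrier (cpart C \<alpha>)"
  using grouplike by (simp add: grouplike_family_def)

lemma comult_x:
  "\<alpha> \<in> carrier G \<Longrightarrow> \<beta> \<in> carrier G \<Longrightarrow>
    comult C \<alpha> \<beta> (x (\<alpha> \<otimes>\<^bsub>G\<^esub> \<beta>)) = tensor A (cpart C \<alpha>) (cpart C \<beta>) (x \<alpha>) (x \<beta>)"
  using grouplike by (simp add: grouplike_family_def)

lemma counit_x: "counit C (x \<one>\<^bsub>G\<^esub>) = \<one>\<^bsub>A\<^esub>"
  using grouplike by (simp add: grouplike_family_def)

lemma i_ring_hom: "i \<in> ring_hom B A"
  using i_hom by (auto simp: ring_hom_def coinvariants_def)

lemma i_x: "b \<in> carrier B \<Longrightarrow> \<alpha> \<in> carrier G \<Longrightarrow> i b \<triangleright>\<^bsub>cpart C \<alpha>\<^esub> x \<alpha> = x \<alpha> \<triangleleft>\<^bsub>cpart C \<alpha>\<^esub> i b"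
  using i_hom by (auto simp: ring_hom_def coinvariants_def)

lemma i_closed: "b \<in> carrier B \<Longrightarrow> i b \<in> carrier A"
  by (rule ring_hom_closed[OF i_ring_hom])

lemma bimodule_A\<^sub>l: "bimodule B A A\<^sub>l"
  by (rule bimodule_ring_bimod) (simp_all add: ident_ring_hom i_ring_hom A.ring_axioms B.ring_axioms)

lemma bimodule_A\<^sub>r: "bimodule A B A\<^sub>r"
  by (rule bimodule_ring_bimod) (simp_all add: ident_ring_hom i_ring_hom A.ring_axioms B.ring_axioms)

lemma F7_simps [simp]:
  "mpart (F7 A B C x i N) \<alpha> = tensor_rmod B N A\<^sub>l"
  "coact (F7 A B C x i N) \<alpha> \<beta> = tensor_lift B N A\<^sub>l (tensor_group A (tensor_rmod B N A\<^sub>l) (cpart C \<beta>))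
    (\<lambda>n a. tensor A (tensor_rmod B N A\<^sub>l) (cpart C \<beta>) (tensor B N A\<^sub>l n \<one>\<^bsub>A\<^esub>) (x \<beta> \<triangleleft>\<^bsub>cpart C \<beta>\<^esub> a))"
  by (simp_all add: F7_def Let_def)

end

locale induced_comodule = grouplike_coring G A C B x i + N: right_module B N
  for G :: "('g, 'v) monoid_scheme" (structure)
    and A :: "('a, 'w) ring_scheme" (structure)
    and C :: "('g, 'a, 'c, 'x) coring_scheme" (structure)
    and B :: "('b, 'y) ring_scheme" and x :: "'g \<Rightarrow> 'c" and i :: "'b \<Rightarrow> 'a"
    and N :: "('b, 'n) rmod"
begin

sublocale NA: tensor_product B N A\<^sub>l
  by (rule tensor_product_bimod[OF N.right_module_axioms bimodule_A\<^sub>l])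

abbreviation T where "T \<equiv> tensor_rmod B N A\<^sub>l"
abbreviation \<rho> where "\<rho> \<equiv> coact (F7 A B C x i N)"

lemma T_module: "right_module A T"
  by (rule NA.tensor_rmod_right_module[OF bimodule_A\<^sub>l])

lemma TC: "\<beta> \<in> carrier G \<Longrightarrow> tensor_product A T (cpart C \<beta>)"
  by (rule tensor_product_bimod[OF T_module cpart_bimodule])

text \<open>The coaction of \<open>F\<^sub>7(N)\<close> is well defined because \<open>i\<close> maps into the coinvariants:
  \<open>(n b \<otimes> 1) \<otimes> x\<^sub>\<beta> a = (n \<otimes> 1) i(b) \<otimes> x\<^sub>\<beta> a = (n \<otimes> 1) \<otimes> i(b) x\<^sub>\<beta> a = (n \<otimes> 1) \<otimes> x\<^sub>\<beta> i(b) a\<close>.\<close>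

lemma coact_balanced:
  assumes \<beta>: "\<beta> \<in> carrier G"
  shows "balanced_map B N A\<^sub>l (tensor_group A T (cpart C \<beta>))
    (\<lambda>n a. tensor A T (cpart C \<beta>) (tensor B N A\<^sub>l n \<one>\<^bsub>A\<^esub>) (x \<beta> \<triangleleft>\<^bsub>cpart C \<beta>\<^esub> a))"
proof -
  interpret C\<beta>: bimodule A A "cpart C \<beta>" by (rule cpart_bimodule[OF \<beta>])
  interpret TC: tensor_product A T "cpart C \<beta>" by (rule TC[OF \<beta>])
  have "tensor A T (cpart C \<beta>) (tensor B N A\<^sub>l (n \<triangleleft>\<^bsub>N\<^esub> b) \<one>\<^bsub>A\<^esub>) (x \<beta> \<triangleleft>\<^bsub>cpart C \<beta>\<^esub> a)
    = tensor A T (cpart C \<beta>) (tensor B N A\<^sub>l n \<one>\<^bsub>A\<^esub>) (x \<beta> \<triangleleft>\<^bsub>cpart C \<beta>\<^esub> (i b \<otimes>\<^bsub>A\<^esub> a))"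
    if n: "n \<in> carrier N" and b: "b \<in> carrier B" and a: "a \<in> carrier A" for n b a
  proof -
    have ib: "i b \<in> carrier A" using b by (rule i_closed)
    have "tensor B N A\<^sub>l (n \<triangleleft>\<^bsub>N\<^esub> b) \<one>\<^bsub>A\<^esub> = tensor_ract B N A\<^sub>l (tensor B N A\<^sub>l n \<one>\<^bsub>A\<^esub>) (i b)"
      using n b ib by (simp add: NA.tensor_balanced NA.tensor_ract_pure[OF bimodule_A\<^sub>l])
    then show ?thesis
      using TC.tensor_balanced[of "tensor B N A\<^sub>l n \<one>\<^bsub>A\<^esub>" "i b" "x \<beta> \<triangleleft>\<^bsub>cpart C \<beta>\<^esub> a"] n a ib
      by (simp add: NA.tensor_closed C\<beta>.ract_closed x_closed[OF \<beta>] C\<beta>.lact_ract[symmetric] i_x[OF b \<beta>]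
          C\<beta>.ract_mult)
  qed
  then show ?thesis
    by (simp add: balanced_map_def TC.tensor_closed NA.tensor_closed C\<beta>.ract_closed x_closed[OF \<beta>]
        NA.tensor_add_left TC.tensor_add_left[simplified] C\<beta>.ract_add_right TC.tensor_add_right)
qed

lemma coact_properties:
  assumes \<beta>: "\<beta> \<in> carrier G"
  shows coact_extensional: "\<rho> \<alpha> \<beta> \<in> extensional (carrier T)"
    and coact_additive: "additive_map (tensor_group B N A\<^sub>l) (tensor_group A T (cpart C \<beta>)) (\<rho> \<alpha> \<beta>)"
    and coact_pure: "n \<in> carrier N \<Longrightarrow> a \<in> carrier A \<Longrightarrow> \<rho> \<alpha> \<beta> (tensor B N A\<^sub>l n a)
      = tensor A T (cpart C \<beta>) (tensor B N A\<^sub>l n \<one>\<^bsub>A\<^esub>) (x \<beta> \<triangleleft>\<^bsub>cpart C \<beta>\<^esub> a)"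
  using NA.tensor_lift_properties[OF tensor_product.abelian_tensor_group[OF TC[OF \<beta>]] coact_balanced[OF \<beta>]]
  by simp_all

lemma coact_right_linear:
  assumes \<beta>: "\<beta> \<in> carrier G"
  shows "right_linear A T (tensor_rmod A T (cpart C \<beta>)) (\<rho> \<alpha> \<beta>)"
proof -
  interpret C\<beta>: bimodule A A "cpart C \<beta>" by (rule cpart_bimodule[OF \<beta>])
  interpret TC: tensor_product A T "cpart C \<beta>" by (rule TC[OF \<beta>])
  note \<rho> = coact_additive[OF \<beta>]
  have "\<rho> \<alpha> \<beta> (tensor_ract B N A\<^sub>l t a) = tensor_ract A T (cpart C \<beta>) (\<rho> \<alpha> \<beta> t) a"
    if "t \<in> carrier (tensor_group B N A\<^sub>l)" and a: "a \<in> carrier A" for t a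
    by (rule NA.tensor_eqI[OF additive_map_comp[OF NA.tensor_ract_additive[OF bimodule_A\<^sub>l a] \<rho>]
          additive_map_comp[OF \<rho> TC.tensor_ract_additive[OF C\<beta>.bimodule_axioms a]] _ that(1)])
       (simp add: coact_pure[OF \<beta>] NA.tensor_ract_pure[OF bimodule_A\<^sub>l] a NA.tensor_closed
          TC.tensor_ract_pure[OF C\<beta>.bimodule_axioms] C\<beta>.ract_mult C\<beta>.ract_closed x_closed[OF \<beta>] del: F7_simps)
  then show ?thesis using \<rho> by (simp add: right_linear_def)
qed

text \<open>On \<open>n \<otimes> a\<close> both sides of coassociativity are \<open>(n \<otimes> 1) \<otimes> (x\<^sub>\<beta> \<otimes> x\<^sub>\<gamma> a)\<close>, as \<open>x\<close> is grouplike, and the counit law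
  amounts to \<open>\<epsilon>(x\<^sub>e a) = a\<close>.\<close>

lemma F7_comodule: "group_comodule G A C (F7 A B C x i N)"
proof (intro group_comodule.intro group_comodule_axioms.intro group_coring_axioms; (simp only: F7_simps(1))?)
  fix \<alpha> \<beta> assume \<alpha>: "\<alpha> \<in> carrier G" and \<beta>: "\<beta> \<in> carrier G"
  show "right_module A T" by (rule T_module)
  show "\<rho> \<alpha> \<beta> \<in> rmod_hom A T (tensor_rmod A T (cpart C \<beta>))"
    unfolding rmod_hom_iff using coact_extensional[OF \<beta>] coact_right_linear[OF \<beta>] by blast
next
  fix \<alpha> \<beta> \<gamma> t assume \<alpha>: "\<alpha> \<in> carrier G" and \<beta>: "\<beta> \<in> carrier G" and \<gamma>: "\<gamma> \<in> carrier G"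
    and "t \<in> carrier T"
  then have t: "t \<in> carrier (tensor_group B N A\<^sub>l)" and \<beta>\<gamma>: "\<beta> \<otimes>\<^bsub>G\<^esub> \<gamma> \<in> carrier G" by simp_all
  interpret C\<beta>: bimodule A A "cpart C \<beta>" by (rule cpart_bimodule[OF \<beta>])
  interpret C\<gamma>: bimodule A A "cpart C \<gamma>" by (rule cpart_bimodule[OF \<gamma>])
  interpret C\<beta>\<gamma>: bimodule A A "cpart C (\<beta> \<otimes>\<^bsub>G\<^esub> \<gamma>)" by (rule cpart_bimodule[OF \<beta>\<gamma>])
  interpret X: triple_tensor_product A A T "cpart C \<beta>" "cpart C \<gamma>"
    by (intro triple_tensor_product.intro T_module C\<beta>.bimodule_axioms bimodule_left[OF C\<gamma>.bimodule_axioms])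
  have \<Delta>: "right_linear A (cpart C (\<beta> \<otimes>\<^bsub>G\<^esub> \<gamma>)) (tensor_rmod A (cpart C \<beta>) (cpart C \<gamma>)) (comult C \<beta> \<gamma>)"
    "left_linear A (cpart C (\<beta> \<otimes>\<^bsub>G\<^esub> \<gamma>)) (tensor_bimod A (cpart C \<beta>) (cpart C \<gamma>)) (comult C \<beta> \<gamma>)"
    using comult_hom[OF \<beta> \<gamma>] by (simp_all add: bimod_hom_iff)
  note id\<Delta> = TC[OF \<beta>\<gamma>] X.M_NP.tensor_product_axioms right_linear_id \<Delta>(2)
  note \<rho>id = TC[OF \<gamma>] X.MN_P.tensor_product_axioms coact_right_linear[OF \<beta>, of \<alpha>] left_linear_id
  show "tensor_map A T (cpart C (\<beta> \<otimes>\<^bsub>G\<^esub> \<gamma>)) T (tensor_bimod A (cpart C \<beta>) (cpart C \<gamma>)) (\<lambda>d. d)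
      (comult C \<beta> \<gamma>) (\<rho> \<alpha> (\<beta> \<otimes>\<^bsub>G\<^esub> \<gamma>) t) =
    tensor_assoc A A T (cpart C \<beta>) (cpart C \<gamma>)
     (tensor_map A T (cpart C \<gamma>) (tensor_rmod A T (cpart C \<beta>)) (cpart C \<gamma>) (\<rho> \<alpha> \<beta>) (\<lambda>d. d)
       (\<rho> (\<alpha> \<otimes>\<^bsub>G\<^esub> \<beta>) \<gamma> t))"
  proof (rule NA.tensor_eqI[OF additive_map_comp[OF coact_additive[OF \<beta>\<gamma>] tensor_map_additive[OF id\<Delta>]]
        additive_map_comp[OF additive_map_comp[OF coact_additive[OF \<gamma>] tensor_map_additive[OF \<rho>id]] X.tensor_assoc_additive] _ t])
    fix n a assume n: "n \<in> carrier N" and "a \<in> carrier A\<^sub>l"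
    then have a: "a \<in> carrier A" by simp
    have "comult C \<beta> \<gamma> (x (\<beta> \<otimes>\<^bsub>G\<^esub> \<gamma>) \<triangleleft>\<^bsub>cpart C (\<beta> \<otimes>\<^bsub>G\<^esub> \<gamma>)\<^esub> a)
      = tensor A (cpart C \<beta>) (cpart C \<gamma>) (x \<beta>) (x \<gamma> \<triangleleft>\<^bsub>cpart C \<gamma>\<^esub> a)"
      using right_linear_ract[OF \<Delta>(1) x_closed[OF \<beta>\<gamma>] a] a
      by (simp add: comult_x[OF \<beta> \<gamma>] X.NP.tensor_ract_pure[OF C\<gamma>.bimodule_axioms] x_closed \<beta> \<gamma>)
    then show "tensor_map A T (cpart C (\<beta> \<otimes>\<^bsub>G\<^esub> \<gamma>)) T (tensor_bimod A (cpart C \<beta>) (cpart C \<gamma>)) (\<lambda>d. d)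
      (comult C \<beta> \<gamma>) (\<rho> \<alpha> (\<beta> \<otimes>\<^bsub>G\<^esub> \<gamma>) (tensor B N A\<^sub>l n a)) =
    tensor_assoc A A T (cpart C \<beta>) (cpart C \<gamma>)
     (tensor_map A T (cpart C \<gamma>) (tensor_rmod A T (cpart C \<beta>)) (cpart C \<gamma>) (\<rho> \<alpha> \<beta>) (\<lambda>d. d)
       (\<rho> (\<alpha> \<otimes>\<^bsub>G\<^esub> \<beta>) \<gamma> (tensor B N A\<^sub>l n a)))"
      using n a
      by (simp add: coact_pure \<beta>\<gamma> \<gamma> \<beta> tensor_map_pure[OF id\<Delta>] tensor_map_pure[OF \<rho>id] NA.tensor_closed
          C\<beta>\<gamma>.ract_closed C\<gamma>.ract_closed C\<beta>.ract_one x_closed X.tensor_assoc_pure del: F7_simps)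
  qed
next
  fix \<alpha> t assume "t \<in> carrier T"
  then have t: "t \<in> carrier (tensor_group B N A\<^sub>l)" by simp
  have e: "\<one>\<^bsub>G\<^esub> \<in> carrier G" by simp
  interpret Ce: bimodule A A "cpart C \<one>\<^bsub>G\<^esub>" by (rule cpart_bimodule[OF e])
  have \<epsilon>: "right_linear A (cpart C \<one>\<^bsub>G\<^esub>) (regular_bimod A) (counit C)"
    "left_linear A (cpart C \<one>\<^bsub>G\<^esub>) (regular_bimod A) (counit C)"
    using counit_hom by (simp_all add: bimod_hom_iff)
  note id\<epsilon> = TC[OF e] tensor_product_bimod[OF T_module bimodule_regular[OF A.ring_axioms]] right_linear_id \<epsilon>(2)
  have "additive_map (tensor_group B N A\<^sub>l) T (\<lambda>t. t)" by (simp add: additive_map_def)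
  note id_additive = this
  show "tensor_unit_right A T (tensor_map A T (cpart C \<one>\<^bsub>G\<^esub>) T (regular_bimod A) (\<lambda>d. d) (counit C)
      (\<rho> \<alpha> \<one>\<^bsub>G\<^esub> t)) = t"
  proof (rule NA.tensor_eqI[OF additive_map_comp[OF additive_map_comp[OF coact_additive[OF e] tensor_map_additive[OF id\<epsilon>]]
          tensor_unit_right_additive[OF T_module]] id_additive _ t])
    fix n a assume n: "n \<in> carrier N" and "a \<in> carrier A\<^sub>l"
    then have a: "a \<in> carrier A" by simp
    have "counit C (x \<one>\<^bsub>G\<^esub> \<triangleleft>\<^bsub>cpart C \<one>\<^bsub>G\<^esub>\<^esub> a) = a"
      using right_linear_ract[OF \<epsilon>(1) x_closed[OF e] a] a by (simp add: counit_x)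
    then show "tensor_unit_right A T (tensor_map A T (cpart C \<one>\<^bsub>G\<^esub>) T (regular_bimod A) (\<lambda>d. d) (counit C)
      (\<rho> \<alpha> \<one>\<^bsub>G\<^esub> (tensor B N A\<^sub>l n a))) = tensor B N A\<^sub>l n a"
      using n a
      by (simp add: coact_pure tensor_map_pure[OF id\<epsilon>] tensor_unit_right_pure[OF T_module] NA.tensor_closed
          Ce.ract_closed x_closed NA.tensor_ract_pure[OF bimodule_A\<^sub>l] del: F7_simps)
  qed
qed

end

section \<open>Comodule morphisms and quotient comodules\<close>

lemma right_linear_inverse:
  assumes M: "right_module R M" and f: "right_linear R M N f"
    and k: "\<And>n. n \<in> carrier N \<Longrightarrow> k n \<in> carrier M" "\<And>n. n \<in> carrier N \<Longrightarrow> f (k n) = n"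
      "\<And>m. m \<in> carrier M \<Longrightarrow> k (f m) = m"
  shows "right_linear R N M k"
proof -
  interpret M: right_module R M by fact
  have "k (n \<oplus>\<^bsub>N\<^esub> n') = k n \<oplus>\<^bsub>M\<^esub> k n'" if "n \<in> carrier N" "n' \<in> carrier N" for n n'
    using k(3)[of "k n \<oplus>\<^bsub>M\<^esub> k n'"] that by (simp add: k right_linear_add[OF f])
  moreover have "k (n \<triangleleft>\<^bsub>N\<^esub> r) = k n \<triangleleft>\<^bsub>M\<^esub> r" if "n \<in> carrier N" "r \<in> carrier R" for n r
    using k(3)[of "k n \<triangleleft>\<^bsub>M\<^esub> r"] that by (simp add: k right_linear_ract[OF f] M.ract_closed)
  ultimately show ?thesis by (simp add: right_linear_def additive_map_def k)
qed

lemma right_linear_cong: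
  assumes M: "right_module R M" and f: "right_linear R M N f" and "\<And>m. m \<in> carrier M \<Longrightarrow> g m = f m"
  shows "right_linear R M N g"
proof -
  interpret M: right_module R M by fact
  show ?thesis
    using f by (simp add: right_linear_def additive_map_def assms(3) M.ract_closed)
qed

lemma comod_homD:
  assumes "f \<in> comod_hom G A C M N" and "\<alpha> \<in> carrier G"
  shows comod_hom_right_linear: "right_linear A (mpart M \<alpha>) (mpart N \<alpha>) (f \<alpha>)"
    and comod_hom_closed: "m \<in> carrier (mpart M \<alpha>) \<Longrightarrow> f \<alpha> m \<in> carrier (mpart N \<alpha>)"
    and comod_hom_coact: "\<beta> \<in> carrier G \<Longrightarrow> m \<in> carrier (mpart M (\<alpha> \<otimes>\<^bsub>G\<^esub> \<beta>)) \<Longrightarrow>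
      tensor_map A (mpart M \<alpha>) (cpart C \<beta>) (mpart N \<alpha>) (cpart C \<beta>) (f \<alpha>) (\<lambda>d. d) (coact M \<alpha> \<beta> m)
        = coact N \<alpha> \<beta> (f (\<alpha> \<otimes>\<^bsub>G\<^esub> \<beta>) m)"
  using assms by (auto simp: comod_hom_def PiE_def Pi_def rmod_hom_iff dest: right_linear_closed)

lemma comod_hom_eqI:
  assumes f: "f \<in> comod_hom G A C M N" and g: "g \<in> comod_hom G A C M N"
    and eq: "\<And>\<alpha> m. \<alpha> \<in> carrier G \<Longrightarrow> m \<in> carrier (mpart M \<alpha>) \<Longrightarrow> f \<alpha> m = g \<alpha> m"
  shows "f = g"
proof (rule PiE_ext)
  show "f \<in> (\<Pi>\<^sub>E \<alpha>\<in>carrier G. rmod_hom A (mpart M \<alpha>) (mpart N \<alpha>))"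
    and g': "g \<in> (\<Pi>\<^sub>E \<alpha>\<in>carrier G. rmod_hom A (mpart M \<alpha>) (mpart N \<alpha>))"
    using f g by (simp_all add: comod_hom_def)
  fix \<alpha> assume \<alpha>: "\<alpha> \<in> carrier G"
  have "f \<alpha> \<in> extensional (carrier (mpart M \<alpha>))" "g \<alpha> \<in> extensional (carrier (mpart M \<alpha>))"
    using f g \<alpha> by (auto simp: comod_hom_def PiE_def Pi_def rmod_hom_iff)
  then show "f \<alpha> = g \<alpha>" by (rule extensionalityI) (rule eq[OF \<alpha>])
qed

context group_comodule
begin

lemma M_tensor_C: "\<alpha> \<in> carrier G \<Longrightarrow> \<beta> \<in> carrier G \<Longrightarrow> tensor_product A (mpart M \<alpha>) (cpart C \<beta>)"
  by (rule tensor_product_bimod[OF mpart_module cpart_bimodule])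

lemma coact_right_linear:
  "\<alpha> \<in> carrier G \<Longrightarrow> \<beta> \<in> carrier G \<Longrightarrow>
    right_linear A (mpart M (\<alpha> \<otimes>\<^bsub>G\<^esub> \<beta>)) (tensor_rmod A (mpart M \<alpha>) (cpart C \<beta>)) (coact M \<alpha> \<beta>)"
  using coact_hom[of \<alpha> \<beta>] by (simp add: rmod_hom_iff)

lemma coact_closed:
  "\<alpha> \<in> carrier G \<Longrightarrow> \<beta> \<in> carrier G \<Longrightarrow> m \<in> carrier (mpart M (\<alpha> \<otimes>\<^bsub>G\<^esub> \<beta>)) \<Longrightarrow>
    coact M \<alpha> \<beta> m \<in> carrier (tensor_group A (mpart M \<alpha>) (cpart C \<beta>))"
  using right_linear_closed[OF coact_right_linear] by simp

end

context group_coring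
begin

lemma comod_homI:
  assumes M: "group_comodule G A C M" and N: "group_comodule G A C N"
    and lin: "\<And>\<alpha>. \<alpha> \<in> carrier G \<Longrightarrow> right_linear A (mpart M \<alpha>) (mpart N \<alpha>) (f \<alpha>)"
    and coact: "\<And>\<alpha> \<beta> m. \<alpha> \<in> carrier G \<Longrightarrow> \<beta> \<in> carrier G \<Longrightarrow> m \<in> carrier (mpart M (\<alpha> \<otimes>\<^bsub>G\<^esub> \<beta>)) \<Longrightarrow>
      tensor_map A (mpart M \<alpha>) (cpart C \<beta>) (mpart N \<alpha>) (cpart C \<beta>) (f \<alpha>) (\<lambda>d. d) (coact M \<alpha> \<beta> m)
        = coact N \<alpha> \<beta> (f (\<alpha> \<otimes>\<^bsub>G\<^esub> \<beta>) m)"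
  shows "(\<lambda>\<alpha>\<in>carrier G. restrict (f \<alpha>) (carrier (mpart M \<alpha>))) \<in> comod_hom G A C M N"
proof -
  interpret M: group_comodule G A C M by fact
  interpret N: group_comodule G A C N by fact
  have lin': "right_linear A (mpart M \<alpha>) (mpart N \<alpha>) (restrict (f \<alpha>) (carrier (mpart M \<alpha>)))"
    if "\<alpha> \<in> carrier G" for \<alpha>
    by (rule right_linear_cong[OF M.mpart_module lin]) (simp_all add: that)
  have "tensor_map A (mpart M \<alpha>) (cpart C \<beta>) (mpart N \<alpha>) (cpart C \<beta>) (restrict (f \<alpha>) (carrier (mpart M \<alpha>)))
      (\<lambda>d. d) (coact M \<alpha> \<beta> m) = coact N \<alpha> \<beta> (f (\<alpha> \<otimes>\<^bsub>G\<^esub> \<beta>) m)"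
    if "\<alpha> \<in> carrier G" "\<beta> \<in> carrier G" "m \<in> carrier (mpart M (\<alpha> \<otimes>\<^bsub>G\<^esub> \<beta>))" for \<alpha> \<beta> m
    using that
    by (subst tensor_map_cong[OF M.M_tensor_C N.M_tensor_C lin' left_linear_id lin left_linear_id _ _ M.coact_closed])
       (simp_all add: coact)
  then show ?thesis
    by (auto simp: comod_hom_def rmod_hom_iff lin')
qed

lemma comod_hom_comp:
  assumes M: "group_comodule G A C M" and N: "group_comodule G A C N" and P: "group_comodule G A C P"
    and f: "f \<in> comod_hom G A C M N" and g: "g \<in> comod_hom G A C N P"
  obtains h where "h \<in> comod_hom G A C M P"
    and "\<And>\<alpha> m. \<alpha> \<in> carrier G \<Longrightarrow> m \<in> carrier (mpart M \<alpha>) \<Longrightarrow> h \<alpha> m = g \<alpha> (f \<alpha> m)"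
proof
  interpret M: group_comodule G A C M by fact
  interpret N: group_comodule G A C N by fact
  interpret P: group_comodule G A C P by fact
  let ?h = "\<lambda>\<alpha>\<in>carrier G. \<lambda>m\<in>carrier (mpart M \<alpha>). g \<alpha> (f \<alpha> m)"
  have lin: "right_linear A (mpart M \<alpha>) (mpart P \<alpha>) (\<lambda>m. g \<alpha> (f \<alpha> m))" if "\<alpha> \<in> carrier G" for \<alpha>
    by (rule right_linear_comp[OF comod_hom_right_linear[OF f that] comod_hom_right_linear[OF g that]])
  show "?h \<in> comod_hom G A C M P"
  proof (rule comod_homI[OF M P lin])
    fix \<alpha> \<beta> m assume *: "\<alpha> \<in> carrier G" "\<beta> \<in> carrier G" "m \<in> carrier (mpart M (\<alpha> \<otimes>\<^bsub>G\<^esub> \<beta>))"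
    have "coact P \<alpha> \<beta> (g (\<alpha> \<otimes>\<^bsub>G\<^esub> \<beta>) (f (\<alpha> \<otimes>\<^bsub>G\<^esub> \<beta>) m))
      = tensor_map A (mpart N \<alpha>) (cpart C \<beta>) (mpart P \<alpha>) (cpart C \<beta>) (g \<alpha>) (\<lambda>d. d)
          (tensor_map A (mpart M \<alpha>) (cpart C \<beta>) (mpart N \<alpha>) (cpart C \<beta>) (f \<alpha>) (\<lambda>d. d) (coact M \<alpha> \<beta> m))"
      using * by (simp add: comod_hom_coact[OF f] comod_hom_coact[OF g] comod_hom_closed[OF f])
    also have "\<dots> = tensor_map A (mpart M \<alpha>) (cpart C \<beta>) (mpart P \<alpha>) (cpart C \<beta>) (\<lambda>m. g \<alpha> (f \<alpha> m)) (\<lambda>d. d)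
        (coact M \<alpha> \<beta> m)"
      using *
      by (intro tensor_map_comp[OF M.M_tensor_C N.M_tensor_C comod_hom_right_linear[OF f] left_linear_id
            P.M_tensor_C comod_hom_right_linear[OF g] left_linear_id lin left_linear_id _ _ M.coact_closed]) simp_all
    finally show "tensor_map A (mpart M \<alpha>) (cpart C \<beta>) (mpart P \<alpha>) (cpart C \<beta>) (\<lambda>m. g \<alpha> (f \<alpha> m)) (\<lambda>d. d)
        (coact M \<alpha> \<beta> m) = coact P \<alpha> \<beta> (g (\<alpha> \<otimes>\<^bsub>G\<^esub> \<beta>) (f (\<alpha> \<otimes>\<^bsub>G\<^esub> \<beta>) m))" ..
  qed
qed simp

lemma comod_hom_inverse:
  assumes M: "group_comodule G A C M" and N: "group_comodule G A C N"
    and f: "f \<in> comod_hom G A C M N"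
    and k: "\<And>\<alpha> n. \<alpha> \<in> carrier G \<Longrightarrow> n \<in> carrier (mpart N \<alpha>) \<Longrightarrow> k \<alpha> n \<in> carrier (mpart M \<alpha>)"
      "\<And>\<alpha> n. \<alpha> \<in> carrier G \<Longrightarrow> n \<in> carrier (mpart N \<alpha>) \<Longrightarrow> f \<alpha> (k \<alpha> n) = n"
      "\<And>\<alpha> m. \<alpha> \<in> carrier G \<Longrightarrow> m \<in> carrier (mpart M \<alpha>) \<Longrightarrow> k \<alpha> (f \<alpha> m) = m"
  shows "(\<lambda>\<alpha>\<in>carrier G. restrict (k \<alpha>) (carrier (mpart N \<alpha>))) \<in> comod_hom G A C N M"
proof -
  interpret M: group_comodule G A C M by fact
  interpret N: group_comodule G A C N by fact
  have lin: "right_linear A (mpart N \<alpha>) (mpart M \<alpha>) (k \<alpha>)" if "\<alpha> \<in> carrier G" for \<alpha>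
    by (rule right_linear_inverse[OF M.mpart_module comod_hom_right_linear[OF f]]) (simp_all add: that k)
  show ?thesis
  proof (rule comod_homI[OF N M lin])
    fix \<alpha> \<beta> n assume *: "\<alpha> \<in> carrier G" "\<beta> \<in> carrier G" "n \<in> carrier (mpart N (\<alpha> \<otimes>\<^bsub>G\<^esub> \<beta>))"
    define m where "m = k (\<alpha> \<otimes>\<^bsub>G\<^esub> \<beta>) n"
    have m: "m \<in> carrier (mpart M (\<alpha> \<otimes>\<^bsub>G\<^esub> \<beta>))" "n = f (\<alpha> \<otimes>\<^bsub>G\<^esub> \<beta>) m"
      using * by (simp_all add: m_def k)
    have "tensor_map A (mpart N \<alpha>) (cpart C \<beta>) (mpart M \<alpha>) (cpart C \<beta>) (k \<alpha>) (\<lambda>d. d) (coact N \<alpha> \<beta> n)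
      = tensor_map A (mpart N \<alpha>) (cpart C \<beta>) (mpart M \<alpha>) (cpart C \<beta>) (k \<alpha>) (\<lambda>d. d)
          (tensor_map A (mpart M \<alpha>) (cpart C \<beta>) (mpart N \<alpha>) (cpart C \<beta>) (f \<alpha>) (\<lambda>d. d) (coact M \<alpha> \<beta> m))"
      using * m by (simp add: comod_hom_coact[OF f])
    also have "\<dots> = tensor_map A (mpart M \<alpha>) (cpart C \<beta>) (mpart M \<alpha>) (cpart C \<beta>) (\<lambda>m. m) (\<lambda>d. d) (coact M \<alpha> \<beta> m)"
      using * m(1)
      by (intro tensor_map_comp[OF M.M_tensor_C N.M_tensor_C comod_hom_right_linear[OF f] left_linear_id
            M.M_tensor_C lin left_linear_id right_linear_id left_linear_id _ _ M.coact_closed]) (simp_all add: k)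
    also have "\<dots> = coact M \<alpha> \<beta> m"
      by (rule tensor_map_ident[OF M.M_tensor_C M.coact_closed]) (simp_all add: * m(1))
    finally show "tensor_map A (mpart N \<alpha>) (cpart C \<beta>) (mpart M \<alpha>) (cpart C \<beta>) (k \<alpha>) (\<lambda>d. d) (coact N \<alpha> \<beta> n)
      = coact M \<alpha> \<beta> (k (\<alpha> \<otimes>\<^bsub>G\<^esub> \<beta>) n)" unfolding m_def .
  qed
qed

text \<open>The comodule axioms pass to any quotient: both sides of either axiom for \<open>N\<close>, evaluated at \<open>f m\<close>, are the
  images of the corresponding sides for \<open>M\<close>.\<close>

lemma quotient_comodule:
  fixes M :: "('g, 'a, 'm, 'c) comod" and N :: "('g, 'a, 'n, 'c) comod"
  assumes M: "group_comodule G A C M"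
    and N: "\<And>\<alpha>. \<alpha> \<in> carrier G \<Longrightarrow> right_module A (mpart N \<alpha>)"
      "\<And>\<alpha> \<beta>. \<alpha> \<in> carrier G \<Longrightarrow> \<beta> \<in> carrier G \<Longrightarrow>
        coact N \<alpha> \<beta> \<in> rmod_hom A (mpart N (\<alpha> \<otimes>\<^bsub>G\<^esub> \<beta>)) (tensor_rmod A (mpart N \<alpha>) (cpart C \<beta>))"
    and f: "\<And>\<alpha>. \<alpha> \<in> carrier G \<Longrightarrow> right_linear A (mpart M \<alpha>) (mpart N \<alpha>) (f \<alpha>)"
      "\<And>\<alpha> \<beta> m. \<alpha> \<in> carrier G \<Longrightarrow> \<beta> \<in> carrier G \<Longrightarrow> m \<in> carrier (mpart M (\<alpha> \<otimes>\<^bsub>G\<^esub> \<beta>)) \<Longrightarrow>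
      coact N \<alpha> \<beta> (f (\<alpha> \<otimes>\<^bsub>G\<^esub> \<beta>) m) =
      tensor_map A (mpart M \<alpha>) (cpart C \<beta>) (mpart N \<alpha>) (cpart C \<beta>) (f \<alpha>) (\<lambda>d. d) (coact M \<alpha> \<beta> m)"
    and surj: "\<And>\<alpha>. \<alpha> \<in> carrier G \<Longrightarrow> carrier (mpart N \<alpha>) \<subseteq> f \<alpha> ` carrier (mpart M \<alpha>)"
  shows "group_comodule G A C N"
proof -
  interpret M: group_comodule G A C M by fact
  note fl = f(1) and fcoact = f(2)
  have NC: "tensor_product A (mpart N \<alpha>) (cpart C \<beta>)" if "\<alpha> \<in> carrier G" "\<beta> \<in> carrier G" for \<alpha> \<beta>
    by (rule tensor_product_bimod[OF N(1)[OF that(1)] cpart_bimodule[OF that(2)]])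
  have \<rho>N: "right_linear A (mpart N (\<alpha> \<otimes>\<^bsub>G\<^esub> \<beta>)) (tensor_rmod A (mpart N \<alpha>) (cpart C \<beta>)) (coact N \<alpha> \<beta>)"
    if "\<alpha> \<in> carrier G" "\<beta> \<in> carrier G" for \<alpha> \<beta>
    using N(2)[OF that] by (simp add: rmod_hom_iff)
  show ?thesis
  proof (intro group_comodule.intro group_comodule_axioms.intro group_coring_axioms N)
    fix \<alpha> \<beta> \<gamma> n assume \<alpha>: "\<alpha> \<in> carrier G" and \<beta>: "\<beta> \<in> carrier G" and \<gamma>: "\<gamma> \<in> carrier G"
      and n: "n \<in> carrier (mpart N (\<alpha> \<otimes>\<^bsub>G\<^esub> \<beta> \<otimes>\<^bsub>G\<^esub> \<gamma>))"
    have \<alpha>\<beta>: "\<alpha> \<otimes>\<^bsub>G\<^esub> \<beta> \<in> carrier G" and \<beta>\<gamma>: "\<beta> \<otimes>\<^bsub>G\<^esub> \<gamma> \<in> carrier G"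
      and \<alpha>\<beta>\<gamma>: "\<alpha> \<otimes>\<^bsub>G\<^esub> \<beta> \<otimes>\<^bsub>G\<^esub> \<gamma> \<in> carrier G" and assoc: "\<alpha> \<otimes>\<^bsub>G\<^esub> \<beta> \<otimes>\<^bsub>G\<^esub> \<gamma> = \<alpha> \<otimes>\<^bsub>G\<^esub> (\<beta> \<otimes>\<^bsub>G\<^esub> \<gamma>)"
      using \<alpha> \<beta> \<gamma> by (simp_all add: G.m_assoc)
    obtain m where m: "m \<in> carrier (mpart M (\<alpha> \<otimes>\<^bsub>G\<^esub> \<beta> \<otimes>\<^bsub>G\<^esub> \<gamma>))" and nm: "n = f (\<alpha> \<otimes>\<^bsub>G\<^esub> \<beta> \<otimes>\<^bsub>G\<^esub> \<gamma>) m"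
      using surj[OF \<alpha>\<beta>\<gamma>] n by blast
    have m': "m \<in> carrier (mpart M (\<alpha> \<otimes>\<^bsub>G\<^esub> (\<beta> \<otimes>\<^bsub>G\<^esub> \<gamma>)))" using m assoc by simp
    let ?M = "mpart M \<alpha>" and ?N = "mpart N \<alpha>" and ?C = "cpart C"
    interpret X: triple_tensor_product A A ?M "?C \<beta>" "?C \<gamma>"
      by (intro triple_tensor_product.intro M.mpart_module cpart_bimodule bimodule_left[OF cpart_bimodule[OF \<gamma>]] \<alpha> \<beta>)
    interpret Y: triple_tensor_product A A ?N "?C \<beta>" "?C \<gamma>"
      by (intro triple_tensor_product.intro N(1) cpart_bimodule bimodule_left[OF cpart_bimodule[OF \<gamma>]] \<alpha> \<beta>)
    have \<Delta>: "left_linear A (?C (\<beta> \<otimes>\<^bsub>G\<^esub> \<gamma>)) (tensor_bimod A (?C \<beta>) (?C \<gamma>)) (comult C \<beta> \<gamma>)"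
      using comult_hom[OF \<beta> \<gamma>] by (simp add: bimod_hom_iff)
    let ?fC = "tensor_map A ?M (?C \<beta>) ?N (?C \<beta>) (f \<alpha>) (\<lambda>d. d)"
    have fC: "right_linear A (tensor_rmod A ?M (?C \<beta>)) (tensor_rmod A ?N (?C \<beta>)) ?fC"
      by (rule tensor_map_right_linear[OF M.M_tensor_C[OF \<alpha> \<beta>] NC[OF \<alpha> \<beta>] fl[OF \<alpha>] left_linear_id
            cpart_bimodule[OF \<beta>] cpart_bimodule[OF \<beta>] right_linear_id])
    note \<rho>Mm = M.coact_closed[OF \<alpha>\<beta> \<gamma> m] and \<rho>Mm' = M.coact_closed[OF \<alpha> \<beta>\<gamma> m']
    have "tensor_map A ?N (?C (\<beta> \<otimes>\<^bsub>G\<^esub> \<gamma>)) ?N (tensor_bimod A (?C \<beta>) (?C \<gamma>)) (\<lambda>d. d) (comult C \<beta> \<gamma>)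
        (coact N \<alpha> (\<beta> \<otimes>\<^bsub>G\<^esub> \<gamma>) n)
      = tensor_map A ?N (?C (\<beta> \<otimes>\<^bsub>G\<^esub> \<gamma>)) ?N (tensor_bimod A (?C \<beta>) (?C \<gamma>)) (\<lambda>d. d) (comult C \<beta> \<gamma>)
        (tensor_map A ?M (?C (\<beta> \<otimes>\<^bsub>G\<^esub> \<gamma>)) ?N (?C (\<beta> \<otimes>\<^bsub>G\<^esub> \<gamma>)) (f \<alpha>) (\<lambda>d. d) (coact M \<alpha> (\<beta> \<otimes>\<^bsub>G\<^esub> \<gamma>) m))"
      by (simp add: nm assoc fcoact[OF \<alpha> \<beta>\<gamma> m'])
    also have "\<dots> = tensor_map A ?M (?C (\<beta> \<otimes>\<^bsub>G\<^esub> \<gamma>)) ?N (tensor_bimod A (?C \<beta>) (?C \<gamma>)) (f \<alpha>) (comult C \<beta> \<gamma>)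
        (coact M \<alpha> (\<beta> \<otimes>\<^bsub>G\<^esub> \<gamma>) m)"
      by (rule tensor_map_comp[OF M.M_tensor_C[OF \<alpha> \<beta>\<gamma>] NC[OF \<alpha> \<beta>\<gamma>] fl[OF \<alpha>] left_linear_id
            Y.M_NP.tensor_product_axioms right_linear_id \<Delta> fl[OF \<alpha>] \<Delta> _ _ \<rho>Mm']) simp_all
    also have "\<dots> = tensor_map A ?M (tensor_bimod A (?C \<beta>) (?C \<gamma>)) ?N (tensor_bimod A (?C \<beta>) (?C \<gamma>)) (f \<alpha>) (\<lambda>d. d)
        (tensor_map A ?M (?C (\<beta> \<otimes>\<^bsub>G\<^esub> \<gamma>)) ?M (tensor_bimod A (?C \<beta>) (?C \<gamma>)) (\<lambda>d. d) (comult C \<beta> \<gamma>)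
          (coact M \<alpha> (\<beta> \<otimes>\<^bsub>G\<^esub> \<gamma>) m))"
      by (rule tensor_map_comp[OF M.M_tensor_C[OF \<alpha> \<beta>\<gamma>] X.M_NP.tensor_product_axioms right_linear_id \<Delta>
            Y.M_NP.tensor_product_axioms fl[OF \<alpha>] left_linear_id fl[OF \<alpha>] \<Delta> _ _ \<rho>Mm', symmetric]) simp_all
    also have "\<dots> = tensor_map A ?M (tensor_bimod A (?C \<beta>) (?C \<gamma>)) ?N (tensor_bimod A (?C \<beta>) (?C \<gamma>)) (f \<alpha>) (\<lambda>d. d)
        (tensor_assoc A A ?M (?C \<beta>) (?C \<gamma>)
          (tensor_map A (mpart M (\<alpha> \<otimes>\<^bsub>G\<^esub> \<beta>)) (?C \<gamma>) (tensor_rmod A ?M (?C \<beta>)) (?C \<gamma>) (coact M \<alpha> \<beta>) (\<lambda>d. d)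
            (coact M (\<alpha> \<otimes>\<^bsub>G\<^esub> \<beta>) \<gamma> m)))"
      by (simp only: M.coact_coassoc[OF \<alpha> \<beta> \<gamma> m])
    also have "\<dots> = tensor_assoc A A ?N (?C \<beta>) (?C \<gamma>)
        (tensor_map A (tensor_rmod A ?M (?C \<beta>)) (?C \<gamma>) (tensor_rmod A ?N (?C \<beta>)) (?C \<gamma>) ?fC (\<lambda>d. d)
          (tensor_map A (mpart M (\<alpha> \<otimes>\<^bsub>G\<^esub> \<beta>)) (?C \<gamma>) (tensor_rmod A ?M (?C \<beta>)) (?C \<gamma>) (coact M \<alpha> \<beta>) (\<lambda>d. d)
            (coact M (\<alpha> \<otimes>\<^bsub>G\<^esub> \<beta>) \<gamma> m)))"
      by (rule tensor_assoc_natural[symmetric, OF M.mpart_module[OF \<alpha>] N(1)[OF \<alpha>] fl[OF \<alpha>] cpart_bimodule[OF \<beta>]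
            bimodule_left[OF cpart_bimodule[OF \<gamma>]]
            tensor_map_closed[OF M.M_tensor_C[OF \<alpha>\<beta> \<gamma>] X.MN_P.tensor_product_axioms
              M.coact_right_linear[OF \<alpha> \<beta>] left_linear_id \<rho>Mm]])
    also have "tensor_map A (tensor_rmod A ?M (?C \<beta>)) (?C \<gamma>) (tensor_rmod A ?N (?C \<beta>)) (?C \<gamma>) ?fC (\<lambda>d. d)
          (tensor_map A (mpart M (\<alpha> \<otimes>\<^bsub>G\<^esub> \<beta>)) (?C \<gamma>) (tensor_rmod A ?M (?C \<beta>)) (?C \<gamma>) (coact M \<alpha> \<beta>) (\<lambda>d. d)
            (coact M (\<alpha> \<otimes>\<^bsub>G\<^esub> \<beta>) \<gamma> m))
      = tensor_map A (mpart M (\<alpha> \<otimes>\<^bsub>G\<^esub> \<beta>)) (?C \<gamma>) (tensor_rmod A ?N (?C \<beta>)) (?C \<gamma>)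
          (\<lambda>m. ?fC (coact M \<alpha> \<beta> m)) (\<lambda>d. d) (coact M (\<alpha> \<otimes>\<^bsub>G\<^esub> \<beta>) \<gamma> m)"
      by (rule tensor_map_comp[OF M.M_tensor_C[OF \<alpha>\<beta> \<gamma>] X.MN_P.tensor_product_axioms
            M.coact_right_linear[OF \<alpha> \<beta>] left_linear_id Y.MN_P.tensor_product_axioms fC left_linear_id
            right_linear_comp[OF M.coact_right_linear[OF \<alpha> \<beta>] fC] left_linear_id _ _ \<rho>Mm]) simp_all
    also have "\<dots> = tensor_map A (mpart N (\<alpha> \<otimes>\<^bsub>G\<^esub> \<beta>)) (?C \<gamma>) (tensor_rmod A ?N (?C \<beta>)) (?C \<gamma>) (coact N \<alpha> \<beta>) (\<lambda>d. d)
        (tensor_map A (mpart M (\<alpha> \<otimes>\<^bsub>G\<^esub> \<beta>)) (?C \<gamma>) (mpart N (\<alpha> \<otimes>\<^bsub>G\<^esub> \<beta>)) (?C \<gamma>) (f (\<alpha> \<otimes>\<^bsub>G\<^esub> \<beta>)) (\<lambda>d. d)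
          (coact M (\<alpha> \<otimes>\<^bsub>G\<^esub> \<beta>) \<gamma> m))"
      by (rule tensor_map_comp[OF M.M_tensor_C[OF \<alpha>\<beta> \<gamma>] NC[OF \<alpha>\<beta> \<gamma>] fl[OF \<alpha>\<beta>] left_linear_id
            Y.MN_P.tensor_product_axioms \<rho>N[OF \<alpha> \<beta>] left_linear_id
            right_linear_comp[OF M.coact_right_linear[OF \<alpha> \<beta>] fC] left_linear_id _ _ \<rho>Mm, symmetric])
         (simp_all add: fcoact[OF \<alpha> \<beta>])
    also have "tensor_map A (mpart M (\<alpha> \<otimes>\<^bsub>G\<^esub> \<beta>)) (?C \<gamma>) (mpart N (\<alpha> \<otimes>\<^bsub>G\<^esub> \<beta>)) (?C \<gamma>) (f (\<alpha> \<otimes>\<^bsub>G\<^esub> \<beta>)) (\<lambda>d. d)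
          (coact M (\<alpha> \<otimes>\<^bsub>G\<^esub> \<beta>) \<gamma> m) = coact N (\<alpha> \<otimes>\<^bsub>G\<^esub> \<beta>) \<gamma> n"
      by (simp add: nm fcoact[OF \<alpha>\<beta> \<gamma> m])
    finally show "tensor_map A ?N (?C (\<beta> \<otimes>\<^bsub>G\<^esub> \<gamma>)) ?N (tensor_bimod A (?C \<beta>) (?C \<gamma>)) (\<lambda>d. d) (comult C \<beta> \<gamma>)
        (coact N \<alpha> (\<beta> \<otimes>\<^bsub>G\<^esub> \<gamma>) n)
      = tensor_assoc A A ?N (?C \<beta>) (?C \<gamma>)
          (tensor_map A (mpart N (\<alpha> \<otimes>\<^bsub>G\<^esub> \<beta>)) (?C \<gamma>) (tensor_rmod A ?N (?C \<beta>)) (?C \<gamma>) (coact N \<alpha> \<beta>) (\<lambda>d. d)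
            (coact N (\<alpha> \<otimes>\<^bsub>G\<^esub> \<beta>) \<gamma> n))" .
  next
    fix \<alpha> n assume \<alpha>: "\<alpha> \<in> carrier G" and n: "n \<in> carrier (mpart N \<alpha>)"
    obtain m where m: "m \<in> carrier (mpart M \<alpha>)" and nm: "n = f \<alpha> m"
      using surj[OF \<alpha>] n by blast
    let ?M = "mpart M \<alpha>" and ?N = "mpart N \<alpha>" and ?E = "cpart C \<one>\<^bsub>G\<^esub>" and ?A = "regular_bimod A"
    have e: "\<one>\<^bsub>G\<^esub> \<in> carrier G" by simp
    have m': "m \<in> carrier (mpart M (\<alpha> \<otimes>\<^bsub>G\<^esub> \<one>\<^bsub>G\<^esub>))" using m \<alpha> by simp
    note \<rho>Mm = M.coact_closed[OF \<alpha> e m']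
    have \<epsilon>: "left_linear A ?E ?A (counit C)"
      using counit_hom by (simp add: bimod_hom_iff)
    note MA = tensor_product_bimod[OF M.mpart_module[OF \<alpha>] bimodule_regular[OF A.ring_axioms]]
      and NA = tensor_product_bimod[OF N(1)[OF \<alpha>] bimodule_regular[OF A.ring_axioms]]
    have "tensor_map A ?N ?E ?N ?A (\<lambda>d. d) (counit C) (coact N \<alpha> \<one>\<^bsub>G\<^esub> n)
      = tensor_map A ?N ?E ?N ?A (\<lambda>d. d) (counit C)
          (tensor_map A ?M ?E ?N ?E (f \<alpha>) (\<lambda>d. d) (coact M \<alpha> \<one>\<^bsub>G\<^esub> m))"
      using fcoact[OF \<alpha> e m'] \<alpha> by (simp add: nm)
    also have "\<dots> = tensor_map A ?M ?E ?N ?A (f \<alpha>) (counit C) (coact M \<alpha> \<one>\<^bsub>G\<^esub> m)"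
      by (rule tensor_map_comp[OF M.M_tensor_C[OF \<alpha> e] NC[OF \<alpha> e] fl[OF \<alpha>] left_linear_id
            NA right_linear_id \<epsilon> fl[OF \<alpha>] \<epsilon> _ _ \<rho>Mm]) simp_all
    also have "\<dots> = tensor_map A ?M ?A ?N ?A (f \<alpha>) (\<lambda>d. d)
        (tensor_map A ?M ?E ?M ?A (\<lambda>d. d) (counit C) (coact M \<alpha> \<one>\<^bsub>G\<^esub> m))"
      by (rule tensor_map_comp[OF M.M_tensor_C[OF \<alpha> e] MA right_linear_id \<epsilon>
            NA fl[OF \<alpha>] left_linear_id fl[OF \<alpha>] \<epsilon> _ _ \<rho>Mm, symmetric]) simp_all
    finally show "tensor_unit_right A ?N (tensor_map A ?N ?E ?N ?A (\<lambda>d. d) (counit C) (coact N \<alpha> \<one>\<^bsub>G\<^esub> n)) = n"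
      using tensor_unit_right_natural[OF M.mpart_module[OF \<alpha>] N(1)[OF \<alpha>] fl[OF \<alpha>]
          tensor_map_closed[OF M.M_tensor_C[OF \<alpha> e] MA right_linear_id \<epsilon> \<rho>Mm]] M.coact_counit[OF \<alpha> m]
      by (simp add: nm)
  qed
qed

end

section \<open>Copies inside a universe\<close>

text \<open>The hypotheses of full faithfulness only speak about modules and comodules on subsets of a fixed type. The module structure of
  \<open>M\<close> is transported to such a subset along an injection \<open>j\<close>.\<close>

definition transport_rmod :: "('m \<Rightarrow> 'n) \<Rightarrow> ('r, 'm, 'x) rmod_scheme \<Rightarrow> ('r, 'n) rmod"
  where "transport_rmod j M =
    (let k = inv_into (carrier M) j
     in \<lparr>carrier = j ` carrier M, monoid.mult = undefined, one = undefined, ring.zero = j \<zero>\<^bsub>M\<^esub>,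
         ring.add = (\<lambda>u v. j (k u \<oplus>\<^bsub>M\<^esub> k v)), ract = (\<lambda>u r. j (k u \<triangleleft>\<^bsub>M\<^esub> r))\<rparr>)"

lemma transport_rmod_linear:
  assumes M: "right_module R M" and j: "inj_on j (carrier M)"
  shows "right_linear R M (transport_rmod j M) j"
  using j by (simp add: transport_rmod_def Let_def right_linear_def additive_map_def)

lemma transport_rmod_module:
  assumes M: "right_module R M" and j: "inj_on j (carrier M)"
  shows "right_module R (transport_rmod j M)"
proof -
  interpret M: right_module R M by fact
  let ?N = "transport_rmod j M" and ?k = "inv_into (carrier M) j"
  have [simp]: "carrier ?N = j ` carrier M" "u \<oplus>\<^bsub>?N\<^esub> v = j (?k u \<oplus>\<^bsub>M\<^esub> ?k v)" "\<zero>\<^bsub>?N\<^esub> = j \<zero>\<^bsub>M\<^esub>"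
    "u \<triangleleft>\<^bsub>?N\<^esub> r = j (?k u \<triangleleft>\<^bsub>M\<^esub> r)" for u v r
    by (simp_all add: transport_rmod_def Let_def)
  have [simp]: "?k (j m) = m" if "m \<in> carrier M" for m
    using j that by simp
  have neg: "\<exists>y\<in>carrier M. j (y \<oplus>\<^bsub>M\<^esub> m) = j \<zero>\<^bsub>M\<^esub>" if "m \<in> carrier M" for m
    using M.M.l_neg[OF that] that by (intro bexI[of _ "\<ominus>\<^bsub>M\<^esub> m"]) simp_all
  have "abelian_group ?N"
    using neg by (intro abelian_groupI) (auto simp: M.M.a_ac)
  then show ?thesis
    by (intro right_module.intro right_module_axioms.intro M.R.ring_axioms)
       (auto simp: M.ract_closed M.ract_add_left M.ract_add_right M.ract_mult M.ract_one)
qed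

context group_coring
begin

text \<open>The coaction is transported together with the modules; the comodule axioms then hold because the copy is in particular a
  quotient.\<close>

lemma comodule_copy:
  fixes M :: "('g, 'a, 'm, 'c) comod"
  assumes M: "group_comodule G A C M"
    and small: "\<And>\<alpha>. \<alpha> \<in> carrier G \<Longrightarrow> carrier (mpart M \<alpha>) \<lesssim> (UNIV :: 'u set)"
  obtains M' :: "('g, 'a, 'u, 'c) comod" and j k
  where "group_comodule G A C M'" "j \<in> comod_hom G A C M M'" "k \<in> comod_hom G A C M' M"
    and "\<And>\<alpha> m. \<alpha> \<in> carrier G \<Longrightarrow> m \<in> carrier (mpart M \<alpha>) \<Longrightarrow> k \<alpha> (j \<alpha> m) = m"
proof -
  interpret M: group_comodule G A C M by fact
  have "\<exists>j::'g \<Rightarrow> 'm \<Rightarrow> 'u. \<forall>\<alpha>\<in>carrier G. inj_on (j \<alpha>) (carrier (mpart M \<alpha>))"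
    using small unfolding lepoll_def by (intro bchoice) blast
  then obtain j :: "'g \<Rightarrow> 'm \<Rightarrow> 'u" where j: "\<And>\<alpha>. \<alpha> \<in> carrier G \<Longrightarrow> inj_on (j \<alpha>) (carrier (mpart M \<alpha>))"
    by blast
  define k where "k = (\<lambda>\<alpha>. inv_into (carrier (mpart M \<alpha>)) (j \<alpha>))"
  let ?P = "\<lambda>\<alpha>. transport_rmod (j \<alpha>) (mpart M \<alpha>)"
  let ?jC = "\<lambda>\<alpha> \<beta>. tensor_map A (mpart M \<alpha>) (cpart C \<beta>) (?P \<alpha>) (cpart C \<beta>) (j \<alpha>) (\<lambda>d. d)"
  define M' :: "('g, 'a, 'u, 'c) comod" where
    "M' = \<lparr>mpart = ?P, coact = (\<lambda>\<alpha> \<beta>. \<lambda>u\<in>carrier (?P (\<alpha> \<otimes>\<^bsub>G\<^esub> \<beta>)). ?jC \<alpha> \<beta> (coact M \<alpha> \<beta> (k (\<alpha> \<otimes>\<^bsub>G\<^esub> \<beta>) u)))\<rparr>"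
  have P_carrier: "carrier (?P \<alpha>) = j \<alpha> ` carrier (mpart M \<alpha>)" for \<alpha>
    by (simp add: transport_rmod_def Let_def)
  have P: "right_module A (?P \<alpha>)" if "\<alpha> \<in> carrier G" for \<alpha>
    by (rule transport_rmod_module[OF M.mpart_module[OF that] j[OF that]])
  have jlin: "right_linear A (mpart M \<alpha>) (?P \<alpha>) (j \<alpha>)" if "\<alpha> \<in> carrier G" for \<alpha>
    by (rule transport_rmod_linear[OF M.mpart_module[OF that] j[OF that]])
  have kj: "k \<alpha> (j \<alpha> m) = m" if "\<alpha> \<in> carrier G" "m \<in> carrier (mpart M \<alpha>)" for \<alpha> m
    using j[OF that(1)] that(2) by (simp add: k_def)
  have k: "k \<alpha> u \<in> carrier (mpart M \<alpha>)" "j \<alpha> (k \<alpha> u) = u" if "\<alpha> \<in> carrier G" "u \<in> carrier (?P \<alpha>)" for \<alpha> u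
    using that(2) kj[OF that(1)] by (auto simp: P_carrier)
  have klin: "right_linear A (?P \<alpha>) (mpart M \<alpha>) (k \<alpha>)" if "\<alpha> \<in> carrier G" for \<alpha>
    by (rule right_linear_inverse[OF M.mpart_module[OF that] jlin[OF that]]) (simp_all add: k kj that)
  have M'_simps: "mpart M' \<alpha> = ?P \<alpha>" "coact M' \<alpha> \<beta> =
      (\<lambda>u\<in>carrier (?P (\<alpha> \<otimes>\<^bsub>G\<^esub> \<beta>)). ?jC \<alpha> \<beta> (coact M \<alpha> \<beta> (k (\<alpha> \<otimes>\<^bsub>G\<^esub> \<beta>) u)))" for \<alpha> \<beta>
    by (simp_all add: M'_def)
  have PC: "tensor_product A (?P \<alpha>) (cpart C \<beta>)" if "\<alpha> \<in> carrier G" "\<beta> \<in> carrier G" for \<alpha> \<beta>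
    by (rule tensor_product_bimod[OF P[OF that(1)] cpart_bimodule[OF that(2)]])
  have coact_j: "coact M' \<alpha> \<beta> (j (\<alpha> \<otimes>\<^bsub>G\<^esub> \<beta>) m) = ?jC \<alpha> \<beta> (coact M \<alpha> \<beta> m)"
    if "\<alpha> \<in> carrier G" "\<beta> \<in> carrier G" "m \<in> carrier (mpart M (\<alpha> \<otimes>\<^bsub>G\<^esub> \<beta>))" for \<alpha> \<beta> m
    using that by (simp add: M'_simps P_carrier kj)
  have coact_hom: "coact M' \<alpha> \<beta> \<in> rmod_hom A (mpart M' (\<alpha> \<otimes>\<^bsub>G\<^esub> \<beta>)) (tensor_rmod A (mpart M' \<alpha>) (cpart C \<beta>))"
    if \<alpha>: "\<alpha> \<in> carrier G" and \<beta>: "\<beta> \<in> carrier G" for \<alpha> \<beta>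
  proof -
    have \<alpha>\<beta>: "\<alpha> \<otimes>\<^bsub>G\<^esub> \<beta> \<in> carrier G" using that by simp
    have "right_linear A (?P (\<alpha> \<otimes>\<^bsub>G\<^esub> \<beta>)) (tensor_rmod A (?P \<alpha>) (cpart C \<beta>)) (\<lambda>u. ?jC \<alpha> \<beta> (coact M \<alpha> \<beta> (k (\<alpha> \<otimes>\<^bsub>G\<^esub> \<beta>) u)))"
      by (rule right_linear_comp[OF right_linear_comp[OF klin[OF \<alpha>\<beta>] M.coact_right_linear[OF \<alpha> \<beta>]]
            tensor_map_right_linear[OF M.M_tensor_C[OF \<alpha> \<beta>] PC[OF \<alpha> \<beta>] jlin[OF \<alpha>] left_linear_id
              cpart_bimodule[OF \<beta>] cpart_bimodule[OF \<beta>] right_linear_id]])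
    then have "right_linear A (?P (\<alpha> \<otimes>\<^bsub>G\<^esub> \<beta>)) (tensor_rmod A (?P \<alpha>) (cpart C \<beta>)) (coact M' \<alpha> \<beta>)"
      by (rule right_linear_cong[OF P[OF \<alpha>\<beta>]]) (simp add: M'_simps)
    then show ?thesis by (simp add: rmod_hom_iff M'_simps)
  qed
  have M': "group_comodule G A C M'"
    by (rule quotient_comodule[OF M, where f = j])
       (use P coact_hom jlin coact_j in \<open>simp_all add: M'_simps(1) P_carrier\<close>)
  let ?j = "\<lambda>\<alpha>\<in>carrier G. restrict (j \<alpha>) (carrier (mpart M \<alpha>))"
  have jhom: "?j \<in> comod_hom G A C M M'"
    by (rule comod_homI[OF M M']) (use jlin coact_j in \<open>simp_all add: M'_simps(1)\<close>)
  have "(\<lambda>\<alpha>\<in>carrier G. restrict (k \<alpha>) (carrier (mpart M' \<alpha>))) \<in> comod_hom G A C M' M"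
    by (rule comod_hom_inverse[OF M M' jhom]) (simp_all add: M'_simps(1) k kj)
  from that[OF M' jhom this] show thesis
    by (simp add: M'_simps(1) P_carrier kj)
qed

end

lemma infinite_times_eqpoll_self: "infinite A \<Longrightarrow> A \<times> A \<approx> A"
  by (simp add: eqpoll_iff_card_of_ordIso card_of_Times_same_infinite)

text \<open>A pairing function \<open>p\<close> on \<open>'u\<close>, iterated along a list, encodes the list up to its length, which is then added to the code.\<close>

lemma lists_lepoll_infinite:
  assumes U: "infinite (UNIV :: 'u set)"
  shows "(UNIV :: 'u list set) \<lesssim> (UNIV :: 'u set)"
proof -
  obtain p :: "'u \<times> 'u \<Rightarrow> 'u" where p: "inj p"
    using infinite_times_eqpoll_self[OF U] unfolding eqpoll_def bij_betw_def by fastforce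
  obtain q :: "nat \<Rightarrow> 'u" where q: "inj q"
    using U infinite_countable_subset by blast
  define enc :: "'u list \<Rightarrow> 'u" where "enc xs = foldr (\<lambda>x y. p (x, y)) xs (q 0)" for xs
  have enc: "enc xs = enc ys \<Longrightarrow> length xs = length ys \<Longrightarrow> xs = ys" for xs ys
  proof (induction xs arbitrary: ys)
    case (Cons x xs)
    then obtain y ys' where ys: "ys = y # ys'" by (cases ys) auto
    then have "p (x, enc xs) = p (y, enc ys')" using Cons.prems(1) by (simp add: enc_def)
    then have "x = y" "enc xs = enc ys'" using injD[OF p] by blast+
    then show ?case using Cons.IH[of ys'] Cons.prems(2) by (simp add: ys)
  qed simp
  have "inj (\<lambda>xs. p (q (length xs), enc xs))"
    by (rule injI) (use injD[OF p] injD[OF q] enc in blast)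
  then show ?thesis unfolding lepoll_def by blast
qed

text \<open>Summation maps the finite lists of pairs \<open>(m, n)\<close> onto \<open>M \<otimes>\<^sub>R N\<close>.\<close>

lemma tensor_group_lepoll:
  assumes T: "tensor_product R M N" and U: "infinite (UNIV :: 'u set)"
    and M: "carrier M \<lesssim> (UNIV :: 'u set)" and N: "carrier N \<lesssim> (UNIV :: 'u set)"
  shows "carrier (tensor_group R M N) \<lesssim> (UNIV :: 'u set)"
proof -
  interpret T: tensor_product R M N by fact
  interpret Q: abelian_group "tensor_group R M N" by (rule T.abelian_tensor_group)
  let ?MN = "carrier M \<times> carrier N"
  let ?sum = "\<lambda>xs. foldr (\<lambda>(m, n) t. tensor R M N m n \<oplus>\<^bsub>tensor_group R M N\<^esub> t) xs \<zero>\<^bsub>tensor_group R M N\<^esub>"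
  have sum_closed: "?sum xs \<in> carrier (tensor_group R M N)" if "xs \<in> lists ?MN" for xs
    using that by (induction xs) (auto simp: T.tensor_closed)
  have sum_append: "?sum (xs @ ys) = ?sum xs \<oplus>\<^bsub>tensor_group R M N\<^esub> ?sum ys"
    if "xs \<in> lists ?MN" "ys \<in> lists ?MN" for xs ys
    using that(1)
  proof (induction xs)
    case Nil
    then show ?case using sum_closed[OF that(2)] by simp
  next
    case (Cons x xs)
    then show ?case
      using sum_closed[OF that(2)] sum_closed[of xs] by (auto simp: T.tensor_closed Q.a_assoc)
  qed
  have "t \<in> ?sum ` lists ?MN" if "t \<in> carrier (tensor_group R M N)" for t
    using that
  proof (induction t rule: T.tensor_induct)
    case (pure m n)
    then show ?case by (intro image_eqI[of _ _ "[(m, n)]"]) (simp_all add: T.tensor_closed)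
  next
    case (add s t)
    then obtain xs ys where "s = ?sum xs" "t = ?sum ys" "xs \<in> lists ?MN" "ys \<in> lists ?MN" by blast
    then show ?case by (intro image_eqI[of _ _ "xs @ ys"]) (simp_all only: sum_append append_in_lists_conv)
  qed
  then have "carrier (tensor_group R M N) \<lesssim> lists ?MN"
    by (meson image_lepoll lepoll_trans subset_imp_lepoll subsetI)
  also have "?MN \<lesssim> (UNIV :: 'u set)"
    using times_lepoll_mono[OF M N] infinite_times_eqpoll_self[OF U] eqpoll_imp_lepoll lepoll_trans
    by metis
  then have "lists ?MN \<lesssim> lists (UNIV :: 'u set)" by (rule lists_lepoll_mono)
  also have "lists (UNIV :: 'u set) \<lesssim> (UNIV :: 'u set)"
    using lists_lepoll_infinite[OF U] by simp
  finally show ?thesis .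
qed

section \<open>Full faithfulness on small objects\<close>

context grouplike_coring
begin

abbreviation G\<^sub>7 :: "('g, 'a, 'm, 'c) comod \<Rightarrow> ('b, 'g \<Rightarrow> 'm) rmod" where "G\<^sub>7 \<equiv> G7 G A C x i"

lemma G7_carrier_iff:
  "m \<in> carrier (G\<^sub>7 M) \<longleftrightarrow> m \<in> (\<Pi>\<^sub>E \<alpha>\<in>carrier G. carrier (mpart M \<alpha>)) \<and>
    (\<forall>\<alpha>\<in>carrier G. \<forall>\<beta>\<in>carrier G.
       coact M \<alpha> \<beta> (m (\<alpha> \<otimes>\<^bsub>G\<^esub> \<beta>)) = tensor A (mpart M \<alpha>) (cpart C \<beta>) (m \<alpha>) (x \<beta>))"
  by (simp add: G7_def)

lemma G7_simps [simp]:
  "m \<oplus>\<^bsub>G\<^sub>7 M\<^esub> m' = (\<lambda>\<alpha>\<in>carrier G. m \<alpha> \<oplus>\<^bsub>mpart M \<alpha>\<^esub> m' \<alpha>)"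
  "m \<triangleleft>\<^bsub>G\<^sub>7 M\<^esub> b = (\<lambda>\<alpha>\<in>carrier G. m \<alpha> \<triangleleft>\<^bsub>mpart M \<alpha>\<^esub> i b)"
  by (simp_all add: G7_def)

lemma G7_component: "m \<in> carrier (G\<^sub>7 M) \<Longrightarrow> \<alpha> \<in> carrier G \<Longrightarrow> m \<alpha> \<in> carrier (mpart M \<alpha>)"
  by (auto simp: G7_carrier_iff)

lemma G7_eqI:
  assumes "m \<in> carrier (G\<^sub>7 M)" "m' \<in> carrier (G\<^sub>7 M)" "\<And>\<alpha>. \<alpha> \<in> carrier G \<Longrightarrow> m \<alpha> = m' \<alpha>"
  shows "m = m'"
  using assms by (auto simp: G7_carrier_iff intro: PiE_ext)

lemma G7_add_closed:
  assumes M: "group_comodule G A C M" and m: "m \<in> carrier (G\<^sub>7 M)" "m' \<in> carrier (G\<^sub>7 M)"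
  shows "m \<oplus>\<^bsub>G\<^sub>7 M\<^esub> m' \<in> carrier (G\<^sub>7 M)"
proof -
  interpret M: group_comodule G A C M by fact
  have closed: "m \<alpha> \<oplus>\<^bsub>mpart M \<alpha>\<^esub> m' \<alpha> \<in> carrier (mpart M \<alpha>)" if "\<alpha> \<in> carrier G" for \<alpha>
    by (rule abelian_groupE(1)[OF right_module.axioms(2)[OF M.mpart_module[OF that]]])
       (simp_all add: G7_component m that)
  have "coact M \<alpha> \<beta> (m (\<alpha> \<otimes>\<^bsub>G\<^esub> \<beta>) \<oplus>\<^bsub>mpart M (\<alpha> \<otimes>\<^bsub>G\<^esub> \<beta>)\<^esub> m' (\<alpha> \<otimes>\<^bsub>G\<^esub> \<beta>))
      = tensor A (mpart M \<alpha>) (cpart C \<beta>) (m \<alpha> \<oplus>\<^bsub>mpart M \<alpha>\<^esub> m' \<alpha>) (x \<beta>)"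
    if "\<alpha> \<in> carrier G" "\<beta> \<in> carrier G" for \<alpha> \<beta>
    using that m
    by (simp add: right_linear_add[OF M.coact_right_linear] G7_component tensor_product.tensor_add_left[OF M.M_tensor_C]
        x_closed) (simp add: G7_carrier_iff)
  then show ?thesis using closed by (simp add: G7_carrier_iff)
qed

text \<open>As for the coaction of \<open>F\<^sub>7\<close>, the point is that \<open>i(b)\<close> commutes with \<open>x\<^sub>\<beta>\<close>:
  \<open>(m\<^sub>\<alpha> \<otimes> x\<^sub>\<beta>) i(b) = m\<^sub>\<alpha> \<otimes> i(b) x\<^sub>\<beta> = m\<^sub>\<alpha> i(b) \<otimes> x\<^sub>\<beta>\<close>.\<close>

lemma G7_ract_closed:
  assumes M: "group_comodule G A C M" and m: "m \<in> carrier (G\<^sub>7 M)" and b: "b \<in> carrier B"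
  shows "m \<triangleleft>\<^bsub>G\<^sub>7 M\<^esub> b \<in> carrier (G\<^sub>7 M)"
proof -
  interpret M: group_comodule G A C M by fact
  have closed: "m \<alpha> \<triangleleft>\<^bsub>mpart M \<alpha>\<^esub> i b \<in> carrier (mpart M \<alpha>)" if "\<alpha> \<in> carrier G" for \<alpha>
    using right_module.ract_closed[OF M.mpart_module[OF that]] G7_component[OF m that] i_closed[OF b] by simp
  have "coact M \<alpha> \<beta> (m (\<alpha> \<otimes>\<^bsub>G\<^esub> \<beta>) \<triangleleft>\<^bsub>mpart M (\<alpha> \<otimes>\<^bsub>G\<^esub> \<beta>)\<^esub> i b)
      = tensor A (mpart M \<alpha>) (cpart C \<beta>) (m \<alpha> \<triangleleft>\<^bsub>mpart M \<alpha>\<^esub> i b) (x \<beta>)"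
    if \<alpha>: "\<alpha> \<in> carrier G" and \<beta>: "\<beta> \<in> carrier G" for \<alpha> \<beta>
  proof -
    have "coact M \<alpha> \<beta> (m (\<alpha> \<otimes>\<^bsub>G\<^esub> \<beta>) \<triangleleft>\<^bsub>mpart M (\<alpha> \<otimes>\<^bsub>G\<^esub> \<beta>)\<^esub> i b)
      = tensor_ract A (mpart M \<alpha>) (cpart C \<beta>) (tensor A (mpart M \<alpha>) (cpart C \<beta>) (m \<alpha>) (x \<beta>)) (i b)"
      using that m right_linear_ract[OF M.coact_right_linear[OF \<alpha> \<beta>] G7_component[OF m] i_closed[OF b]]
      by (simp add: G7_carrier_iff)
    also have "\<dots> = tensor A (mpart M \<alpha>) (cpart C \<beta>) (m \<alpha>) (i b \<triangleright>\<^bsub>cpart C \<beta>\<^esub> x \<beta>)"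
      by (simp add: tensor_product.tensor_ract_pure[OF M.M_tensor_C[OF \<alpha> \<beta>] cpart_bimodule[OF \<beta>]] i_closed[OF b]
          G7_component[OF m \<alpha>] x_closed \<beta> i_x[OF b \<beta>])
    also have "\<dots> = tensor A (mpart M \<alpha>) (cpart C \<beta>) (m \<alpha> \<triangleleft>\<^bsub>mpart M \<alpha>\<^esub> i b) (x \<beta>)"
      by (simp add: tensor_product.tensor_balanced[OF M.M_tensor_C[OF \<alpha> \<beta>]] i_closed[OF b] G7_component[OF m \<alpha>]
          x_closed \<beta>)
    finally show ?thesis .
  qed
  then show ?thesis using closed by (simp add: G7_carrier_iff)
qed

lemma G7_map_closed:
  assumes M: "group_comodule G A C M" and N: "group_comodule G A C N" and f: "f \<in> comod_hom G A C M N"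
    and m: "m \<in> carrier (G\<^sub>7 M)"
  shows "(\<lambda>\<alpha>\<in>carrier G. f \<alpha> (m \<alpha>)) \<in> carrier (G\<^sub>7 N)"
proof -
  interpret M: group_comodule G A C M by fact
  interpret N: group_comodule G A C N by fact
  have "coact N \<alpha> \<beta> (f (\<alpha> \<otimes>\<^bsub>G\<^esub> \<beta>) (m (\<alpha> \<otimes>\<^bsub>G\<^esub> \<beta>))) = tensor A (mpart N \<alpha>) (cpart C \<beta>) (f \<alpha> (m \<alpha>)) (x \<beta>)"
    if \<alpha>: "\<alpha> \<in> carrier G" and \<beta>: "\<beta> \<in> carrier G" for \<alpha> \<beta>
  proof -
    have "coact M \<alpha> \<beta> (m (\<alpha> \<otimes>\<^bsub>G\<^esub> \<beta>)) = tensor A (mpart M \<alpha>) (cpart C \<beta>) (m \<alpha>) (x \<beta>)"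
      using m that by (simp add: G7_carrier_iff)
    then show ?thesis
      using comod_hom_coact[OF f \<alpha> \<beta>, of "m (\<alpha> \<otimes>\<^bsub>G\<^esub> \<beta>)"] that G7_component[OF m]
        tensor_map_pure[OF M.M_tensor_C[OF \<alpha> \<beta>] N.M_tensor_C[OF \<alpha> \<beta>] comod_hom_right_linear[OF f \<alpha>] left_linear_id]
      by (simp add: x_closed)
  qed
  then show ?thesis
    using comod_hom_closed[OF f] G7_component[OF m] by (simp add: G7_carrier_iff)
qed

lemma G7_map_right_linear:
  assumes M: "group_comodule G A C M" and N: "group_comodule G A C N" and f: "f \<in> comod_hom G A C M N"
  shows "right_linear B (G\<^sub>7 M) (G\<^sub>7 N) (\<lambda>m. \<lambda>\<alpha>\<in>carrier G. f \<alpha> (m \<alpha>))"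
proof -
  note lin = comod_hom_right_linear[OF f]
  show ?thesis
    unfolding right_linear_def additive_map_def
    using G7_map_closed[OF M N f]
    by (auto simp: fun_eq_iff restrict_def right_linear_add[OF lin] right_linear_ract[OF lin] G7_component i_closed)
qed

text \<open>Full faithfulness passes from comodules on \<open>'u\<close> to all comodules that have copies there: conjugate the comodule morphisms with the
  isomorphisms \<open>jM\<close> and \<open>jN\<close> onto the copies, and the linear maps with the images of these under \<open>G\<^sub>7\<close>.\<close>

lemma G7_fully_faithful_small:
  fixes M :: "('g, 'a, 'm, 'c) comod" and N :: "('g, 'a, 'n, 'c) comod"
  assumes ff: "G7_fully_faithful TYPE('u) G A B C x i"
    and M: "group_comodule G A C M" and N: "group_comodule G A C N"
    and M_small: "\<And>\<alpha>. \<alpha> \<in> carrier G \<Longrightarrow> carrier (mpart M \<alpha>) \<lesssim> (UNIV :: 'u set)"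
    and N_small: "\<And>\<alpha>. \<alpha> \<in> carrier G \<Longrightarrow> carrier (mpart N \<alpha>) \<lesssim> (UNIV :: 'u set)"
  shows G7_faithful_small:
      "\<lbrakk>f \<in> comod_hom G A C M N; g \<in> comod_hom G A C M N;
        \<And>m \<alpha>. m \<in> carrier (G\<^sub>7 M) \<Longrightarrow> \<alpha> \<in> carrier G \<Longrightarrow> f \<alpha> (m \<alpha>) = g \<alpha> (m \<alpha>)\<rbrakk> \<Longrightarrow> f = g"
    and G7_full_small:
      "right_linear B (G\<^sub>7 M) (G\<^sub>7 N) s \<Longrightarrow>
        \<exists>f\<in>comod_hom G A C M N. \<forall>m\<in>carrier (G\<^sub>7 M). \<forall>\<alpha>\<in>carrier G. f \<alpha> (m \<alpha>) = s m \<alpha>"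
proof -
  obtain M' :: "('g, 'a, 'u, 'c) comod" and jM kM where M': "group_comodule G A C M'"
    and jM: "jM \<in> comod_hom G A C M M'" and kM: "kM \<in> comod_hom G A C M' M"
    and kjM: "\<And>\<alpha> m. \<alpha> \<in> carrier G \<Longrightarrow> m \<in> carrier (mpart M \<alpha>) \<Longrightarrow> kM \<alpha> (jM \<alpha> m) = m"
    by (rule comodule_copy[OF M M_small]) blast+
  obtain N' :: "('g, 'a, 'u, 'c) comod" and jN kN where N': "group_comodule G A C N'"
    and jN: "jN \<in> comod_hom G A C N N'" and kN: "kN \<in> comod_hom G A C N' N"
    and kjN: "\<And>\<alpha> m. \<alpha> \<in> carrier G \<Longrightarrow> m \<in> carrier (mpart N \<alpha>) \<Longrightarrow> kN \<alpha> (jN \<alpha> m) = m"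
    by (rule comodule_copy[OF N N_small]) blast+
  have bij: "bij_betw (G7_map G A C x i M' N') (comod_hom G A C M' N') (rmod_hom B (G\<^sub>7 M') (G\<^sub>7 N'))"
    using ff M' N' by (simp add: G7_fully_faithful_def fully_faithful_def)
  have conj: "\<exists>f'\<in>comod_hom G A C M' N'. \<forall>\<alpha>\<in>carrier G. \<forall>m\<in>carrier (mpart M' \<alpha>). f' \<alpha> m = jN \<alpha> (f \<alpha> (kM \<alpha> m))"
    if f: "f \<in> comod_hom G A C M N" for f
  proof -
    obtain g where g: "g \<in> comod_hom G A C M' N"
      and g_eq: "\<And>\<alpha> m. \<alpha> \<in> carrier G \<Longrightarrow> m \<in> carrier (mpart M' \<alpha>) \<Longrightarrow> g \<alpha> m = f \<alpha> (kM \<alpha> m)"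
      by (rule comod_hom_comp[OF M' M N kM f]) blast
    obtain h where "h \<in> comod_hom G A C M' N'"
      and "\<And>\<alpha> m. \<alpha> \<in> carrier G \<Longrightarrow> m \<in> carrier (mpart M' \<alpha>) \<Longrightarrow> h \<alpha> m = jN \<alpha> (g \<alpha> m)"
      by (rule comod_hom_comp[OF M' N N' g jN]) blast
    then show ?thesis using g_eq by (metis (no_types, lifting))
  qed
  show "f = g" if f: "f \<in> comod_hom G A C M N" and g: "g \<in> comod_hom G A C M N"
    and eq: "\<And>m \<alpha>. m \<in> carrier (G\<^sub>7 M) \<Longrightarrow> \<alpha> \<in> carrier G \<Longrightarrow> f \<alpha> (m \<alpha>) = g \<alpha> (m \<alpha>)" for f g
  proof -
    obtain f' where f': "f' \<in> comod_hom G A C M' N'"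
      and f'_eq: "\<And>\<alpha> m. \<alpha> \<in> carrier G \<Longrightarrow> m \<in> carrier (mpart M' \<alpha>) \<Longrightarrow> f' \<alpha> m = jN \<alpha> (f \<alpha> (kM \<alpha> m))"
      using conj[OF f] by blast
    obtain g' where g': "g' \<in> comod_hom G A C M' N'"
      and g'_eq: "\<And>\<alpha> m. \<alpha> \<in> carrier G \<Longrightarrow> m \<in> carrier (mpart M' \<alpha>) \<Longrightarrow> g' \<alpha> m = jN \<alpha> (g \<alpha> (kM \<alpha> m))"
      using conj[OF g] by blast
    have "f' \<alpha> (m \<alpha>) = g' \<alpha> (m \<alpha>)" if "m \<in> carrier (G\<^sub>7 M')" "\<alpha> \<in> carrier G" for m \<alpha>
      using eq[OF G7_map_closed[OF M' M kM that(1)] that(2)] that G7_component[OF that]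
      by (simp add: f'_eq g'_eq)
    then have "G7_map G A C x i M' N' f' = G7_map G A C x i M' N' g'"
      by (auto simp: G7_map_def fun_eq_iff restrict_def)
    then have "f' = g'"
      using bij f' g' by (auto simp: bij_betw_def dest: inj_onD)
    then have "f \<alpha> m = g \<alpha> m" if \<alpha>: "\<alpha> \<in> carrier G" and m: "m \<in> carrier (mpart M \<alpha>)" for \<alpha> m
      using f'_eq[OF \<alpha> comod_hom_closed[OF jM \<alpha> m]] g'_eq[OF \<alpha> comod_hom_closed[OF jM \<alpha> m]] kjM[OF that]
        kjN[OF \<alpha> comod_hom_closed[OF f \<alpha> m]] kjN[OF \<alpha> comod_hom_closed[OF g \<alpha> m]] by simp
    then show "f = g" by (rule comod_hom_eqI[OF f g])
  qed
  show "\<exists>f\<in>comod_hom G A C M N. \<forall>m\<in>carrier (G\<^sub>7 M). \<forall>\<alpha>\<in>carrier G. f \<alpha> (m \<alpha>) = s m \<alpha>"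
    if s: "right_linear B (G\<^sub>7 M) (G\<^sub>7 N) s" for s
  proof -
    let ?Gj = "\<lambda>n. \<lambda>\<alpha>\<in>carrier G. jN \<alpha> (n \<alpha>)" and ?Gk = "\<lambda>m. \<lambda>\<alpha>\<in>carrier G. kM \<alpha> (m \<alpha>)"
    let ?s = "restrict (\<lambda>m. ?Gj (s (?Gk m))) (carrier (G\<^sub>7 M'))"
    have "right_linear B (G\<^sub>7 M') (G\<^sub>7 N') (\<lambda>m. ?Gj (s (?Gk m)))"
      by (rule right_linear_comp[OF right_linear_comp[OF G7_map_right_linear[OF M' M kM] s] G7_map_right_linear[OF N N' jN]])
    then have "right_linear B (G\<^sub>7 M') (G\<^sub>7 N') ?s"
      using G7_add_closed[OF M'] G7_ract_closed[OF M']
      unfolding right_linear_def additive_map_def by (simp del: G7_simps)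
    then have "?s \<in> rmod_hom B (G\<^sub>7 M') (G\<^sub>7 N')" by (simp add: rmod_hom_iff)
    then have "?s \<in> G7_map G A C x i M' N' ` comod_hom G A C M' N'"
      using bij by (simp only: bij_betw_def)
    then obtain f' where f': "f' \<in> comod_hom G A C M' N'" and G7_f': "?s = G7_map G A C x i M' N' f'"
      by (rule imageE)
    have f'_eq: "f' \<alpha> (m \<alpha>) = jN \<alpha> (s (?Gk m) \<alpha>)" if "m \<in> carrier (G\<^sub>7 M')" "\<alpha> \<in> carrier G" for m \<alpha>
      using fun_cong[OF fun_cong[OF G7_f', of m], of \<alpha>] that by (simp add: G7_map_def)
    obtain g where g: "g \<in> comod_hom G A C M N'"
      and g_eq: "\<And>\<alpha> m. \<alpha> \<in> carrier G \<Longrightarrow> m \<in> carrier (mpart M \<alpha>) \<Longrightarrow> g \<alpha> m = f' \<alpha> (jM \<alpha> m)"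
      by (rule comod_hom_comp[OF M M' N' jM f']) blast
    obtain f where f: "f \<in> comod_hom G A C M N"
      and f_eq: "\<And>\<alpha> m. \<alpha> \<in> carrier G \<Longrightarrow> m \<in> carrier (mpart M \<alpha>) \<Longrightarrow> f \<alpha> m = kN \<alpha> (g \<alpha> m)"
      by (rule comod_hom_comp[OF M N' N g kN]) blast
    have "f \<alpha> (m \<alpha>) = s m \<alpha>" if m: "m \<in> carrier (G\<^sub>7 M)" and \<alpha>: "\<alpha> \<in> carrier G" for m \<alpha>
    proof -
      let ?m = "\<lambda>\<alpha>\<in>carrier G. jM \<alpha> (m \<alpha>)"
      have m': "?m \<in> carrier (G\<^sub>7 M')" by (rule G7_map_closed[OF M M' jM m])
      have "?Gk ?m = m"
        by (rule G7_eqI[OF G7_map_closed[OF M' M kM m'] m]) (simp add: kjM G7_component[OF m])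
      then have "f' \<alpha> (jM \<alpha> (m \<alpha>)) = jN \<alpha> (s m \<alpha>)"
        using f'_eq[OF m' \<alpha>] \<alpha> by simp
      then show ?thesis
        using G7_component[OF m \<alpha>] G7_component[OF right_linear_closed[OF s m] \<alpha>] \<alpha>
        by (simp add: f_eq g_eq kjN)
    qed
    then show ?thesis using f by blast
  qed
qed

end

section \<open>The unit of the adjunction: fully faithful induction\<close>

text \<open>One map \<open>\<phi>\<close>, used in every degree, is colinear as soon as it is so on pure tensors for \<open>\<alpha> = e\<close>, since the coaction
  of \<open>F\<^sub>7(N)\<close> does not depend on the first index.\<close>

lemma (in induced_comodule) F7_endomorphism:
  assumes lin: "right_linear A T T \<phi>"
    and coact: "\<And>\<beta> n a. \<beta> \<in> carrier G \<Longrightarrow> n \<in> carrier N \<Longrightarrow> a \<in> carrier A \<Longrightarrow>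
      tensor A T (cpart C \<beta>) (\<phi> (tensor B N A\<^sub>l n \<one>\<^bsub>A\<^esub>)) (x \<beta> \<triangleleft>\<^bsub>cpart C \<beta>\<^esub> a) = \<rho> \<one>\<^bsub>G\<^esub> \<beta> (\<phi> (tensor B N A\<^sub>l n a))"
  shows "(\<lambda>\<alpha>\<in>carrier G. restrict \<phi> (carrier T)) \<in> comod_hom G A C (F7 A B C x i N) (F7 A B C x i N)"
proof -
  have "(\<lambda>\<alpha>\<in>carrier G. restrict \<phi> (carrier (mpart (F7 A B C x i N) \<alpha>)))
    \<in> comod_hom G A C (F7 A B C x i N) (F7 A B C x i N)"
  proof (rule comod_homI[OF F7_comodule F7_comodule]; simp only: F7_simps(1))
    show "right_linear A T T \<phi>" by fact
    fix \<alpha> \<beta> t assume \<alpha>: "\<alpha> \<in> carrier G" and \<beta>: "\<beta> \<in> carrier G" and "t \<in> carrier T"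
    then have t: "t \<in> carrier (tensor_group B N A\<^sub>l)" by simp
    interpret C\<beta>: bimodule A A "cpart C \<beta>" by (rule cpart_bimodule[OF \<beta>])
    note \<phi>id = TC[OF \<beta>] TC[OF \<beta>] lin left_linear_id
    have add: "additive_map (tensor_group B N A\<^sub>l) (tensor_group B N A\<^sub>l) \<phi>"
      using right_linear_additive[OF lin] by simp
    show "tensor_map A T (cpart C \<beta>) T (cpart C \<beta>) \<phi> (\<lambda>d. d) (\<rho> \<alpha> \<beta> t) = \<rho> \<alpha> \<beta> (\<phi> t)"
    proof (rule NA.tensor_eqI[OF additive_map_comp[OF coact_additive[OF \<beta>] tensor_map_additive[OF \<phi>id]]
          additive_map_comp[OF add coact_additive[OF \<beta>]] _ t])
      fix n a assume n: "n \<in> carrier N" and "a \<in> carrier A\<^sub>l"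
      then have a: "a \<in> carrier A" by simp
      have "\<rho> \<alpha> \<beta> = \<rho> \<one>\<^bsub>G\<^esub> \<beta>" by simp
      then show "tensor_map A T (cpart C \<beta>) T (cpart C \<beta>) \<phi> (\<lambda>d. d) (\<rho> \<alpha> \<beta> (tensor B N A\<^sub>l n a))
          = \<rho> \<alpha> \<beta> (\<phi> (tensor B N A\<^sub>l n a))"
        using coact[OF \<beta> n a] n a \<beta>
        by (simp add: coact_pure[OF \<beta> n a] tensor_map_pure[OF \<phi>id] NA.tensor_closed C\<beta>.ract_closed x_closed del: F7_simps)
    qed
  qed
  then show ?thesis by simp
qed

context grouplike_coring
begin

text \<open>Let \<open>N\<close> be a copy of \<open>B\<close> and \<open>u\<close> the element of \<open>N\<close> that corresponds to \<open>1\<close>. Left multiplications by elements of \<open>B\<close>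
  are the endomorphisms of \<open>N\<close>, and \<open>F\<^sub>7\<close> turns them into left multiplications by their images under \<open>i\<close>; faithfulness gives
  injectivity. Left multiplication by a coinvariant \<open>t\<close> is an endomorphism \<open>\<phi>\<close> of \<open>F\<^sub>7(N)\<close>; fullness gives surjectivity.\<close>

lemma F7_fully_faithful_imp_iso:
  assumes ff: "F7_fully_faithful TYPE('u) G A B C x i" and small: "carrier B \<lesssim> (UNIV :: 'u set)"
  shows "i \<in> ring_iso B (coinvariants G A C x)"
proof -
  obtain j :: "'b \<Rightarrow> 'u" where j: "inj_on j (carrier B)"
    using small unfolding lepoll_def by blast
  define N where "N = transport_rmod j (regular_bimod B)"
  define k where "k = inv_into (carrier B) j"
  have reg: "right_module B (regular_bimod B)"
    by (rule bimodule_right[OF bimodule_regular[OF B.ring_axioms]])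
  have N: "right_module B N"
    unfolding N_def by (rule transport_rmod_module[OF reg]) (simp add: j)
  have jlin: "right_linear B (regular_bimod B) N j"
    unfolding N_def by (rule transport_rmod_linear[OF reg]) (simp add: j)
  have N_carrier: "carrier N = j ` carrier B"
    by (simp add: N_def transport_rmod_def Let_def)
  have kj: "k (j b) = b" if "b \<in> carrier B" for b
    using j that by (simp add: k_def)
  have k: "k n \<in> carrier B" "j (k n) = n" if "n \<in> carrier N" for n
    using that kj by (auto simp: N_carrier)
  have klin: "right_linear B N (regular_bimod B) k"
    by (rule right_linear_inverse[OF reg jlin]) (simp_all add: k kj)
  interpret N: induced_comodule G A C B x i N
    by (intro induced_comodule.intro grouplike_coring_axioms N)
  interpret T: right_module A N.T by (rule N.T_module)
  define u where "u = j \<one>\<^bsub>B\<^esub>"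
  have u: "u \<in> carrier N" by (simp add: u_def N_carrier)
  have j_eq: "j b = u \<triangleleft>\<^bsub>N\<^esub> b" if "b \<in> carrier B" for b
    using right_linear_ract[OF jlin, of "\<one>\<^bsub>B\<^esub>" b] that by (simp add: u_def)
  \<comment> \<open>Over \<open>N \<cong> B\<close> every element of \<open>N \<otimes>\<^sub>B A \<cong> A\<close> has the form \<open>1 \<otimes> a\<close>, and \<open>a\<close> can be recovered from it.\<close>
  have pure_eq: "tensor B N A\<^sub>l n a = tensor B N A\<^sub>l u (i (k n) \<otimes>\<^bsub>A\<^esub> a)"
    if "n \<in> carrier N" "a \<in> carrier A" for n a
    using N.NA.tensor_balanced[of u "k n" a] that u k[OF that(1)] by (simp add: j_eq[symmetric])
  have u_inj: "a = a'" if a: "a \<in> carrier A" "a' \<in> carrier A" and eq: "tensor B N A\<^sub>l u a = tensor B N A\<^sub>l u a'" for a a'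
  proof -
    have "balanced_map B N A\<^sub>l A (\<lambda>n a. i (k n) \<otimes>\<^bsub>A\<^esub> a)"
      using right_linear_add[OF klin] right_linear_ract[OF klin]
      by (simp add: balanced_map_def k i_closed A.l_distr A.r_distr A.m_assoc ring_hom_add[OF i_ring_hom]
          ring_hom_mult[OF i_ring_hom])
    note lift = N.NA.tensor_lift_pure[OF A.abelian_group_axioms this]
    have "i (k u) \<otimes>\<^bsub>A\<^esub> a = i (k u) \<otimes>\<^bsub>A\<^esub> a'"
      using lift[OF u, of a] lift[OF u, of a'] a by (simp only: ring_bimod_simps eq)
    moreover have "i (k u) = \<one>\<^bsub>A\<^esub>"
      by (simp add: u_def kj ring_hom_one[OF i_ring_hom])
    ultimately show ?thesis using a by simp
  qed
  have bij: "bij_betw (F7_map G A B i N N) (rmod_hom B N N) (comod_hom G A C (F7 A B C x i N) (F7 A B C x i N))"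
    using ff N by (simp add: F7_fully_faithful_def fully_faithful_def)
  have F7_map_pure: "F7_map G A B i N N f \<one>\<^bsub>G\<^esub> (tensor B N A\<^sub>l n a) = tensor B N A\<^sub>l (f n) a"
    if "f \<in> rmod_hom B N N" "n \<in> carrier N" "a \<in> carrier A" for f n a
    using that by (simp add: F7_map_def Let_def rmod_hom_iff
        tensor_map_pure[OF N.NA.tensor_product_axioms N.NA.tensor_product_axioms _ left_linear_id])
  have inj: "inj_on i (carrier B)"
  proof (rule inj_onI)
    fix b b' assume b: "b \<in> carrier B" "b' \<in> carrier B" and eq: "i b = i b'"
    define f where "f b = (\<lambda>n\<in>carrier N. j (b \<otimes>\<^bsub>B\<^esub> k n))" for b
    have f: "f b \<in> rmod_hom B N N" if "b \<in> carrier B" for b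
    proof -
      have "right_linear B (regular_bimod B) (regular_bimod B) (\<lambda>c. b \<otimes>\<^bsub>B\<^esub> c)"
        using that by (simp add: right_linear_def additive_map_def B.r_distr B.m_assoc)
      from right_linear_comp[OF right_linear_comp[OF klin this] jlin]
      have "right_linear B N N (f b)"
        by (rule right_linear_cong[OF N]) (simp add: f_def)
      then show ?thesis by (simp add: rmod_hom_iff f_def)
    qed
    have "tensor_map B N A\<^sub>l N A\<^sub>l (f b) (\<lambda>a. a) = tensor_map B N A\<^sub>l N A\<^sub>l (f b') (\<lambda>a. a)"
    proof (rule extensionalityI)
      have flin: "right_linear B N N (f b)" "right_linear B N N (f b')"
        using f b by (simp_all add: rmod_hom_iff)
      note NN = N.NA.tensor_product_axioms N.NA.tensor_product_axioms
      note fb = NN flin(1) left_linear_id and fb' = NN flin(2) left_linear_id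
      show "tensor_map B N A\<^sub>l N A\<^sub>l (f b) (\<lambda>a. a) \<in> extensional (carrier (tensor_group B N A\<^sub>l))"
        by (rule tensor_map_extensional[OF fb])
      show "tensor_map B N A\<^sub>l N A\<^sub>l (f b') (\<lambda>a. a) \<in> extensional (carrier (tensor_group B N A\<^sub>l))"
        by (rule tensor_map_extensional[OF fb'])
      fix t assume t: "t \<in> carrier (tensor_group B N A\<^sub>l)"
      show "tensor_map B N A\<^sub>l N A\<^sub>l (f b) (\<lambda>a. a) t = tensor_map B N A\<^sub>l N A\<^sub>l (f b') (\<lambda>a. a) t"
      proof (rule N.NA.tensor_eqI[OF tensor_map_additive[OF fb] tensor_map_additive[OF fb'] _ t])
        fix n a assume n: "n \<in> carrier N" and "a \<in> carrier A\<^sub>l"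
        then have a: "a \<in> carrier A" by simp
        have fn: "f c n \<in> carrier N" "k (f c n) = c \<otimes>\<^bsub>B\<^esub> k n" if "c \<in> carrier B" for c
          using that n k[OF n] by (simp_all add: f_def N_carrier kj)
        show "tensor_map B N A\<^sub>l N A\<^sub>l (f b) (\<lambda>a. a) (tensor B N A\<^sub>l n a)
            = tensor_map B N A\<^sub>l N A\<^sub>l (f b') (\<lambda>a. a) (tensor B N A\<^sub>l n a)"
          using n a b k[OF n]
          by (simp add: tensor_map_pure[OF fb] tensor_map_pure[OF fb'] pure_eq[OF fn(1)] fn(2)
              ring_hom_mult[OF i_ring_hom] eq)
      qed
    qed
    then have "F7_map G A B i N N (f b) = F7_map G A B i N N (f b')"
      by (simp add: F7_map_def Let_def)
    then have "f b = f b'"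
      using bij f b unfolding bij_betw_def by (blast dest: inj_onD)
    then have "j (b \<otimes>\<^bsub>B\<^esub> k u) = j (b' \<otimes>\<^bsub>B\<^esub> k u)"
      using u by (auto simp: f_def fun_eq_iff restrict_def split: if_splits)
    then show "b = b'"
      using inj_onD[OF j] b by (simp add: u_def kj)
  qed
  have "\<exists>b\<in>carrier B. i b = t" if t: "t \<in> carrier (coinvariants G A C x)" for t
  proof -
    have tA: "t \<in> carrier A" and tx: "\<And>\<beta>. \<beta> \<in> carrier G \<Longrightarrow> t \<triangleright>\<^bsub>cpart C \<beta>\<^esub> x \<beta> = x \<beta> \<triangleleft>\<^bsub>cpart C \<beta>\<^esub> t"
      using t by (auto simp: coinvariants_def)
    let ?h = "\<lambda>n a. tensor B N A\<^sub>l u (t \<otimes>\<^bsub>A\<^esub> i (k n) \<otimes>\<^bsub>A\<^esub> a)"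
    define \<phi> where "\<phi> = tensor_lift B N A\<^sub>l (tensor_group B N A\<^sub>l) ?h"
    have bal: "balanced_map B N A\<^sub>l (tensor_group B N A\<^sub>l) ?h"
      using right_linear_add[OF klin] right_linear_ract[OF klin] tA u
      by (simp add: balanced_map_def k i_closed A.l_distr A.r_distr A.m_assoc ring_hom_add[OF i_ring_hom]
          ring_hom_mult[OF i_ring_hom] N.NA.tensor_closed N.NA.tensor_add_right[simplified, symmetric])
    note \<phi>_pure = N.NA.tensor_lift_pure[OF N.NA.abelian_tensor_group bal, folded \<phi>_def, simplified]
      and \<phi>_additive = N.NA.tensor_lift_additive[OF N.NA.abelian_tensor_group bal, folded \<phi>_def]
    have \<phi>_lin: "right_linear A N.T N.T \<phi>"
    proof -
      have "\<phi> (tensor_ract B N A\<^sub>l w a) = tensor_ract B N A\<^sub>l (\<phi> w) a"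
        if w: "w \<in> carrier (tensor_group B N A\<^sub>l)" and a: "a \<in> carrier A" for w a
        by (rule N.NA.tensor_eqI[OF additive_map_comp[OF N.NA.tensor_ract_additive[OF bimodule_A\<^sub>l a] \<phi>_additive]
              additive_map_comp[OF \<phi>_additive N.NA.tensor_ract_additive[OF bimodule_A\<^sub>l a]] _ w])
           (simp add: N.NA.tensor_ract_pure[OF bimodule_A\<^sub>l] \<phi>_pure a tA u k i_closed A.m_assoc)
      then show ?thesis using \<phi>_additive by (simp add: right_linear_def)
    qed
    have "(\<lambda>\<alpha>\<in>carrier G. restrict \<phi> (carrier N.T)) \<in> comod_hom G A C (F7 A B C x i N) (F7 A B C x i N)"
    proof (rule N.F7_endomorphism[OF \<phi>_lin])
      fix \<beta> n a assume \<beta>: "\<beta> \<in> carrier G" and n: "n \<in> carrier N" and a: "a \<in> carrier A"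
      interpret C\<beta>: bimodule A A "cpart C \<beta>" by (rule cpart_bimodule[OF \<beta>])
      interpret TC: tensor_product A N.T "cpart C \<beta>" by (rule N.TC[OF \<beta>])
      define c where "c = t \<otimes>\<^bsub>A\<^esub> i (k n)"
      have ik: "i (k n) \<in> carrier A" and c: "c \<in> carrier A"
        using tA k[OF n] by (simp_all add: c_def i_closed)
      have x: "x \<beta> \<in> carrier (cpart C \<beta>)" using \<beta> by (rule x_closed)
      \<comment> \<open>This is where \<open>t\<close> being coinvariant makes \<open>\<phi>\<close> colinear.\<close>
      have cx: "c \<triangleright>\<^bsub>cpart C \<beta>\<^esub> x \<beta> = x \<beta> \<triangleleft>\<^bsub>cpart C \<beta>\<^esub> c"
        using tA ik x by (simp add: c_def C\<beta>.lact_mult i_x k[OF n] \<beta> C\<beta>.lact_ract[symmetric] tx C\<beta>.ract_mult)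
      have "tensor B N A\<^sub>l u c = tensor_ract B N A\<^sub>l (tensor B N A\<^sub>l u \<one>\<^bsub>A\<^esub>) c"
        using u c by (simp add: N.NA.tensor_ract_pure[OF bimodule_A\<^sub>l])
      then have "tensor A N.T (cpart C \<beta>) (tensor B N A\<^sub>l u c) (x \<beta> \<triangleleft>\<^bsub>cpart C \<beta>\<^esub> a)
        = tensor A N.T (cpart C \<beta>) (tensor B N A\<^sub>l u \<one>\<^bsub>A\<^esub>) (x \<beta> \<triangleleft>\<^bsub>cpart C \<beta>\<^esub> (c \<otimes>\<^bsub>A\<^esub> a))"
        using TC.tensor_balanced[of "tensor B N A\<^sub>l u \<one>\<^bsub>A\<^esub>" c "x \<beta> \<triangleleft>\<^bsub>cpart C \<beta>\<^esub> a"] u c x a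
        by (simp add: N.NA.tensor_closed C\<beta>.ract_closed C\<beta>.lact_ract[symmetric] cx C\<beta>.ract_mult)
      then show "tensor A N.T (cpart C \<beta>) (\<phi> (tensor B N A\<^sub>l n \<one>\<^bsub>A\<^esub>)) (x \<beta> \<triangleleft>\<^bsub>cpart C \<beta>\<^esub> a)
          = N.\<rho> \<one>\<^bsub>G\<^esub> \<beta> (\<phi> (tensor B N A\<^sub>l n a))"
        using n a c u by (simp add: \<phi>_pure c_def[symmetric] N.coact_pure[OF \<beta>] del: F7_simps)
    qed
    then have "(\<lambda>\<alpha>\<in>carrier G. restrict \<phi> (carrier N.T)) \<in> F7_map G A B i N N ` rmod_hom B N N"
      using bij by (simp only: bij_betw_def)
    then obtain f where f: "f \<in> rmod_hom B N N"
      and f_eq: "(\<lambda>\<alpha>\<in>carrier G. restrict \<phi> (carrier N.T)) = F7_map G A B i N N f"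
      by (rule imageE)
    have fu: "f u \<in> carrier N" using f u by (auto simp: rmod_hom_iff dest: right_linear_closed)
    have "tensor B N A\<^sub>l (f u) \<one>\<^bsub>A\<^esub> = \<phi> (tensor B N A\<^sub>l u \<one>\<^bsub>A\<^esub>)"
      using fun_cong[OF fun_cong[OF f_eq, of "\<one>\<^bsub>G\<^esub>"], of "tensor B N A\<^sub>l u \<one>\<^bsub>A\<^esub>"] F7_map_pure[OF f u] u
      by (simp add: N.NA.tensor_closed)
    then have "tensor B N A\<^sub>l u (i (k (f u))) = tensor B N A\<^sub>l u t"
      using pure_eq[OF fu, of "\<one>\<^bsub>A\<^esub>"] k[OF fu] u tA
      by (simp add: \<phi>_pure i_closed) (simp add: u_def kj ring_hom_one[OF i_ring_hom])
    then have "i (k (f u)) = t"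
      using u_inj k[OF fu] tA by (simp add: i_closed)
    then show ?thesis using k[OF fu] by blast
  qed
  moreover have "i b \<in> carrier (coinvariants G A C x)" if "b \<in> carrier B" for b
    using i_hom that by (rule ring_hom_closed)
  ultimately have "bij_betw i (carrier B) (carrier (coinvariants G A C x))"
    using inj unfolding bij_betw_def by blast
  then show ?thesis using i_hom by (simp add: ring_iso_def)
qed

end

section \<open>The counit of the adjunction: fully faithful coinvariants\<close>

lemma left_linear_inverse:
  assumes M: "left_module L M" and f: "left_linear L M N f"
    and k: "\<And>n. n \<in> carrier N \<Longrightarrow> k n \<in> carrier M" "\<And>n. n \<in> carrier N \<Longrightarrow> f (k n) = n"
      "\<And>m. m \<in> carrier M \<Longrightarrow> k (f m) = m"
  shows "left_linear L N M k"
proof -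
  interpret M: left_module L M by fact
  have "k (n \<oplus>\<^bsub>N\<^esub> n') = k n \<oplus>\<^bsub>M\<^esub> k n'" if "n \<in> carrier N" "n' \<in> carrier N" for n n'
    using k(3)[of "k n \<oplus>\<^bsub>M\<^esub> k n'"] that by (simp add: k left_linear_add[OF f])
  moreover have "k (l \<triangleright>\<^bsub>N\<^esub> n) = l \<triangleright>\<^bsub>M\<^esub> k n" if "n \<in> carrier N" "l \<in> carrier L" for n l
    using k(3)[of "l \<triangleright>\<^bsub>M\<^esub> k n"] that by (simp add: k left_linear_lact[OF f] M.lact_closed)
  ultimately show ?thesis by (simp add: left_linear_def additive_map_def k)
qed

text \<open>If \<open>c = f(d)\<close>, then \<open>(k \<otimes> k)(\<Delta>(f(d))) = (k \<otimes> k)((f \<otimes> f)(\<Delta>(d))) = \<Delta>(d)\<close>: the inverse of a bijective morphism is again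
  compatible with comultiplication and counit.\<close>

lemma coring_isoI:
  fixes C :: "('g, 'a, 'c, 'x) coring_scheme" and D :: "('g, 'a, 'd, 'y) coring_scheme"
  assumes G: "group G"
    and D: "\<And>\<alpha>. \<alpha> \<in> carrier G \<Longrightarrow> bimodule A A (cpart D \<alpha>)"
    and C: "\<And>\<alpha>. \<alpha> \<in> carrier G \<Longrightarrow> bimodule A A (cpart C \<alpha>)"
    and \<Delta>: "\<And>\<alpha> \<beta> d. \<alpha> \<in> carrier G \<Longrightarrow> \<beta> \<in> carrier G \<Longrightarrow> d \<in> carrier (cpart D (\<alpha> \<otimes>\<^bsub>G\<^esub> \<beta>)) \<Longrightarrow>
      comult D \<alpha> \<beta> d \<in> carrier (tensor_group A (cpart D \<alpha>) (cpart D \<beta>))"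
    and f: "f \<in> coring_hom G A D C"
    and k: "\<And>\<alpha> c. \<alpha> \<in> carrier G \<Longrightarrow> c \<in> carrier (cpart C \<alpha>) \<Longrightarrow> k \<alpha> c \<in> carrier (cpart D \<alpha>)"
      "\<And>\<alpha> c. \<alpha> \<in> carrier G \<Longrightarrow> c \<in> carrier (cpart C \<alpha>) \<Longrightarrow> f \<alpha> (k \<alpha> c) = c"
      "\<And>\<alpha> d. \<alpha> \<in> carrier G \<Longrightarrow> d \<in> carrier (cpart D \<alpha>) \<Longrightarrow> k \<alpha> (f \<alpha> d) = d"
  shows "f \<in> coring_iso G A D C"
proof -
  interpret G: group G by fact
  have f_hom: "f \<alpha> \<in> bimod_hom A A (cpart D \<alpha>) (cpart C \<alpha>)" if "\<alpha> \<in> carrier G" for \<alpha>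
    using f that by (auto simp: coring_hom_def)
  have f_right: "right_linear A (cpart D \<alpha>) (cpart C \<alpha>) (f \<alpha>)"
    and f_left: "left_linear A (cpart D \<alpha>) (cpart C \<alpha>) (f \<alpha>)" if "\<alpha> \<in> carrier G" for \<alpha>
    using f_hom[OF that] by (simp_all add: bimod_hom_iff)
  define h where "h = (\<lambda>\<alpha>\<in>carrier G. restrict (k \<alpha>) (carrier (cpart C \<alpha>)))"
  have h: "h \<alpha> c = k \<alpha> c" if "\<alpha> \<in> carrier G" "c \<in> carrier (cpart C \<alpha>)" for \<alpha> c
    using that by (simp add: h_def)
  have h_right: "right_linear A (cpart C \<alpha>) (cpart D \<alpha>) (h \<alpha>)" if "\<alpha> \<in> carrier G" for \<alpha>
    by (rule right_linear_inverse[OF bimodule_right[OF D] f_right])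
       (simp_all add: that k h right_linear_closed[OF f_right])
  have h_left: "left_linear A (cpart C \<alpha>) (cpart D \<alpha>) (h \<alpha>)" if "\<alpha> \<in> carrier G" for \<alpha>
    by (rule left_linear_inverse[OF bimodule_left[OF D] f_left])
       (simp_all add: that k h right_linear_closed[OF f_right])
  have DD: "tensor_product A (cpart D \<alpha>) (cpart D \<beta>)" if "\<alpha> \<in> carrier G" "\<beta> \<in> carrier G" for \<alpha> \<beta>
    by (rule tensor_product_bimod[OF bimodule_right[OF D[OF that(1)]] D[OF that(2)]])
  have CC: "tensor_product A (cpart C \<alpha>) (cpart C \<beta>)" if "\<alpha> \<in> carrier G" "\<beta> \<in> carrier G" for \<alpha> \<beta>
    by (rule tensor_product_bimod[OF bimodule_right[OF C[OF that(1)]] C[OF that(2)]])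
  have comult: "tensor_map A (cpart C \<alpha>) (cpart C \<beta>) (cpart D \<alpha>) (cpart D \<beta>) (h \<alpha>) (h \<beta>) (comult C \<alpha> \<beta> c)
      = comult D \<alpha> \<beta> (h (\<alpha> \<otimes>\<^bsub>G\<^esub> \<beta>) c)"
    if \<alpha>: "\<alpha> \<in> carrier G" and \<beta>: "\<beta> \<in> carrier G" and c: "c \<in> carrier (cpart C (\<alpha> \<otimes>\<^bsub>G\<^esub> \<beta>))" for \<alpha> \<beta> c
  proof -
    have \<alpha>\<beta>: "\<alpha> \<otimes>\<^bsub>G\<^esub> \<beta> \<in> carrier G" using \<alpha> \<beta> by simp
    define d where "d = k (\<alpha> \<otimes>\<^bsub>G\<^esub> \<beta>) c"
    have d: "d \<in> carrier (cpart D (\<alpha> \<otimes>\<^bsub>G\<^esub> \<beta>))" and c_eq: "c = f (\<alpha> \<otimes>\<^bsub>G\<^esub> \<beta>) d"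
      using k(1,2)[OF \<alpha>\<beta> c] by (simp_all add: d_def)
    have "comult C \<alpha> \<beta> c
      = tensor_map A (cpart D \<alpha>) (cpart D \<beta>) (cpart C \<alpha>) (cpart C \<beta>) (f \<alpha>) (f \<beta>) (comult D \<alpha> \<beta> d)"
      using f \<alpha> \<beta> d by (simp add: coring_hom_def c_eq)
    then have "tensor_map A (cpart C \<alpha>) (cpart C \<beta>) (cpart D \<alpha>) (cpart D \<beta>) (h \<alpha>) (h \<beta>) (comult C \<alpha> \<beta> c)
      = tensor_map A (cpart D \<alpha>) (cpart D \<beta>) (cpart D \<alpha>) (cpart D \<beta>) (\<lambda>d. d) (\<lambda>d. d) (comult D \<alpha> \<beta> d)"
      by (simp only:) (rule tensor_map_comp[OF DD[OF \<alpha> \<beta>] CC[OF \<alpha> \<beta>] f_right[OF \<alpha>] f_left[OF \<beta>]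
            DD[OF \<alpha> \<beta>] h_right[OF \<alpha>] h_left[OF \<beta>] right_linear_id left_linear_id _ _ \<Delta>[OF \<alpha> \<beta> d]],
          simp_all add: \<alpha> \<beta> h k right_linear_closed[OF f_right])
    also have "\<dots> = comult D \<alpha> \<beta> d" by (rule tensor_map_ident[OF DD[OF \<alpha> \<beta>] \<Delta>[OF \<alpha> \<beta> d]])
    finally show ?thesis by (simp add: h[OF \<alpha>\<beta> c] d_def)
  qed
  have e: "\<one>\<^bsub>G\<^esub> \<in> carrier G" by simp
  have counit: "counit D (h \<one>\<^bsub>G\<^esub> c) = counit C c" if c: "c \<in> carrier (cpart C \<one>\<^bsub>G\<^esub>)" for c
  proof -
    have "\<forall>d\<in>carrier (cpart D \<one>\<^bsub>G\<^esub>). counit C (f \<one>\<^bsub>G\<^esub> d) = counit D d"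
      using f by (simp add: coring_hom_def)
    then show ?thesis using k(1,2)[OF e c] h[OF e c] by metis
  qed
  have "h \<in> coring_hom G A C D"
    using comult counit h_right h_left
    by (auto simp: coring_hom_def bimod_hom_iff h_def)
  moreover have "\<forall>\<alpha>\<in>carrier G. (\<forall>c\<in>carrier (cpart D \<alpha>). h \<alpha> (f \<alpha> c) = c) \<and> (\<forall>d\<in>carrier (cpart C \<alpha>). f \<alpha> (h \<alpha> d) = d)"
    by (simp add: h k right_linear_closed[OF f_right])
  ultimately show ?thesis using f by (auto simp: coring_iso_def)
qed

context grouplike_coring
begin

abbreviation AA where "AA \<equiv> tensor_group B A\<^sub>r A\<^sub>l"
abbreviation D where "D \<equiv> tensor_bimod B A\<^sub>r A\<^sub>l"
abbreviation pure (infix "\<otimes>\<^sub>B" 70) where "a \<otimes>\<^sub>B b \<equiv> tensor B A\<^sub>r A\<^sub>l a b"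
abbreviation can\<^sub>x where "can\<^sub>x \<equiv> can G A B C x i"

lemma AA_tensor: "tensor_product B A\<^sub>r A\<^sub>l"
  by (rule tensor_product_bimod[OF bimodule_right[OF bimodule_A\<^sub>r] bimodule_A\<^sub>l])

lemma AA_tensor_bimodule: "tensor_product_bimodule A B A\<^sub>r A\<^sub>l"
  by (intro tensor_product_bimodule.intro bimodule_A\<^sub>r AA_tensor)

lemmas AA_pure_closed = tensor_product.tensor_closed[OF AA_tensor, simplified]
  and AA_pure_add_left = tensor_product.tensor_add_left[OF AA_tensor, simplified]
  and AA_pure_add_right = tensor_product.tensor_add_right[OF AA_tensor, simplified]
  and AA_pure_balanced = tensor_product.tensor_balanced[OF AA_tensor, simplified]
  and AA_ract_pure = tensor_product.tensor_ract_pure[OF AA_tensor bimodule_A\<^sub>l, simplified]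
  and AA_lact_pure = tensor_product_bimodule.tensor_lact_pure[OF AA_tensor_bimodule, simplified]
  and AA_ract_additive = tensor_product.tensor_ract_additive[OF AA_tensor bimodule_A\<^sub>l]
  and AA_lact_additive = tensor_product_bimodule.tensor_lact_additive[OF AA_tensor_bimodule]
  and AA_eqI = tensor_product.tensor_eqI[OF AA_tensor, simplified]

lemma D_bimodule: "bimodule A A D"
  by (rule tensor_bimod_bimodule[OF bimodule_A\<^sub>r bimodule_A\<^sub>l])

text \<open>Again because \<open>i(b)\<close> commutes with \<open>x\<^sub>\<alpha>\<close>.\<close>

lemma can_balanced:
  assumes \<alpha>: "\<alpha> \<in> carrier G"
  shows "balanced_map B A\<^sub>r A\<^sub>l (cpart C \<alpha>) (\<lambda>a b. (a \<triangleright>\<^bsub>cpart C \<alpha>\<^esub> x \<alpha>) \<triangleleft>\<^bsub>cpart C \<alpha>\<^esub> b)"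
proof -
  interpret C\<alpha>: bimodule A A "cpart C \<alpha>" by (rule cpart_bimodule[OF \<alpha>])
  show ?thesis
    by (simp add: balanced_map_def C\<alpha>.lact_closed C\<alpha>.ract_closed x_closed[OF \<alpha>] C\<alpha>.lact_add_left C\<alpha>.ract_add_left
        C\<alpha>.ract_add_right C\<alpha>.lact_mult i_closed i_x \<alpha> C\<alpha>.ract_mult C\<alpha>.lact_ract)
qed

lemma can_properties:
  assumes \<alpha>: "\<alpha> \<in> carrier G"
  shows can_extensional: "can\<^sub>x \<alpha> \<in> extensional (carrier AA)"
    and can_additive: "additive_map AA (cpart C \<alpha>) (can\<^sub>x \<alpha>)"
    and can_pure: "a \<in> carrier A \<Longrightarrow> b \<in> carrier A \<Longrightarrow>
      can\<^sub>x \<alpha> (a \<otimes>\<^sub>B b) = (a \<triangleright>\<^bsub>cpart C \<alpha>\<^esub> x \<alpha>) \<triangleleft>\<^bsub>cpart C \<alpha>\<^esub> b"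
proof -
  interpret C\<alpha>: bimodule A A "cpart C \<alpha>" by (rule cpart_bimodule[OF \<alpha>])
  show "can\<^sub>x \<alpha> \<in> extensional (carrier AA)" "additive_map AA (cpart C \<alpha>) (can\<^sub>x \<alpha>)"
    "a \<in> carrier A \<Longrightarrow> b \<in> carrier A \<Longrightarrow> can\<^sub>x \<alpha> (a \<otimes>\<^sub>B b) = (a \<triangleright>\<^bsub>cpart C \<alpha>\<^esub> x \<alpha>) \<triangleleft>\<^bsub>cpart C \<alpha>\<^esub> b"
    using tensor_product.tensor_lift_properties[OF AA_tensor C\<alpha>.M.abelian_group_axioms can_balanced[OF \<alpha>]] \<alpha>
    by (simp_all add: can_def)
qed

lemma can_right_linear:
  assumes \<alpha>: "\<alpha> \<in> carrier G"
  shows "right_linear A (tensor_rmod B A\<^sub>r A\<^sub>l) (cpart C \<alpha>) (can\<^sub>x \<alpha>)"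
proof -
  interpret C\<alpha>: bimodule A A "cpart C \<alpha>" by (rule cpart_bimodule[OF \<alpha>])
  have ract_additive: "additive_map (cpart C \<alpha>) (cpart C \<alpha>) (\<lambda>c. c \<triangleleft>\<^bsub>cpart C \<alpha>\<^esub> r)" if "r \<in> carrier A" for r
    using that by (simp add: additive_map_def C\<alpha>.ract_closed C\<alpha>.ract_add_left)
  have "can\<^sub>x \<alpha> (tensor_ract B A\<^sub>r A\<^sub>l t r) = can\<^sub>x \<alpha> t \<triangleleft>\<^bsub>cpart C \<alpha>\<^esub> r" if "t \<in> carrier AA" and r: "r \<in> carrier A" for t r
    by (rule AA_eqI[OF additive_map_comp[OF AA_ract_additive[OF r] can_additive[OF \<alpha>]]
          additive_map_comp[OF can_additive[OF \<alpha>] ract_additive[OF r]] _ that(1)])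
       (simp add: AA_ract_pure can_pure[OF \<alpha>] r C\<alpha>.ract_mult C\<alpha>.lact_closed x_closed \<alpha>)
  then show ?thesis using can_additive[OF \<alpha>] by (simp add: right_linear_def)
qed

lemma can_left_linear:
  assumes \<alpha>: "\<alpha> \<in> carrier G"
  shows "left_linear A D (cpart C \<alpha>) (can\<^sub>x \<alpha>)"
proof -
  interpret C\<alpha>: bimodule A A "cpart C \<alpha>" by (rule cpart_bimodule[OF \<alpha>])
  have lact_additive: "additive_map (cpart C \<alpha>) (cpart C \<alpha>) (\<lambda>c. l \<triangleright>\<^bsub>cpart C \<alpha>\<^esub> c)" if "l \<in> carrier A" for l
    using that by (simp add: additive_map_def C\<alpha>.lact_closed C\<alpha>.lact_add_right)
  have "can\<^sub>x \<alpha> (tensor_lact B A\<^sub>r A\<^sub>l l t) = l \<triangleright>\<^bsub>cpart C \<alpha>\<^esub> can\<^sub>x \<alpha> t" if "t \<in> carrier AA" and l: "l \<in> carrier A" for t l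
    by (rule AA_eqI[OF additive_map_comp[OF AA_lact_additive[OF l] can_additive[OF \<alpha>]]
          additive_map_comp[OF can_additive[OF \<alpha>] lact_additive[OF l]] _ that(1)])
       (simp add: AA_lact_pure can_pure[OF \<alpha>] l C\<alpha>.lact_mult C\<alpha>.lact_ract C\<alpha>.lact_closed x_closed \<alpha>)
  then show ?thesis using can_additive[OF \<alpha>] by (simp add: left_linear_def)
qed

text \<open>On the elements \<open>a x\<^sub>\<alpha> b\<close>, which generate the image of \<open>can\<close>, the structure maps of \<open>C\<close> are determined by \<open>x\<close>
  being grouplike and by bilinearity.\<close>

lemma comult_axb:
  assumes \<alpha>: "\<alpha> \<in> carrier G" and \<beta>: "\<beta> \<in> carrier G" and a: "a \<in> carrier A" and b: "b \<in> carrier A"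
  shows "comult C \<alpha> \<beta> ((a \<triangleright>\<^bsub>cpart C (\<alpha> \<otimes>\<^bsub>G\<^esub> \<beta>)\<^esub> x (\<alpha> \<otimes>\<^bsub>G\<^esub> \<beta>)) \<triangleleft>\<^bsub>cpart C (\<alpha> \<otimes>\<^bsub>G\<^esub> \<beta>)\<^esub> b)
    = tensor A (cpart C \<alpha>) (cpart C \<beta>) (a \<triangleright>\<^bsub>cpart C \<alpha>\<^esub> x \<alpha>) (x \<beta> \<triangleleft>\<^bsub>cpart C \<beta>\<^esub> b)"
proof -
  have \<alpha>\<beta>: "\<alpha> \<otimes>\<^bsub>G\<^esub> \<beta> \<in> carrier G" using \<alpha> \<beta> by simp
  interpret C\<alpha>: bimodule A A "cpart C \<alpha>" by (rule cpart_bimodule[OF \<alpha>])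
  interpret C\<beta>: bimodule A A "cpart C \<beta>" by (rule cpart_bimodule[OF \<beta>])
  interpret C\<alpha>\<beta>: bimodule A A "cpart C (\<alpha> \<otimes>\<^bsub>G\<^esub> \<beta>)" by (rule cpart_bimodule[OF \<alpha>\<beta>])
  interpret CC: tensor_product_bimodule A A "cpart C \<alpha>" "cpart C \<beta>"
    by (intro tensor_product_bimodule.intro C\<alpha>.bimodule_axioms
        tensor_product_bimod[OF C\<alpha>.right_module_axioms C\<beta>.bimodule_axioms])
  have \<Delta>: "right_linear A (cpart C (\<alpha> \<otimes>\<^bsub>G\<^esub> \<beta>)) (tensor_rmod A (cpart C \<alpha>) (cpart C \<beta>)) (comult C \<alpha> \<beta>)"
    "left_linear A (cpart C (\<alpha> \<otimes>\<^bsub>G\<^esub> \<beta>)) (tensor_bimod A (cpart C \<alpha>) (cpart C \<beta>)) (comult C \<alpha> \<beta>)"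
    using comult_hom[OF \<alpha> \<beta>] by (simp_all add: bimod_hom_iff)
  show ?thesis
    using a b \<alpha> \<beta>
    by (simp add: right_linear_ract[OF \<Delta>(1)] left_linear_lact[OF \<Delta>(2)] x_closed C\<alpha>\<beta>.lact_closed comult_x
        CC.tensor_lact_pure CC.tensor_ract_pure[OF C\<beta>.bimodule_axioms] C\<alpha>.lact_closed)
qed

lemma counit_axb:
  assumes "a \<in> carrier A" "b \<in> carrier A"
  shows "counit C ((a \<triangleright>\<^bsub>cpart C \<one>\<^bsub>G\<^esub>\<^esub> x \<one>\<^bsub>G\<^esub>) \<triangleleft>\<^bsub>cpart C \<one>\<^bsub>G\<^esub>\<^esub> b) = a \<otimes>\<^bsub>A\<^esub> b"
proof -
  interpret Ce: bimodule A A "cpart C \<one>\<^bsub>G\<^esub>" by (rule cpart_bimodule) simp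
  have \<epsilon>: "right_linear A (cpart C \<one>\<^bsub>G\<^esub>) (regular_bimod A) (counit C)"
    "left_linear A (cpart C \<one>\<^bsub>G\<^esub>) (regular_bimod A) (counit C)"
    using counit_hom by (simp_all add: bimod_hom_iff)
  show ?thesis
    using assms by (simp add: right_linear_ract[OF \<epsilon>(1)] left_linear_lact[OF \<epsilon>(2)] x_closed Ce.lact_closed counit_x)
qed

lemma canonical_coring_simps:
  "cpart (canonical_coring A B i) \<alpha> = D"
  "comult (canonical_coring A B i) \<alpha> \<beta>
    = tensor_lift B A\<^sub>r A\<^sub>l (tensor_group A D D) (\<lambda>a b. tensor A D D (a \<otimes>\<^sub>B \<one>\<^bsub>A\<^esub>) (\<one>\<^bsub>A\<^esub> \<otimes>\<^sub>B b))"
  "counit (canonical_coring A B i) = tensor_lift B A\<^sub>r A\<^sub>l A (\<lambda>a b. a \<otimes>\<^bsub>A\<^esub> b)"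
  by (simp_all add: canonical_coring_def Let_def)

lemma DD_tensor: "tensor_product A D D"
  by (rule tensor_product_bimod[OF bimodule_right[OF D_bimodule] D_bimodule])

text \<open>A scalar \<open>r\<close> from \<open>B\<close> passes through the two inner factors:
  \<open>(a i(r) \<otimes> 1) \<otimes> (1 \<otimes> b) = (a \<otimes> 1) i(r) \<otimes> (1 \<otimes> b) = (a \<otimes> 1) \<otimes> i(r) (1 \<otimes> b) = (a \<otimes> 1) \<otimes> (1 \<otimes> i(r) b)\<close>.\<close>

lemma canonical_comult_balanced:
  "balanced_map B A\<^sub>r A\<^sub>l (tensor_group A D D) (\<lambda>a b. tensor A D D (a \<otimes>\<^sub>B \<one>\<^bsub>A\<^esub>) (\<one>\<^bsub>A\<^esub> \<otimes>\<^sub>B b))"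
proof -
  interpret DD: tensor_product A D D by (rule DD_tensor)
  have "tensor A D D ((a \<otimes>\<^bsub>A\<^esub> i r) \<otimes>\<^sub>B \<one>\<^bsub>A\<^esub>) (\<one>\<^bsub>A\<^esub> \<otimes>\<^sub>B b) = tensor A D D (a \<otimes>\<^sub>B \<one>\<^bsub>A\<^esub>) (\<one>\<^bsub>A\<^esub> \<otimes>\<^sub>B (i r \<otimes>\<^bsub>A\<^esub> b))"
    if a: "a \<in> carrier A" and r: "r \<in> carrier B" and b: "b \<in> carrier A" for a r b
  proof -
    have ir: "i r \<in> carrier A" using r by (rule i_closed)
    have "(a \<otimes>\<^bsub>A\<^esub> i r) \<otimes>\<^sub>B \<one>\<^bsub>A\<^esub> = tensor_ract B A\<^sub>r A\<^sub>l (a \<otimes>\<^sub>B \<one>\<^bsub>A\<^esub>) (i r)"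
      using AA_pure_balanced[of a r "\<one>\<^bsub>A\<^esub>"] a r ir by (simp add: AA_ract_pure)
    moreover have "\<one>\<^bsub>A\<^esub> \<otimes>\<^sub>B (i r \<otimes>\<^bsub>A\<^esub> b) = tensor_lact B A\<^sub>r A\<^sub>l (i r) (\<one>\<^bsub>A\<^esub> \<otimes>\<^sub>B b)"
      using AA_pure_balanced[of "\<one>\<^bsub>A\<^esub>" r b] b r ir by (simp add: AA_lact_pure)
    ultimately show ?thesis
      using DD.tensor_balanced[of "a \<otimes>\<^sub>B \<one>\<^bsub>A\<^esub>" "i r" "\<one>\<^bsub>A\<^esub> \<otimes>\<^sub>B b"] a b ir by (simp add: AA_pure_closed)
  qed
  then show ?thesis
    by (simp add: balanced_map_def DD.tensor_closed AA_pure_closed AA_pure_add_left AA_pure_add_right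
        DD.tensor_add_left[simplified] DD.tensor_add_right[simplified])
qed

lemma canonical_comult_additive:
  "additive_map AA (tensor_group A D D) (comult (canonical_coring A B i) \<alpha> \<beta>)"
  unfolding canonical_coring_simps
  by (rule tensor_product.tensor_lift_additive[OF AA_tensor
        tensor_product.abelian_tensor_group[OF DD_tensor] canonical_comult_balanced])

lemma canonical_comult_pure:
  assumes "a \<in> carrier A" "b \<in> carrier A"
  shows "comult (canonical_coring A B i) \<alpha> \<beta> (a \<otimes>\<^sub>B b) = tensor A D D (a \<otimes>\<^sub>B \<one>\<^bsub>A\<^esub>) (\<one>\<^bsub>A\<^esub> \<otimes>\<^sub>B b)"
  unfolding canonical_coring_simps using assms
  by (intro tensor_product.tensor_lift_pure[OF AA_tensor
        tensor_product.abelian_tensor_group[OF DD_tensor] canonical_comult_balanced]) simp_all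

lemma canonical_counit_balanced: "balanced_map B A\<^sub>r A\<^sub>l A (\<lambda>a b. a \<otimes>\<^bsub>A\<^esub> b)"
  by (simp add: balanced_map_def A.l_distr A.r_distr A.m_assoc i_closed)

lemma canonical_counit_additive: "additive_map AA A (counit (canonical_coring A B i))"
  unfolding canonical_coring_simps
  by (rule tensor_product.tensor_lift_additive[OF AA_tensor A.abelian_group_axioms canonical_counit_balanced])

lemma canonical_counit_pure:
  assumes "a \<in> carrier A" "b \<in> carrier A"
  shows "counit (canonical_coring A B i) (a \<otimes>\<^sub>B b) = a \<otimes>\<^bsub>A\<^esub> b"
  unfolding canonical_coring_simps using assms
  by (intro tensor_product.tensor_lift_pure[OF AA_tensor A.abelian_group_axioms canonical_counit_balanced]) simp_all

lemma can_coring_hom: "can\<^sub>x \<in> coring_hom G A (canonical_coring A B i) C"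
proof -
  have bimod: "can\<^sub>x \<alpha> \<in> bimod_hom A A D (cpart C \<alpha>)" if "\<alpha> \<in> carrier G" for \<alpha>
    using can_extensional[OF that] can_right_linear[OF that] can_left_linear[OF that] by (simp add: bimod_hom_iff)
  have comult: "tensor_map A D D (cpart C \<alpha>) (cpart C \<beta>) (can\<^sub>x \<alpha>) (can\<^sub>x \<beta>) (comult (canonical_coring A B i) \<alpha> \<beta> t)
      = comult C \<alpha> \<beta> (can\<^sub>x (\<alpha> \<otimes>\<^bsub>G\<^esub> \<beta>) t)"
    if \<alpha>: "\<alpha> \<in> carrier G" and \<beta>: "\<beta> \<in> carrier G" and t: "t \<in> carrier AA" for \<alpha> \<beta> t
  proof -
    have \<alpha>\<beta>: "\<alpha> \<otimes>\<^bsub>G\<^esub> \<beta> \<in> carrier G" using \<alpha> \<beta> by simp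
    interpret C\<alpha>: bimodule A A "cpart C \<alpha>" by (rule cpart_bimodule[OF \<alpha>])
    interpret C\<beta>: bimodule A A "cpart C \<beta>" by (rule cpart_bimodule[OF \<beta>])
    have "right_linear A D (cpart C \<alpha>) (can\<^sub>x \<alpha>)" using can_right_linear[OF \<alpha>] by simp
    note cc = DD_tensor tensor_product_bimod[OF C\<alpha>.right_module_axioms C\<beta>.bimodule_axioms] this can_left_linear[OF \<beta>]
    have \<Delta>: "additive_map (cpart C (\<alpha> \<otimes>\<^bsub>G\<^esub> \<beta>)) (tensor_group A (cpart C \<alpha>) (cpart C \<beta>)) (comult C \<alpha> \<beta>)"
      using comult_hom[OF \<alpha> \<beta>] by (auto simp: bimod_hom_iff dest: right_linear_additive)
    show ?thesis
      by (rule AA_eqI[OF additive_map_comp[OF canonical_comult_additive tensor_map_additive[OF cc]]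
            additive_map_comp[OF can_additive[OF \<alpha>\<beta>] \<Delta>] _ t])
         (simp add: canonical_comult_pure tensor_map_pure[OF cc] AA_pure_closed can_pure \<alpha> \<beta> comult_axb
            C\<alpha>.ract_one C\<alpha>.lact_closed C\<beta>.lact_one x_closed)
  qed
  have counit: "counit C (can\<^sub>x \<one>\<^bsub>G\<^esub> t) = counit (canonical_coring A B i) t" if t: "t \<in> carrier AA" for t
  proof -
    have e: "\<one>\<^bsub>G\<^esub> \<in> carrier G" by simp
    have \<epsilon>: "additive_map (cpart C \<one>\<^bsub>G\<^esub>) A (counit C)"
      using right_linear_additive[of A "cpart C \<one>\<^bsub>G\<^esub>" "regular_bimod A" "counit C"] counit_hom
      by (simp add: bimod_hom_iff additive_map_def)
    show ?thesis
      by (rule AA_eqI[OF additive_map_comp[OF can_additive[OF e] \<epsilon>] canonical_counit_additive _ t])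
         (simp add: can_pure counit_axb canonical_counit_pure)
  qed
  show ?thesis
    using bimod comult counit by (auto simp: coring_hom_def canonical_coring_simps(1) can_def)
qed

text \<open>With \<open>A\<^sub>B\<close>, the right \<open>B\<close>-module \<open>A\<close>, the comodule \<open>F\<^sub>7(A\<^sub>B)\<close> has the parts of \<open>(A \<otimes>\<^sub>B A)\<langle>G\<rangle>\<close>, and \<open>can\<close> is the counit of the
  adjunction between \<open>F\<^sub>7\<close> and \<open>G\<^sub>7\<close> at the comodule \<open>C\<close>.\<close>

abbreviation A\<^sub>B where "A\<^sub>B \<equiv> rmod.truncate A\<^sub>r"

lemma A_induced: "induced_comodule G A C B x i A\<^sub>B"
  by (intro induced_comodule.intro grouplike_coring_axioms right_module_truncate bimodule_right[OF bimodule_A\<^sub>r])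

lemmas D_comodule = induced_comodule.F7_comodule[OF A_induced]

lemma D_coact_pure:
  "\<beta> \<in> carrier G \<Longrightarrow> a \<in> carrier A \<Longrightarrow> b \<in> carrier A \<Longrightarrow>
    coact (F7 A B C x i A\<^sub>B) \<alpha> \<beta> (a \<otimes>\<^sub>B b)
      = tensor A (tensor_rmod B A\<^sub>r A\<^sub>l) (cpart C \<beta>) (a \<otimes>\<^sub>B \<one>\<^bsub>A\<^esub>) (x \<beta> \<triangleleft>\<^bsub>cpart C \<beta>\<^esub> b)"
  using induced_comodule.coact_pure[OF A_induced, of \<beta> a b \<alpha>] by (simp del: F7_simps(2))

lemma can_comod_hom:
  "(\<lambda>\<alpha>\<in>carrier G. restrict (can\<^sub>x \<alpha>) (carrier (mpart (F7 A B C x i A\<^sub>B) \<alpha>)))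
    \<in> comod_hom G A C (F7 A B C x i A\<^sub>B) (regular_comod C)"
proof (rule comod_homI[OF D_comodule regular_comodule])
  fix \<alpha> assume "\<alpha> \<in> carrier G"
  then show "right_linear A (mpart (F7 A B C x i A\<^sub>B) \<alpha>) (mpart (regular_comod C) \<alpha>) (can\<^sub>x \<alpha>)"
    using can_right_linear by simp
next
  fix \<alpha> \<beta> t assume \<alpha>: "\<alpha> \<in> carrier G" and \<beta>: "\<beta> \<in> carrier G"
    and "t \<in> carrier (mpart (F7 A B C x i A\<^sub>B) (\<alpha> \<otimes>\<^bsub>G\<^esub> \<beta>))"
  then have t: "t \<in> carrier AA" and \<alpha>\<beta>: "\<alpha> \<otimes>\<^bsub>G\<^esub> \<beta> \<in> carrier G" by simp_all
  let ?\<rho> = "coact (F7 A B C x i A\<^sub>B) \<alpha> \<beta>" and ?T = "tensor_rmod B A\<^sub>r A\<^sub>l"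
  interpret C\<alpha>: bimodule A A "cpart C \<alpha>" by (rule cpart_bimodule[OF \<alpha>])
  interpret C\<beta>: bimodule A A "cpart C \<beta>" by (rule cpart_bimodule[OF \<beta>])
  have \<rho>: "additive_map AA (tensor_group A ?T (cpart C \<beta>)) ?\<rho>"
    using induced_comodule.coact_additive[OF A_induced \<beta>, of \<alpha>] by (simp del: F7_simps(2))
  have \<Delta>: "additive_map (cpart C (\<alpha> \<otimes>\<^bsub>G\<^esub> \<beta>)) (tensor_group A (cpart C \<alpha>) (cpart C \<beta>)) (comult C \<alpha> \<beta>)"
    using comult_hom[OF \<alpha> \<beta>] by (auto simp: bimod_hom_iff dest: right_linear_additive)
  have TC: "tensor_product A ?T (cpart C \<beta>)"
    using induced_comodule.TC[OF A_induced \<beta>] by simp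
  note can_id = TC tensor_product_bimod[OF C\<alpha>.right_module_axioms C\<beta>.bimodule_axioms] can_right_linear[OF \<alpha>] left_linear_id
  have "tensor_map A ?T (cpart C \<beta>) (cpart C \<alpha>) (cpart C \<beta>) (can\<^sub>x \<alpha>) (\<lambda>d. d) (?\<rho> t)
      = comult C \<alpha> \<beta> (can\<^sub>x (\<alpha> \<otimes>\<^bsub>G\<^esub> \<beta>) t)"
    by (rule AA_eqI[OF additive_map_comp[OF \<rho> tensor_map_additive[OF can_id]]
          additive_map_comp[OF can_additive[OF \<alpha>\<beta>] \<Delta>] _ t])
       (simp add: D_coact_pure \<beta> tensor_map_pure[OF can_id] AA_pure_closed C\<beta>.ract_closed x_closed can_pure \<alpha>
          comult_axb C\<alpha>.ract_one C\<alpha>.lact_closed del: F7_simps)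
  then show "tensor_map A (mpart (F7 A B C x i A\<^sub>B) \<alpha>) (cpart C \<beta>) (mpart (regular_comod C) \<alpha>) (cpart C \<beta>)
      (can\<^sub>x \<alpha>) (\<lambda>d. d) (?\<rho> t) = coact (regular_comod C) \<alpha> \<beta> (can\<^sub>x (\<alpha> \<otimes>\<^bsub>G\<^esub> \<beta>) t)"
    by (simp del: F7_simps(2))
qed

text \<open>A family \<open>c\<close> in \<open>G\<^sub>7(C)\<close> satisfies \<open>\<Delta>\<^sub>e\<^sub>,\<^sub>\<alpha>(c\<^sub>\<alpha>) = c\<^sub>e \<otimes> x\<^sub>\<alpha>\<close>; the counit law turns this into the claim.\<close>

lemma regular_coinvariant_eq:
  assumes c: "c \<in> carrier (G\<^sub>7 (regular_comod C))" and \<alpha>: "\<alpha> \<in> carrier G"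
  shows "c \<alpha> = counit C (c \<one>\<^bsub>G\<^esub>) \<triangleright>\<^bsub>cpart C \<alpha>\<^esub> x \<alpha>"
proof -
  have e: "\<one>\<^bsub>G\<^esub> \<in> carrier G" by simp
  have ce: "c \<one>\<^bsub>G\<^esub> \<in> carrier (cpart C \<one>\<^bsub>G\<^esub>)" and c\<alpha>: "c \<alpha> \<in> carrier (cpart C \<alpha>)"
    using G7_component[OF c] \<alpha> by simp_all
  have \<epsilon>: "right_linear A (cpart C \<one>\<^bsub>G\<^esub>) (regular_bimod A) (counit C)"
    using counit_hom by (simp add: bimod_hom_iff)
  have \<Delta>c: "comult C \<one>\<^bsub>G\<^esub> \<alpha> (c \<alpha>) = tensor A (cpart C \<one>\<^bsub>G\<^esub>) (cpart C \<alpha>) (c \<one>\<^bsub>G\<^esub>) (x \<alpha>)"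
  proof -
    have "coact (regular_comod C) \<one>\<^bsub>G\<^esub> \<alpha> (c (\<one>\<^bsub>G\<^esub> \<otimes>\<^bsub>G\<^esub> \<alpha>))
      = tensor A (mpart (regular_comod C) \<one>\<^bsub>G\<^esub>) (cpart C \<alpha>) (c \<one>\<^bsub>G\<^esub>) (x \<alpha>)"
      using c e \<alpha> unfolding G7_carrier_iff by blast
    then show ?thesis using \<alpha> by simp
  qed
  have "tensor_map A (cpart C \<one>\<^bsub>G\<^esub>) (cpart C \<alpha>) (regular_bimod A) (cpart C \<alpha>) (counit C) (\<lambda>d. d)
      (comult C \<one>\<^bsub>G\<^esub> \<alpha> (c \<alpha>)) = tensor A (regular_bimod A) (cpart C \<alpha>) (counit C (c \<one>\<^bsub>G\<^esub>)) (x \<alpha>)"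
    unfolding \<Delta>c
    by (rule tensor_map_pure[OF tensor_product_bimod[OF bimodule_right[OF cpart_bimodule[OF e]] cpart_bimodule[OF \<alpha>]]
          tensor_product_bimod[OF bimodule_right[OF bimodule_regular[OF A.ring_axioms]] cpart_bimodule[OF \<alpha>]]
          \<epsilon> left_linear_id ce x_closed[OF \<alpha>]])
  then show ?thesis
    using counit_left[OF \<alpha> c\<alpha>]
    by (simp add: tensor_unit_left_pure[OF bimodule_left[OF cpart_bimodule[OF \<alpha>]] counit_closed[OF ce] x_closed[OF \<alpha>]])
qed

text \<open>Together with the preceding lemma: \<open>a \<mapsto> (a x\<^sub>\<alpha>)\<^sub>\<alpha>\<close> identifies \<open>A\<close> with \<open>G\<^sub>7(C)\<close>.\<close>

lemma ax_coinvariant: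
  assumes a: "a \<in> carrier A"
  shows "(\<lambda>\<alpha>\<in>carrier G. a \<triangleright>\<^bsub>cpart C \<alpha>\<^esub> x \<alpha>) \<in> carrier (G\<^sub>7 (regular_comod C))"
proof -
  have ax: "a \<triangleright>\<^bsub>cpart C \<alpha>\<^esub> x \<alpha> \<in> carrier (cpart C \<alpha>)" "(a \<triangleright>\<^bsub>cpart C \<alpha>\<^esub> x \<alpha>) \<triangleleft>\<^bsub>cpart C \<alpha>\<^esub> \<one>\<^bsub>A\<^esub> = a \<triangleright>\<^bsub>cpart C \<alpha>\<^esub> x \<alpha>"
    "x \<alpha> \<triangleleft>\<^bsub>cpart C \<alpha>\<^esub> \<one>\<^bsub>A\<^esub> = x \<alpha>" if "\<alpha> \<in> carrier G" for \<alpha>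
  proof -
    interpret C\<alpha>: bimodule A A "cpart C \<alpha>" by (rule cpart_bimodule[OF that])
    show "a \<triangleright>\<^bsub>cpart C \<alpha>\<^esub> x \<alpha> \<in> carrier (cpart C \<alpha>)" "(a \<triangleright>\<^bsub>cpart C \<alpha>\<^esub> x \<alpha>) \<triangleleft>\<^bsub>cpart C \<alpha>\<^esub> \<one>\<^bsub>A\<^esub> = a \<triangleright>\<^bsub>cpart C \<alpha>\<^esub> x \<alpha>"
      "x \<alpha> \<triangleleft>\<^bsub>cpart C \<alpha>\<^esub> \<one>\<^bsub>A\<^esub> = x \<alpha>"
      using a x_closed[OF that] by (simp_all add: C\<alpha>.lact_closed C\<alpha>.ract_one)
  qed
  then show ?thesis
    using comult_axb[OF _ _ a A.one_closed] by (simp add: G7_carrier_iff)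
qed

text \<open>The map \<open>s\<close> is \<open>c \<mapsto> (\<epsilon>(c\<^sub>e) \<otimes> 1)\<^sub>\<alpha>\<close>, the identification \<open>G\<^sub>7(C) \<cong> A\<close> followed by the unit of the adjunction at \<open>A\<^sub>B\<close>. The
  comodule morphism \<open>h\<close> that fullness provides is inverse to \<open>can\<close>: faithfulness gives \<open>can \<circ> h = id\<close>, and evaluation at
  \<open>a x\<^sub>\<alpha> b\<close> gives \<open>h \<circ> can = id\<close>.\<close>

lemma G7_fully_faithful_imp_can_iso:
  assumes ff: "G7_fully_faithful TYPE('u) G A B C x i" and U: "infinite (UNIV :: 'u set)"
    and A_small: "carrier A \<lesssim> (UNIV :: 'u set)"
    and C_small: "\<And>\<alpha>. \<alpha> \<in> carrier G \<Longrightarrow> carrier (cpart C \<alpha>) \<lesssim> (UNIV :: 'u set)"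
  shows "can\<^sub>x \<in> coring_iso G A (canonical_coring A B i) C"
proof -
  let ?D = "F7 A B C x i A\<^sub>B" and ?C = "regular_comod C"
  have D_small: "carrier (mpart ?D \<alpha>) \<lesssim> (UNIV :: 'u set)" for \<alpha>
    using tensor_group_lepoll[OF AA_tensor U] A_small by simp
  have C_small': "carrier (mpart ?C \<alpha>) \<lesssim> (UNIV :: 'u set)" if "\<alpha> \<in> carrier G" for \<alpha>
    using C_small[OF that] by simp
  have e: "\<one>\<^bsub>G\<^esub> \<in> carrier G" by simp
  have \<epsilon>: "right_linear A (cpart C \<one>\<^bsub>G\<^esub>) (regular_bimod A) (counit C)"
    using counit_hom by (simp add: bimod_hom_iff)
  define s where "s = (\<lambda>c::'g \<Rightarrow> 'c. \<lambda>\<alpha>\<in>carrier G. counit C (c \<one>\<^bsub>G\<^esub>) \<otimes>\<^sub>B \<one>\<^bsub>A\<^esub>)"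
  have \<epsilon>_closed: "counit C (c \<one>\<^bsub>G\<^esub>) \<in> carrier A" if "c \<in> carrier (G\<^sub>7 ?C)" for c
    using counit_closed G7_component[OF that e] by simp
  have s_closed: "s c \<in> carrier (G\<^sub>7 ?D)" if c: "c \<in> carrier (G\<^sub>7 ?C)" for c
  proof -
    have "x \<beta> \<triangleleft>\<^bsub>cpart C \<beta>\<^esub> \<one>\<^bsub>A\<^esub> = x \<beta>" if "\<beta> \<in> carrier G" for \<beta>
      using right_module.ract_one[OF bimodule_right[OF cpart_bimodule[OF that]] x_closed[OF that]] .
    then show ?thesis
      using \<epsilon>_closed[OF c] by (simp add: G7_carrier_iff s_def D_coact_pure AA_pure_closed del: F7_simps(2))
  qed
  have s_linear: "right_linear B (G\<^sub>7 ?C) (G\<^sub>7 ?D) s"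
  proof -
    have "s (c \<oplus>\<^bsub>G\<^sub>7 ?C\<^esub> c') = s c \<oplus>\<^bsub>G\<^sub>7 ?D\<^esub> s c'" if "c \<in> carrier (G\<^sub>7 ?C)" "c' \<in> carrier (G\<^sub>7 ?C)" for c c'
    proof -
      have "c \<one>\<^bsub>G\<^esub> \<in> carrier (cpart C \<one>\<^bsub>G\<^esub>)" "c' \<one>\<^bsub>G\<^esub> \<in> carrier (cpart C \<one>\<^bsub>G\<^esub>)"
        using G7_component[OF that(1) e] G7_component[OF that(2) e] by simp_all
      then have "counit C (c \<one>\<^bsub>G\<^esub> \<oplus>\<^bsub>cpart C \<one>\<^bsub>G\<^esub>\<^esub> c' \<one>\<^bsub>G\<^esub>) = counit C (c \<one>\<^bsub>G\<^esub>) \<oplus>\<^bsub>A\<^esub> counit C (c' \<one>\<^bsub>G\<^esub>)"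
        using right_linear_add[OF \<epsilon>] by simp
      then show ?thesis
        using \<epsilon>_closed[OF that(1)] \<epsilon>_closed[OF that(2)] by (simp add: s_def fun_eq_iff restrict_def AA_pure_add_left)
    qed
    moreover have "s (c \<triangleleft>\<^bsub>G\<^sub>7 ?C\<^esub> b) = s c \<triangleleft>\<^bsub>G\<^sub>7 ?D\<^esub> b" if c: "c \<in> carrier (G\<^sub>7 ?C)" and b: "b \<in> carrier B" for c b
    proof -
      have "counit C (c \<one>\<^bsub>G\<^esub> \<triangleleft>\<^bsub>cpart C \<one>\<^bsub>G\<^esub>\<^esub> i b) = counit C (c \<one>\<^bsub>G\<^esub>) \<otimes>\<^bsub>A\<^esub> i b"
        using right_linear_ract[OF \<epsilon>, of "c \<one>\<^bsub>G\<^esub>" "i b"] G7_component[OF c e] i_closed[OF b] by simp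
      moreover have "(a \<otimes>\<^bsub>A\<^esub> i b) \<otimes>\<^sub>B \<one>\<^bsub>A\<^esub> = tensor_ract B A\<^sub>r A\<^sub>l (a \<otimes>\<^sub>B \<one>\<^bsub>A\<^esub>) (i b)" if "a \<in> carrier A" for a
        using AA_pure_balanced[OF that b, of "\<one>\<^bsub>A\<^esub>"] that i_closed[OF b] by (simp add: AA_ract_pure)
      ultimately show ?thesis
        using \<epsilon>_closed[OF c] by (simp add: s_def fun_eq_iff restrict_def)
    qed
    ultimately show ?thesis
      using s_closed by (simp add: right_linear_def additive_map_def del: G7_simps)
  qed
  obtain h where h: "h \<in> comod_hom G A C ?C ?D"
    and h_eq: "\<And>c \<alpha>. c \<in> carrier (G\<^sub>7 ?C) \<Longrightarrow> \<alpha> \<in> carrier G \<Longrightarrow> h \<alpha> (c \<alpha>) = s c \<alpha>"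
    using G7_full_small[OF ff regular_comodule D_comodule C_small' D_small s_linear] by blast
  have h_closed: "h \<alpha> c \<in> carrier AA" if "\<alpha> \<in> carrier G" "c \<in> carrier (cpart C \<alpha>)" for \<alpha> c
    using comod_hom_closed[OF h that(1), of c] that(2) by simp
  have can_h: "can\<^sub>x \<alpha> (h \<alpha> c) = c" if \<alpha>: "\<alpha> \<in> carrier G" and c: "c \<in> carrier (cpart C \<alpha>)" for \<alpha> c
  proof -
    obtain g where g: "g \<in> comod_hom G A C ?C ?C"
      and g_eq: "\<And>\<alpha> c. \<alpha> \<in> carrier G \<Longrightarrow> c \<in> carrier (cpart C \<alpha>) \<Longrightarrow> g \<alpha> c = can\<^sub>x \<alpha> (h \<alpha> c)"
      using comod_hom_comp[OF regular_comodule D_comodule regular_comodule h can_comod_hom] h_closed by simp blast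
    interpret R: group_comodule G A C ?C by (rule regular_comodule)
    let ?id = "\<lambda>\<alpha>\<in>carrier G. restrict (\<lambda>c. c) (carrier (mpart ?C \<alpha>))"
    have id: "?id \<in> comod_hom G A C ?C ?C"
      by (rule comod_homI[OF regular_comodule regular_comodule right_linear_id])
         (rule tensor_map_ident[OF R.M_tensor_C R.coact_closed])
    have "g = ?id"
    proof (rule G7_faithful_small[OF ff regular_comodule regular_comodule C_small' C_small' g id])
      fix c \<alpha> assume c: "c \<in> carrier (G\<^sub>7 ?C)" and \<alpha>: "\<alpha> \<in> carrier G"
      interpret C\<alpha>: bimodule A A "cpart C \<alpha>" by (rule cpart_bimodule[OF \<alpha>])
      have c\<alpha>: "c \<alpha> \<in> carrier (cpart C \<alpha>)" using G7_component[OF c \<alpha>] by simp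
      have "g \<alpha> (c \<alpha>) = counit C (c \<one>\<^bsub>G\<^esub>) \<triangleright>\<^bsub>cpart C \<alpha>\<^esub> x \<alpha>"
        using \<alpha> c\<alpha> \<epsilon>_closed[OF c]
        by (simp add: g_eq h_eq[OF c \<alpha>] s_def can_pure C\<alpha>.ract_one C\<alpha>.lact_closed x_closed)
      then show "g \<alpha> (c \<alpha>) = ?id \<alpha> (c \<alpha>)"
        using \<alpha> c\<alpha> regular_coinvariant_eq[OF c \<alpha>] by simp
    qed
    then show ?thesis using g_eq[OF \<alpha> c] \<alpha> c by simp
  qed
  have h_can: "h \<alpha> (can\<^sub>x \<alpha> t) = t" if \<alpha>: "\<alpha> \<in> carrier G" and t: "t \<in> carrier AA" for \<alpha> t
  proof -
    interpret C\<alpha>: bimodule A A "cpart C \<alpha>" by (rule cpart_bimodule[OF \<alpha>])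
    have h_lin: "right_linear A (cpart C \<alpha>) (tensor_rmod B A\<^sub>r A\<^sub>l) (h \<alpha>)"
      using comod_hom_right_linear[OF h \<alpha>] by simp
    have h_additive: "additive_map (cpart C \<alpha>) AA (h \<alpha>)"
      using right_linear_additive[OF h_lin] by simp
    have "additive_map AA AA (\<lambda>t. t)" by (simp add: additive_map_def)
    then show ?thesis
    proof (rule AA_eqI[OF additive_map_comp[OF can_additive[OF \<alpha>] h_additive] _ _ t])
      fix a b assume a: "a \<in> carrier A" and b: "b \<in> carrier A"
      have "counit C (a \<triangleright>\<^bsub>cpart C \<one>\<^bsub>G\<^esub>\<^esub> x \<one>\<^bsub>G\<^esub>) = a"
      proof -
        interpret Ce: bimodule A A "cpart C \<one>\<^bsub>G\<^esub>" by (rule cpart_bimodule[OF e])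
        show ?thesis using counit_axb[OF a A.one_closed] a by (simp add: Ce.ract_one Ce.lact_closed x_closed)
      qed
      then have "h \<alpha> (a \<triangleright>\<^bsub>cpart C \<alpha>\<^esub> x \<alpha>) = a \<otimes>\<^sub>B \<one>\<^bsub>A\<^esub>"
        using h_eq[OF ax_coinvariant[OF a] \<alpha>] \<alpha> by (simp add: s_def)
      then show "h \<alpha> (can\<^sub>x \<alpha> (a \<otimes>\<^sub>B b)) = a \<otimes>\<^sub>B b"
        using a b \<alpha>
        by (simp add: can_pure right_linear_ract[OF h_lin] C\<alpha>.lact_closed x_closed AA_ract_pure)
    qed
  qed
  show ?thesis
    by (rule coring_isoI[where k = h])
       (use additive_map_closed[OF canonical_comult_additive] can_coring_hom in
         \<open>simp_all add: G.group_axioms canonical_coring_simps(1) D_bimodule cpart_bimodule h_closed can_h h_can\<close>)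
qed

end

theorem proposition5p7:
  fixes G :: "'g monoid" and A :: "'a ring" and B :: "'b ring"
    and C :: "('g, 'a, 'c) coring" and x :: "'g \<Rightarrow> 'c" and i :: "'b \<Rightarrow> 'a"
  assumes "group_coring G A C"
    and "grouplike_family G A C x"
    and "ring B"
    and "i \<in> ring_hom B (coinvariants G A C x)"
    and "infinite (UNIV :: 'u set)"
    and "carrier A \<lesssim> (UNIV :: 'u set)"
    and "carrier B \<lesssim> (UNIV :: 'u set)"
    and "\<And>\<alpha>. \<alpha> \<in> carrier G \<Longrightarrow> carrier (cpart C \<alpha>) \<lesssim> (UNIV :: 'u set)"
  shows "(F7_fully_faithful TYPE('u) G A B C x i \<longrightarrow> i \<in> ring_iso B (coinvariants G A C x))
    \<and> (G7_fully_faithful TYPE('u) G A B C x i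
        \<longrightarrow> can G A B C x i \<in> coring_iso G A (canonical_coring A B i) C)"
proof -
  interpret grouplike_coring G A C B x i
    by (intro grouplike_coring.intro grouplike_coring_axioms.intro assms)
  show ?thesis
    using F7_fully_faithful_imp_iso[OF _ assms(7)] G7_fully_faithful_imp_can_iso[OF _ assms(5,6,8)] by blast
qed

end
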